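(* Let $X$ be a real algebraic set and let $X'$ be its normalization. Let $Y$ be any real algebraic set equipped with a finite birational map $\pi:Y\to X$. Then $\pi^{-1}$ is hereditarily rational on the center of $X$ if and only if the seminormalization map relative to the central locus $\pi^{s_c}:X^{s_c}\to X$ factorizes through $\pi$ (i.e. $\pi^{s_c}=\pi\circ\psi$ for some polynomial map $\psi:X^{s_c}\to Y$).
   Context: A real algebraic set is the zero set $X\subset\mathbb R^n$ of a family of polynomials; $\mathcal P(X)=\mathbb R[x_1,\dots,x_n]/\mathcal I(X)$ is its ring of polynomial functions, and maps between real algebraic sets are polynomial maps unless specified. $\mathcal K(X)$ is the total ring of fractions of $\mathcal P(X)$ (the ring of rational functions on $X$). A rational function is regular on a Zariski-dense open $U\subset X$ if it equals $p/q$ on $U$ with $p,q$ polynomials and $q$ nowhere zero on $U$. A polynomial map $\pi:Y\to X$ is finite if it makes $\mathcal P(Y)$ a finite $\mathcal P(X)$-module, and birational if it induces an isomorphism from a Zariski-dense open subset of $Y$ onto one of $X$. The normalization $X'$ is the real algebraic set whose ring of polynomial functions is the integral closure of $\mathcal P(X)$ in $\mathcal K(X)$. Central locus: if $X$ is irreducible, $\mathrm{Cent}\,X$ is the Euclidean closure in $X$ of the set of nonsingular points of $X$; if $X$ has irreducible components $X_1,\dots,X_t$, $\mathrm{Cent}\,X=\bigcup_i\mathrm{Cent}\,X_i$. An irreducible algebraic subset $V\subset X$ is central in $X$ if the Zariski closure of $V\cap\mathrm{Cent}\,X$ is $V$. $\mathcal K^0(\mathrm{Cent}\,X)$ is the ring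 of continuous (Euclidean topology) functions $f:\mathrm{Cent}\,X\to\mathbb R$ for which there are a Zariski-dense open $U\subset X$ and a regular function $g$ on $U$ with $f=g$ on $U\cap\mathrm{Cent}\,X$; it injects canonically in $\mathcal K(X)$. $\mathcal R^0(\mathrm{Cent}\,X)$, the ring of hereditarily rational functions on $\mathrm{Cent}\,X$, is the subring of those $f\in\mathcal K^0(\mathrm{Cent}\,X)$ such that for every irreducible algebraic subset $V$ central in $X$ there are a Zariski-dense open $W\subset V$ and a rational function $g$ on $V$, regular on $W$, with $f=g$ on $W\cap\mathrm{Cent}\,X$. For a finite birational $\pi:Y\to X$ with $Y\subset\mathbb R^m$, "$\pi^{-1}$ is hereditarily rational on the center of $X$" means that the rational map $\pi^{-1}$ extends to a map on $\mathrm{Cent}\,X$ all of whose components are in $\mathcal R^0(\mathrm{Cent}\,X)$. The seminormalization of $X$ relative to its central locus, $X^{s_c}$, is the real algebraic set whose ring of polynomial functions is the integral closure of $\mathcal P(X)$ in $\mathcal R^0(\mathrm{Cent}\,X)$ (a subring of $\mathcal P(X')$), and $\pi^{s_c}:X^{s_c}\to X$ is the finite birational map induced by the inclusion $\mathcal P(X)\subset\mathcal P(X^{s_c})$. *)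

theory Defs
  imports "HOL-Analysis.Analysis" "HOL-Algebra.QuotRing"
begin

section \<open>Real algebraic sets and the Zariski topology\<close>

text \<open>A polynomial in $n$ variables with real coefficients is identified with the function it
  defines on $\mathbb{R}^n$, i.e. with a library \<^const>\<open>real_polynomial_function\<close>; this is
  harmless because $\mathbb{R}$ is infinite.\<close>

definition real_algebraic :: "(real^'n) set \<Rightarrow> bool" where
  "real_algebraic X \<longleftrightarrow>
     (\<exists>P. (\<forall>p\<in>P. real_polynomial_function p) \<and> X = {x. \<forall>p\<in>P. p x = 0})"

definition vanishing_ideal :: "(real^'n) set \<Rightarrow> (real^'n \<Rightarrow> real) set" where
  "vanishing_ideal X = {p. real_polynomial_function p \<and> (\<forall>x\<in>X. p x = 0)}"

definition zariski :: "(real^'n) topology" where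
  "zariski = topology (\<lambda>U. real_algebraic (- U))"

lemma real_algebraic_iff_vanishing_ideal:
  "real_algebraic X \<longleftrightarrow> X = {x. \<forall>p\<in>vanishing_ideal X. p x = 0}"
proof
  assume "real_algebraic X"
  then obtain P where P: "\<forall>p\<in>P. real_polynomial_function p" "X = {x. \<forall>p\<in>P. p x = 0}"
    unfolding real_algebraic_def by (elim exE conjE)
  have "P \<subseteq> vanishing_ideal X"
    unfolding vanishing_ideal_def using P by simp blast
  then have "x \<in> X" if "\<forall>p\<in>vanishing_ideal X. p x = 0" for x
    using that by (subst P(2)) blast
  moreover have "p x = 0" if "x \<in> X" "p \<in> vanishing_ideal X" for x p
    using that unfolding vanishing_ideal_def by simp
  ultimately show "X = {x. \<forall>p\<in>vanishing_ideal X. p x = 0}"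
    by blast
next
  assume "X = {x. \<forall>p\<in>vanishing_ideal X. p x = 0}"
  moreover have "\<forall>p\<in>vanishing_ideal X. real_polynomial_function p"
    unfolding vanishing_ideal_def by simp
  ultimately show "real_algebraic X"
    unfolding real_algebraic_def by (intro exI[of _ "vanishing_ideal X"] conjI)
qed

lemma real_algebraic_Inter:
  assumes "\<And>A. A \<in> K \<Longrightarrow> real_algebraic A"
  shows "real_algebraic (\<Inter>K)"
proof -
  let ?P = "\<Union>A\<in>K. vanishing_ideal A"
  have "\<forall>p\<in>?P. real_polynomial_function p"
    unfolding vanishing_ideal_def by simp
  moreover have "x \<in> A \<longleftrightarrow> (\<forall>p\<in>vanishing_ideal A. p x = 0)" if "A \<in> K" for A x
    using assms[OF that] unfolding real_algebraic_iff_vanishing_ideal by blast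
  then have "\<Inter>K = {x. \<forall>p\<in>?P. p x = 0}"
    by (simp add: set_eq_iff)
  ultimately show ?thesis
    unfolding real_algebraic_def by (intro exI[of _ ?P] conjI)
qed

lemma real_algebraic_Un:
  assumes "real_algebraic A" "real_algebraic B"
  shows "real_algebraic (A \<union> B)"
proof -
  obtain P where P: "\<forall>p\<in>P. real_polynomial_function p" "A = {x. \<forall>p\<in>P. p x = 0}"
    using assms(1) unfolding real_algebraic_def by blast
  obtain Q where Q: "\<forall>q\<in>Q. real_polynomial_function q" "B = {x. \<forall>q\<in>Q. q x = 0}"
    using assms(2) unfolding real_algebraic_def by blast
  define R where "R = (\<lambda>(p, q) x. p x * q x) ` (P \<times> Q)"
  have "real_polynomial_function r" if "r \<in> R" for r
  proof -
    obtain p q where "p \<in> P" "q \<in> Q" "r = (\<lambda>x. p x * q x)"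
      using \<open>r \<in> R\<close> unfolding R_def by auto
    then show ?thesis
      using P(1) Q(1) real_polynomial_function.intros(4)[of p q] by simp
  qed
  moreover have "x \<in> A \<union> B \<longleftrightarrow> (\<forall>r\<in>R. r x = 0)" for x
  proof -
    have "(\<forall>r\<in>R. r x = 0) \<longleftrightarrow> (\<forall>p\<in>P. \<forall>q\<in>Q. p x = 0 \<or> q x = 0)"
      unfolding R_def by simp
    then show ?thesis
      unfolding P(2) Q(2) by blast
  qed
  then have "A \<union> B = {x. \<forall>r\<in>R. r x = 0}"
    by blast
  ultimately show ?thesis
    unfolding real_algebraic_def by (intro exI[of _ R] conjI ballI)
qed

lemma istopology_zariski: "istopology (\<lambda>U. real_algebraic (- U))"
  unfolding istopology_def
proof (intro conjI allI impI)
  fix S T :: "(real^'n) set"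
  assume "real_algebraic (- S)" "real_algebraic (- T)"
  then show "real_algebraic (- (S \<inter> T))"
    by (simp add: real_algebraic_Un)
next
  fix K :: "(real^'n) set set"
  assume "\<forall>S\<in>K. real_algebraic (- S)"
  then have "real_algebraic (\<Inter>(uminus ` K))"
    by (intro real_algebraic_Inter) auto
  then show "real_algebraic (- \<Union>K)"
    by (simp add: uminus_Sup)
qed

lemma openin_zariski: "openin zariski U \<longleftrightarrow> real_algebraic (- U)"
  unfolding zariski_def by (simp add: topology_inverse'[OF istopology_zariski])

lemma topspace_zariski [simp]: "topspace (zariski :: (real^'n) topology) = UNIV"
proof -
  have "real_algebraic ({} :: (real^'n) set)"
    unfolding real_algebraic_def
    by (intro exI[of _ "{\<lambda>x. 1}"] conjI) (simp_all add: real_polynomial_function.intros(2))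
  then have "openin zariski (UNIV :: (real^'n) set)"
    by (simp add: openin_zariski)
  from openin_subset[OF this] show ?thesis
    by (rule top_le)
qed

lemma closedin_zariski: "closedin zariski X \<longleftrightarrow> real_algebraic X"
  unfolding closedin_def openin_zariski topspace_zariski Compl_eq_Diff_UNIV[symmetric]
  by simp

definition zariski_dense_open :: "(real^'n) set \<Rightarrow> (real^'n) set \<Rightarrow> bool" where
  "zariski_dense_open U X \<longleftrightarrow>
     openin (subtopology zariski X) U \<and> subtopology zariski X closure_of U = X"

definition irreducible_algebraic :: "(real^'n) set \<Rightarrow> bool" where
  "irreducible_algebraic V \<longleftrightarrow> real_algebraic V \<and> V \<noteq> {} \<and>
     (\<forall>A B. real_algebraic A \<and> real_algebraic B \<and> V = A \<union> B \<longrightarrow> V = A \<or> V = B)"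

definition irreducible_components :: "(real^'n) set \<Rightarrow> (real^'n) set set" where
  "irreducible_components X = {V. irreducible_algebraic V \<and> V \<subseteq> X \<and>
     (\<forall>W. irreducible_algebraic W \<and> V \<subseteq> W \<and> W \<subseteq> X \<longrightarrow> W = V)}"


section \<open>Polynomial maps, regular functions, finite and birational maps\<close>

text \<open>Only the values on \<open>Y\<close> of a map out of \<open>Y\<close> are relevant.\<close>

definition polynomial_map :: "(real^'m) set \<Rightarrow> (real^'n) set \<Rightarrow> (real^'m \<Rightarrow> real^'n) \<Rightarrow> bool" where
  "polynomial_map Y X f \<longleftrightarrow>
     (\<exists>q. polynomial_function q \<and> (\<forall>y\<in>Y. f y = q y)) \<and> f ` Y \<subseteq> X"

definition regular_on :: "(real^'n) set \<Rightarrow> (real^'n \<Rightarrow> real) \<Rightarrow> bool" where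
  "regular_on U g \<longleftrightarrow>
     (\<exists>p q. real_polynomial_function p \<and> real_polynomial_function q \<and>
        (\<forall>x\<in>U. q x \<noteq> 0 \<and> g x = p x / q x))"

definition finite_map :: "(real^'m) set \<Rightarrow> (real^'n) set \<Rightarrow> (real^'m \<Rightarrow> real^'n) \<Rightarrow> bool" where
  "finite_map Y X f \<longleftrightarrow> polynomial_map Y X f \<and>
     (\<exists>(r::nat) g. (\<forall>i<r. real_polynomial_function (g i)) \<and>
        (\<forall>p. real_polynomial_function p \<longrightarrow>
           (\<exists>a. (\<forall>i<r. real_polynomial_function (a i)) \<and>
              (\<forall>y\<in>Y. p y = (\<Sum>i<r. a i (f y) * g i y)))))"

text \<open>\<open>f\<close> restricts to an isomorphism (biregular bijection) from \<open>V\<close> onto \<open>U\<close>. The restriction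
  of a polynomial map is itself regular, so only the inverse carries a condition.\<close>

definition iso_onto :: "(real^'m \<Rightarrow> real^'n) \<Rightarrow> (real^'m) set \<Rightarrow> (real^'n) set \<Rightarrow> bool" where
  "iso_onto f V U \<longleftrightarrow> bij_betw f V U \<and> (\<forall>j. regular_on U (\<lambda>x. inv_into V f x $ j))"

definition birational_map :: "(real^'m) set \<Rightarrow> (real^'n) set \<Rightarrow> (real^'m \<Rightarrow> real^'n) \<Rightarrow> bool" where
  "birational_map Y X f \<longleftrightarrow> polynomial_map Y X f \<and>
     (\<exists>V U. zariski_dense_open V Y \<and> zariski_dense_open U X \<and> iso_onto f V U)"


section \<open>Nonsingular points and the central locus\<close>

text \<open>The monomials in \<open>f 0, \<dots>, f (d - 1)\<close>, indexed by exponent vectors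
  $\alpha \in \mathbb{N}^d$, are linearly independent over $\mathbb{R}$ as functions on \<open>U\<close>.\<close>

definition algebraically_independent_on ::
  "(real^'n) set \<Rightarrow> nat \<Rightarrow> (nat \<Rightarrow> real^'n \<Rightarrow> real) \<Rightarrow> bool" where
  "algebraically_independent_on U d f \<longleftrightarrow>
     (\<forall>A c. finite A \<and> A \<subseteq> ({..<d} \<rightarrow>\<^sub>E (UNIV :: nat set)) \<and>
        (\<forall>x\<in>U. (\<Sum>\<alpha>\<in>A. c \<alpha> * (\<Prod>i<d. f i x ^ \<alpha> i)) = (0::real)) \<longrightarrow> (\<forall>\<alpha>\<in>A. c \<alpha> = 0))"

text \<open>The dimension of an irreducible \<open>X\<close> is the transcendence degree over $\mathbb{R}$ of its
  field $\mathcal{K}(X)$ of rational functions: finitely many elements of $\mathcal{K}(X)$ are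
  functions regular on a common Zariski-dense open set \<open>U\<close>.\<close>

definition algebraic_dim :: "(real^'n) set \<Rightarrow> nat" where
  "algebraic_dim X = (GREATEST d. \<exists>U f. zariski_dense_open U X \<and>
     (\<forall>i<d. regular_on U (f i)) \<and> algebraically_independent_on U d f)"

definition zariski_tangent_space :: "(real^'n) set \<Rightarrow> real^'n \<Rightarrow> (real^'n) set" where
  "zariski_tangent_space X x =
     {v. \<forall>p\<in>vanishing_ideal X. frechet_derivative p (at x) v = 0}"

text \<open>The Jacobian criterion: for generators $p_1, \dots, p_k$ of the vanishing ideal, the
  condition says that $(\partial p_i / \partial x_j)(x)$ has rank $n - \dim X$.\<close>

definition nonsingular_points :: "(real^'n) set \<Rightarrow> (real^'n) set" where
  "nonsingular_points X = {x\<in>X. dim (zariski_tangent_space X x) = algebraic_dim X}"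

definition Cent :: "(real^'n) set \<Rightarrow> (real^'n) set" where
  "Cent X = (\<Union>V\<in>irreducible_components X. V \<inter> closure (nonsingular_points V))"

definition central_in :: "(real^'n) set \<Rightarrow> (real^'n) set \<Rightarrow> bool" where
  "central_in V X \<longleftrightarrow> zariski closure_of (V \<inter> Cent X) = V"


section \<open>Rings of functions and the seminormalization\<close>

text \<open>A set \<open>F\<close> of functions on \<open>S\<close> (extensional outside \<open>S\<close>) with the pointwise operations.\<close>

definition function_ring :: "'a set \<Rightarrow> ('a \<Rightarrow> real) set \<Rightarrow> ('a \<Rightarrow> real) ring" where
  "function_ring S F =
     \<lparr>carrier = F,
      monoid.mult = (\<lambda>f g. \<lambda>x\<in>S. f x * g x),
      one = (\<lambda>x\<in>S. 1),
      zero = (\<lambda>x\<in>S. 0),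
      add = (\<lambda>f g. \<lambda>x\<in>S. f x + g x)\<rparr>"

text \<open>$\mathcal{P}(X) = \mathbb{R}[x_1,\dots,x_n]/\mathcal{I}(X)$, as restrictions of polynomials
  to \<open>X\<close>.\<close>

definition polynomial_ring :: "(real^'n) set \<Rightarrow> (real^'n \<Rightarrow> real) ring" where
  "polynomial_ring X =
     function_ring X {restrict p X | p. real_polynomial_function p}"

definition K0 :: "(real^'n) set \<Rightarrow> (real^'n \<Rightarrow> real) set" where
  "K0 X = {f \<in> extensional (Cent X). continuous_on (Cent X) f \<and>
     (\<exists>U g. zariski_dense_open U X \<and> regular_on U g \<and> (\<forall>x\<in>U \<inter> Cent X. f x = g x))}"

definition R0 :: "(real^'n) set \<Rightarrow> (real^'n \<Rightarrow> real) set" where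
  "R0 X = {f \<in> K0 X. \<forall>V. irreducible_algebraic V \<and> V \<subseteq> X \<and> central_in V X \<longrightarrow>
     (\<exists>W g. zariski_dense_open W V \<and> regular_on W g \<and> (\<forall>x\<in>W \<inter> Cent X. f x = g x))}"

text \<open>$\mathcal{P}(X)$ maps to $\mathcal{R}^0(\mathrm{Cent}\,X)$ by restriction, so the
  coefficients of an integral equation are represented by polynomials on the ambient space.\<close>

definition integral_closure_R0 :: "(real^'n) set \<Rightarrow> (real^'n \<Rightarrow> real) set" where
  "integral_closure_R0 X = {f \<in> R0 X. \<exists>(d::nat) a. (\<forall>i<d. real_polynomial_function (a i)) \<and>
     (\<forall>x\<in>Cent X. f x ^ d + (\<Sum>i<d. a i x * f x ^ i) = 0)}"

text \<open>The seminormalization relative to the central locus is determined only up to isomorphism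
  over \<open>X\<close>, hence a predicate: \<open>(Z, \<rho>)\<close> is a model of it when the ring of polynomial functions
  of \<open>Z\<close> is identified by some \<open>\<Phi>\<close> with the integral closure, in such a way that
  $p \mapsto p \circ \rho$ becomes the inclusion of $\mathcal{P}(X)$.\<close>

definition is_seminormalization_cent ::
  "(real^'n) set \<Rightarrow> (real^'k) set \<Rightarrow> (real^'k \<Rightarrow> real^'n) \<Rightarrow> bool" where
  "is_seminormalization_cent X Z \<rho> \<longleftrightarrow> real_algebraic Z \<and> polynomial_map Z X \<rho> \<and>
     (\<exists>\<Phi> \<in> ring_iso (polynomial_ring Z) (function_ring (Cent X) (integral_closure_R0 X)).
        \<forall>p. real_polynomial_function p \<longrightarrow> \<Phi> (restrict (p \<circ> \<rho>) Z) = restrict p (Cent X))"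

text \<open>\<open>f\<close> extends the rational map $\pi^{-1}$, which is the inverse of \<open>\<pi>\<close> over a Zariski-dense
  open set \<open>U\<close>, to the whole central locus.\<close>

definition inverse_hereditarily_rational ::
  "(real^'m) set \<Rightarrow> (real^'n) set \<Rightarrow> (real^'m \<Rightarrow> real^'n) \<Rightarrow> bool" where
  "inverse_hereditarily_rational Y X \<pi> \<longleftrightarrow>
     (\<exists>f. (\<forall>j. restrict (\<lambda>x. f x $ j) (Cent X) \<in> R0 X) \<and>
        (\<exists>V U. zariski_dense_open V Y \<and> zariski_dense_open U X \<and> iso_onto \<pi> V U \<and>
           (\<forall>x\<in>U \<inter> Cent X. f x = inv_into V \<pi> x)))"

end

theory Submission
  imports Defs "HOL-Library.Function_Algebras" "HOL-Computational_Algebra.Polynomial"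
begin

text \<open>Let \<open>C\<close> be the central locus of \<open>X\<close>. The ring of polynomial functions on the seminormalization is
identified with the integral closure of the polynomial functions of \<open>X\<close> in the hereditarily rational
functions on \<open>C\<close>; this identification \<open>\<Psi>\<close> is a homomorphism of real algebras and therefore
commutes with substitution into polynomials (\<open>polynomial_substitution\<close>).

If the seminormalization map factors as \<open>\<pi> \<circ> \<psi>\<close>, the images under \<open>\<Psi>\<close> of the
coordinates of \<open>\<psi>\<close> are the components of a map \<open>f\<close> on \<open>C\<close>. Since \<open>\<Psi>\<close>
preserves polynomial relations, \<open>f\<close> has values in \<open>Y\<close> and \<open>\<pi> \<circ> f\<close> is the
identity. Over the open set on which \<open>\<pi>\<close> is invertible, a point of \<open>Y\<close> is determined by its
image (\<open>inverse_on_dense_open\<close>), so \<open>f\<close> extends the inverse of \<open>\<pi>\<close>.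

Conversely, let \<open>f\<close> extend the inverse of \<open>\<pi>\<close>. Its components satisfy integral equations
because \<open>\<pi>\<close> is finite, so they are images under \<open>\<Psi>\<close> of polynomial functions, and these
make up the required \<open>\<psi>\<close>. But the integral equations, the relations that say that \<open>f\<close> maps
into \<open>Y\<close>, and \<open>\<pi> \<circ> f = id\<close> are known only over a Zariski-dense open set \<open>U\<close>. They
extend to \<open>C\<close> by continuity, provided that \<open>U \<inter> C\<close> is dense in \<open>C\<close> for the Euclidean
topology (\<open>dense_open_dense_in_Cent\<close>). This density is the substance of the proof.

It reduces to a statement about a nonsingular point \<open>c\<close> of an irreducible set \<open>V\<close> of dimension
\<open>d\<close> in \<open>n\<close>-space (\<open>nonsingular_local\<close>): a polynomial that vanishes on \<open>V\<close> near \<open>c\<close>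
vanishes on all of \<open>V\<close>, and the points of \<open>V\<close> near \<open>c\<close> are nonsingular. Let \<open>I\<close> be
the vanishing ideal of \<open>V\<close>. Choose \<open>n - d\<close> elements \<open>p\<^sub>b\<close> of \<open>I\<close> whose differentials at
\<open>c\<close> form a basis of the differentials of \<open>I\<close>, and let \<open>J\<close> consist of all polynomials
\<open>h\<close> such that \<open>u h\<close> lies in the ideal \<open>(p\<^sub>b)\<close> for some \<open>u\<close> with \<open>u(c) \<noteq> 0\<close>.
Then \<open>J \<subseteq> I\<close> because \<open>I\<close> is prime, and everything follows from \<open>J = I\<close>: this equality
says that \<open>V\<close> agrees near \<open>c\<close> with the common zero set of the \<open>p\<^sub>b\<close>, and \<open>J\<close> is the
ideal of polynomials that vanish on that zero set near \<open>c\<close>.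

Two facts give \<open>J = I\<close>. First, \<open>J\<close> is prime. By Krull's intersection theorem
(\<open>krull_intersection_at_point\<close>) a polynomial outside \<open>J\<close> has, modulo \<open>(p\<^sub>b)\<close>, a nonzero
initial form on the tangent space; this form dominates the polynomial along suitable curves in the zero
set of the \<open>p\<^sub>b\<close>, and a product of nonzero forms is nonzero (\<open>prime_filter_germ\<close>). Secondly, the
number of functions that are algebraically independent modulo a prime ideal is at most the dimension of
the kernel of differentials of elements of the ideal at generic points
(\<open>independent_functions_le_tangent_dim\<close>); for \<open>J\<close> this bound is \<open>d\<close>. If some \<open>g\<close> in
\<open>I\<close> were not in \<open>J\<close>, then \<open>g\<close> together with \<open>d\<close> functions that are independent on
\<open>V\<close> would be \<open>d + 1\<close> functions independent modulo \<open>J\<close>.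

Hilbert's basis theorem is the finiteness tool throughout: for decomposition into irreducible sets, for
Krull's theorem (applied to a Rees algebra), and for integral equations (applied to a ring
with extra variables, which replaces the usual determinant argument).\<close>

section \<open>Hilbert's basis theorem\<close>

text \<open>Subrings are sets of elements of an ambient ring, so that rings generated by varying lists of
functions all live in one type.\<close>

definition subring_set :: "'a::comm_ring_1 set \<Rightarrow> bool" where
  "subring_set S \<longleftrightarrow> 1 \<in> S \<and> (\<forall>a\<in>S. \<forall>b\<in>S. a + b \<in> S \<and> a * b \<in> S) \<and> (\<forall>a\<in>S. - a \<in> S)"

lemma subring_setD:
  assumes "subring_set S"
  shows "1 \<in> S" "0 \<in> S" "a \<in> S \<Longrightarrow> b \<in> S \<Longrightarrow> a + b \<in> S" "a \<in> S \<Longrightarrow> b \<in> S \<Longrightarrow> a * b \<in> S"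
    "a \<in> S \<Longrightarrow> - a \<in> S" "a \<in> S \<Longrightarrow> b \<in> S \<Longrightarrow> a - b \<in> S"
proof -
  have 1: "1 \<in> S" and m: "\<And>a. a \<in> S \<Longrightarrow> - a \<in> S" and p: "\<And>a b. a \<in> S \<Longrightarrow> b \<in> S \<Longrightarrow> a + b \<in> S"
    and t: "\<And>a b. a \<in> S \<Longrightarrow> b \<in> S \<Longrightarrow> a * b \<in> S"
    using assms unfolding subring_set_def by auto
  show "1 \<in> S" by fact
  show "0 \<in> S" using p[OF 1 m[OF 1]] by simp
  show "a \<in> S \<Longrightarrow> b \<in> S \<Longrightarrow> a + b \<in> S" "a \<in> S \<Longrightarrow> b \<in> S \<Longrightarrow> a * b \<in> S" "a \<in> S \<Longrightarrow> - a \<in> S"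
    by fact+
  show "a \<in> S \<Longrightarrow> b \<in> S \<Longrightarrow> a - b \<in> S" using p[of a "-b"] m[of b] by simp
qed

lemma subring_set_sum:
  assumes "subring_set S" "\<And>i. i \<in> I \<Longrightarrow> f i \<in> S"
  shows "sum f I \<in> S"
  using assms(2) by (induction I rule: infinite_finite_induct) (auto simp: subring_setD[OF assms(1)])

lemma subring_set_power:
  assumes "subring_set S" "a \<in> S"
  shows "a ^ n \<in> S"
  by (induction n) (auto simp: subring_setD[OF assms(1)] assms(2))

inductive_set generated_ideal :: "'a::comm_ring_1 set \<Rightarrow> 'a set \<Rightarrow> 'a set"
  for S A where
    zero: "0 \<in> generated_ideal S A"
  | step: "a \<in> A \<Longrightarrow> s \<in> S \<Longrightarrow> u \<in> generated_ideal S A \<Longrightarrow> s * a + u \<in> generated_ideal S A"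

lemma generated_ideal_base:
  assumes "subring_set S" "a \<in> A"
  shows "a \<in> generated_ideal S A"
  using generated_ideal.step[OF assms(2) subring_setD(1)[OF assms(1)] generated_ideal.zero] by simp

lemma generated_ideal_add:
  assumes "x \<in> generated_ideal S A" "y \<in> generated_ideal S A"
  shows "x + y \<in> generated_ideal S A"
  using assms(1)
proof induction
  case (step a s u)
  then show ?case using generated_ideal.step[of a A s S "u + y"] by (simp add: add.assoc)
qed (use assms(2) in simp)

lemma generated_ideal_mult:
  assumes "subring_set S" "s \<in> S" "x \<in> generated_ideal S A"
  shows "s * x \<in> generated_ideal S A"
  using assms(3)
proof induction
  case (step a r u)
  then show ?case using generated_ideal.step[of a A "s * r" S "s * u"] subring_setD(4)[OF assms(1,2), of r]
    by (simp add: algebra_simps)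
qed (simp add: generated_ideal.zero)

lemma generated_ideal_diff:
  assumes "subring_set S" "x \<in> generated_ideal S A" "y \<in> generated_ideal S A"
  shows "x - y \<in> generated_ideal S A"
proof -
  have "(-1) * y \<in> generated_ideal S A"
    using generated_ideal_mult[OF assms(1) _ assms(3), of "-1"] subring_setD[OF assms(1)] by simp
  from generated_ideal_add[OF assms(2) this] show ?thesis by simp
qed

lemma generated_ideal_sum:
  assumes "\<And>i. i \<in> I \<Longrightarrow> f i \<in> generated_ideal S A"
  shows "sum f I \<in> generated_ideal S A"
  using assms
  by (induction I rule: infinite_finite_induct)
     (auto simp: generated_ideal.zero generated_ideal_add)

lemma generated_ideal_subset_ring:
  assumes "subring_set S" "A \<subseteq> S"
  shows "generated_ideal S A \<subseteq> S"
proof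
  fix x assume "x \<in> generated_ideal S A"
  then show "x \<in> S"
    by induction (use assms in \<open>auto simp: subring_setD\<close>)
qed

lemma generated_ideal_least:
  assumes "subring_set S" "A \<subseteq> generated_ideal S B"
  shows "generated_ideal S A \<subseteq> generated_ideal S B"
proof
  fix x assume "x \<in> generated_ideal S A"
  then show "x \<in> generated_ideal S B"
    by induction (use assms in \<open>auto intro: generated_ideal.zero generated_ideal_add generated_ideal_mult\<close>)
qed

lemma generated_ideal_mono: "A \<subseteq> B \<Longrightarrow> generated_ideal S A \<subseteq> generated_ideal S B"
proof
  fix x assume "A \<subseteq> B" "x \<in> generated_ideal S A"
  from this(2,1) show "x \<in> generated_ideal S B"
    by induction (auto intro: generated_ideal.intros)
qed

lemma generated_ideal_finite_subset:
  assumes "x \<in> generated_ideal S A"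
  shows "\<exists>B. finite B \<and> B \<subseteq> A \<and> x \<in> generated_ideal S B"
  using assms
proof induction
  case zero
  show ?case by (intro exI[of _ "{}"]) (auto intro: generated_ideal.zero)
next
  case (step a s u)
  then obtain B where B: "finite B" "B \<subseteq> A" "u \<in> generated_ideal S B" by blast
  have "u \<in> generated_ideal S (insert a B)"
    using B(3) generated_ideal_mono[of B "insert a B"] by blast
  then show ?case using B step
    by (intro exI[of _ "insert a B"]) (auto intro: generated_ideal.step)
qed

lemma generated_ideal_image:
  assumes "subring_set S" "finite I" "x \<in> generated_ideal S (f ` I)"
  shows "\<exists>u. (\<forall>i. u i \<in> S) \<and> x = (\<Sum>i\<in>I. u i * f i)"
  using assms(3)
proof induction
  case zero
  show ?case by (intro exI[of _ "\<lambda>_. 0"]) (auto simp: subring_setD[OF assms(1)])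
next
  case (step a s u)
  then obtain v i where v: "\<forall>i. v i \<in> S" "u = (\<Sum>i\<in>I. v i * f i)" and i: "i \<in> I" "a = f i" by blast
  have "(\<Sum>j\<in>I. (v j + (if j = i then s else 0)) * f j) = u + s * a"
    using i assms(2) by (simp add: v(2) distrib_right sum.distrib if_distrib[of "\<lambda>x. x * _"] sum.delta cong: if_cong)
  then show ?case using step v(1)
    by (intro exI[of _ "\<lambda>j. v j + (if j = i then s else 0)"])
       (auto simp: subring_setD[OF assms(1)] add.commute)
qed

lemma generated_ideal_sum_mem:
  assumes "subring_set S" "\<And>i. i \<in> I \<Longrightarrow> u i \<in> S" "\<And>i. i \<in> I \<Longrightarrow> f i \<in> A"
  shows "(\<Sum>i\<in>I. u i * f i) \<in> generated_ideal S A"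
  by (intro generated_ideal_sum generated_ideal_mult generated_ideal_base) (use assms in auto)

text \<open>The finite generating set is required to be a subset of \<open>A\<close>; this form yields the ascending chain
condition for sequences directly.\<close>

definition noetherian_set :: "'a::comm_ring_1 set \<Rightarrow> bool" where
  "noetherian_set S \<longleftrightarrow> (\<forall>A\<subseteq>S. \<exists>B\<subseteq>A. finite B \<and> A \<subseteq> generated_ideal S B)"

lemma noetherian_set_sequence:
  assumes "noetherian_set S" "subring_set S" "\<And>i. f i \<in> S"
  shows "\<exists>N. \<forall>n. f n \<in> generated_ideal S (f ` {..<N::nat})"
proof -
  obtain B where B: "B \<subseteq> range f" "finite B" "range f \<subseteq> generated_ideal S B"
    using assms(1,3) unfolding noetherian_set_def by (metis image_subset_iff)
  obtain C where C: "finite C" "B = f ` C"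
    using finite_subset_image[OF B(2,1)] by auto
  obtain N where "C \<subseteq> {..<N}" using C(1) finite_nat_iff_bounded by blast
  then have "generated_ideal S B \<subseteq> generated_ideal S (f ` {..<N})"
    unfolding C(2) by (intro generated_ideal_mono image_mono)
  with B(3) show ?thesis by blast
qed

text \<open>The representation by coefficients need not be unique: \<open>t\<close> is allowed to satisfy relations over
\<open>S\<close>.\<close>

definition polys_below :: "'a::comm_ring_1 set \<Rightarrow> 'a \<Rightarrow> nat \<Rightarrow> 'a set" where
  "polys_below S t n = {\<Sum>i<n. c i * t ^ i | c. \<forall>i. c i \<in> S}"

definition adjoin :: "'a::comm_ring_1 set \<Rightarrow> 'a \<Rightarrow> 'a set" where
  "adjoin S t = (\<Union>n. polys_below S t n)"

lemma polys_belowI: "(\<And>i. i < n \<Longrightarrow> c i \<in> S) \<Longrightarrow> subring_set S \<Longrightarrow> (\<Sum>i<n. c i * t ^ i) \<in> polys_below S t n"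
  unfolding polys_below_def
  by (rule CollectI, rule exI[of _ "\<lambda>i. if i < n then c i else 0"]) (auto simp: subring_setD)

lemma polys_below_mono:
  assumes "subring_set S" "n \<le> m" shows "polys_below S t n \<subseteq> polys_below S t m"
proof
  fix x assume "x \<in> polys_below S t n"
  then obtain c where c: "\<forall>i. c i \<in> S" "x = (\<Sum>i<n. c i * t ^ i)" unfolding polys_below_def by blast
  have "x = (\<Sum>i<m. (if i < n then c i else 0) * t ^ i)"
    unfolding c(2) using assms(2) by (intro sum.mono_neutral_cong_left) auto
  also have "\<dots> \<in> polys_below S t m"
    by (rule polys_belowI) (use c assms in \<open>auto simp: subring_setD\<close>)
  finally show "x \<in> polys_below S t m" .
qed

lemma polys_below_add:
  assumes "subring_set S" "x \<in> polys_below S t n" "y \<in> polys_below S t n"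
  shows "x + y \<in> polys_below S t n"
proof -
  obtain c where c: "\<forall>i. c i \<in> S" "x = (\<Sum>i<n. c i * t ^ i)" using assms(2) unfolding polys_below_def by blast
  obtain d where d: "\<forall>i. d i \<in> S" "y = (\<Sum>i<n. d i * t ^ i)" using assms(3) unfolding polys_below_def by blast
  have "x + y = (\<Sum>i<n. (c i + d i) * t ^ i)" by (simp add: c d distrib_right sum.distrib)
  also have "\<dots> \<in> polys_below S t n"
    by (rule polys_belowI) (use c d assms in \<open>auto simp: subring_setD\<close>)
  finally show ?thesis .
qed

lemma polys_below_mult:
  assumes "subring_set S" "s \<in> S" "x \<in> polys_below S t n"
  shows "s * x \<in> polys_below S t n"
proof -
  obtain c where c: "\<forall>i. c i \<in> S" "x = (\<Sum>i<n. c i * t ^ i)" using assms(3) unfolding polys_below_def by blast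
  have "s * x = (\<Sum>i<n. (s * c i) * t ^ i)" by (simp add: c sum_distrib_left mult.assoc)
  also have "\<dots> \<in> polys_below S t n"
    by (rule polys_belowI) (use c assms in \<open>auto simp: subring_setD\<close>)
  finally show ?thesis .
qed

lemma polys_below_zero: "subring_set S \<Longrightarrow> 0 \<in> polys_below S t n"
  using polys_belowI[of n "\<lambda>_. 0" S t] by (simp add: subring_setD)

lemma polys_below_diff:
  assumes "subring_set S" "x \<in> polys_below S t n" "y \<in> polys_below S t n"
  shows "x - y \<in> polys_below S t n"
  using polys_below_add[OF assms(1,2) polys_below_mult[OF assms(1) _ assms(3), of "-1"]] assms(1)
  by (simp add: subring_setD)

lemma polys_below_sum:
  assumes "subring_set S" "\<And>j. j \<in> J \<Longrightarrow> f j \<in> polys_below S t n"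
  shows "sum f J \<in> polys_below S t n"
  using assms(2) by (induction J rule: infinite_finite_induct)
    (auto simp: polys_below_add[OF assms(1)] polys_below_zero[OF assms(1)])

lemma polys_below_shift:
  assumes "subring_set S" "x \<in> polys_below S t n"
  shows "t ^ k * x \<in> polys_below S t (n + k)"
proof -
  obtain c where c: "\<forall>i. c i \<in> S" "x = (\<Sum>i<n. c i * t ^ i)" using assms(2) unfolding polys_below_def by blast
  have "t ^ k * x = (\<Sum>i<n. c i * t ^ (i + k))"
    by (simp add: c sum_distrib_left power_add mult_ac)
  also have "\<dots> = (\<Sum>i\<in>(\<lambda>i. i + k) ` {..<n}. c (i - k) * t ^ i)"
    by (subst sum.reindex) auto
  also have "\<dots> = (\<Sum>i<n + k. (if k \<le> i then c (i - k) else 0) * t ^ i)"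
  proof (rule sum.mono_neutral_cong_left)
    show "\<forall>i\<in>{..<n + k} - (\<lambda>i. i + k) ` {..<n}. (if k \<le> i then c (i - k) else 0) * t ^ i = 0"
    proof
      fix i assume i: "i \<in> {..<n + k} - (\<lambda>i. i + k) ` {..<n}"
      have "\<not> k \<le> i"
      proof
        assume "k \<le> i"
        with i have "i = (i - k) + k" "i - k \<in> {..<n}" by auto
        with i show False by blast
      qed
      then show "(if k \<le> i then c (i - k) else 0) * t ^ i = 0" by simp
    qed
  qed auto
  also have "\<dots> \<in> polys_below S t (n + k)"
    by (rule polys_belowI) (use c assms in \<open>auto simp: subring_setD\<close>)
  finally show ?thesis .
qed

lemma polys_below_Suc_lead:
  assumes "x \<in> polys_below S t (Suc n)" "subring_set S"
  shows "\<exists>a\<in>S. x - a * t ^ n \<in> polys_below S t n"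
proof -
  obtain c where c: "\<forall>i. c i \<in> S" "x = (\<Sum>i<Suc n. c i * t ^ i)" using assms(1) unfolding polys_below_def by blast
  then show ?thesis using polys_belowI[of n c S t] assms(2) by (intro bexI[of _ "c n"]) auto
qed

lemma subring_adjoin:
  assumes "subring_set S"
  shows "subring_set (adjoin S t)"
proof -
  have up: "x \<in> polys_below S t n \<Longrightarrow> n \<le> m \<Longrightarrow> x \<in> polys_below S t m" for x n m
    using polys_below_mono[OF assms] by blast
  have 1: "1 \<in> adjoin S t"
    using polys_belowI[of 1 "\<lambda>_. 1" S t] assms unfolding adjoin_def by (auto simp: subring_setD)
  have add: "x + y \<in> adjoin S t" if xy: "x \<in> adjoin S t" "y \<in> adjoin S t" for x y
  proof -
    obtain n where "x \<in> polys_below S t n" using xy(1) unfolding adjoin_def by blast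
    moreover obtain m where "y \<in> polys_below S t m" using xy(2) unfolding adjoin_def by blast
    ultimately have "x + y \<in> polys_below S t (max n m)"
      using up by (intro polys_below_add[OF assms]) (metis max.cobounded1, metis max.cobounded2)
    then show ?thesis unfolding adjoin_def by blast
  qed
  have min: "- x \<in> adjoin S t" if "x \<in> adjoin S t" for x
    using that polys_below_mult[OF assms, of "-1"] assms unfolding adjoin_def by (auto simp: subring_setD)
  have mult: "x * y \<in> adjoin S t" if x: "x \<in> adjoin S t" and y: "y \<in> adjoin S t" for x y
  proof -
    obtain n c where c: "\<forall>i. c i \<in> S" "x = (\<Sum>i<n. c i * t ^ i)" using x unfolding adjoin_def polys_below_def by blast
    obtain m where m: "y \<in> polys_below S t m" using y unfolding adjoin_def by blast
    have "c i * (t ^ i * y) \<in> polys_below S t (m + n)" if "i < n" for i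
      using up[OF polys_below_shift[OF assms m, of i], of "m + n"] that c polys_below_mult[OF assms] by auto
    then have "(\<Sum>i<n. c i * (t ^ i * y)) \<in> polys_below S t (m + n)"
      by (intro polys_below_sum[OF assms]) auto
    also have "(\<Sum>i<n. c i * (t ^ i * y)) = x * y"
      by (simp add: c(2) sum_distrib_right mult.assoc)
    finally show ?thesis unfolding adjoin_def by blast
  qed
  show ?thesis unfolding subring_set_def using 1 add min mult by blast
qed

lemma adjoin_base: "subring_set S \<Longrightarrow> s \<in> S \<Longrightarrow> s \<in> adjoin S t"
  using polys_belowI[of 1 "\<lambda>_. s" S t] unfolding adjoin_def by auto

lemma adjoin_new:
  assumes "subring_set S"
  shows "t \<in> adjoin S t"
proof -
  have "(\<Sum>i<2. (if i = 1 then 1 else 0) * t ^ i) \<in> polys_below S t 2"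
    by (rule polys_belowI) (use assms in \<open>auto simp: subring_setD\<close>)
  then show ?thesis unfolding adjoin_def by (auto simp: numeral_2_eq_2)
qed

lemma adjoin_least:
  assumes "subring_set R" "S \<subseteq> R" "t \<in> R"
  shows "adjoin S t \<subseteq> R"
  unfolding adjoin_def polys_below_def
  using assms by (auto intro!: subring_set_sum subring_setD subring_set_power)

text \<open>The classical argument also works when \<open>t\<close> is not transcendental over \<open>S\<close>, if the degree of an
element is replaced by the least length of an expression in powers of \<open>t\<close>. Elements \<open>f k\<close> of the
ideal are chosen with least length outside the ideal generated by their predecessors; when the
leading coefficient of \<open>f N\<close> is a combination of the earlier ones, subtracting the corresponding
combination of the \<open>f i\<close> produces a shorter element outside that ideal.\<close>

theorem hilbert_basis:
  assumes S: "subring_set S" and noeth: "noetherian_set S"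
  shows "noetherian_set (adjoin S t)"
proof (rule ccontr)
  let ?R = "adjoin S t"
  note R = subring_adjoin[OF S, of t]
  assume "\<not> noetherian_set ?R"
  then obtain A where A: "A \<subseteq> ?R" and nofin: "\<And>B. B \<subseteq> A \<Longrightarrow> finite B \<Longrightarrow> \<not> A \<subseteq> generated_ideal ?R B"
    unfolding noetherian_set_def by blast
  define I where "I = generated_ideal ?R A"
  have IR: "I \<subseteq> ?R" unfolding I_def by (rule generated_ideal_subset_ring[OF R A])
  have AI: "A \<subseteq> I" unfolding I_def using generated_ideal_base[OF R] by blast
  have ex: "\<exists>f. f \<in> I \<and> f \<notin> generated_ideal ?R F" if F: "finite F" "F \<subseteq> I" for F
  proof (rule ccontr)
    assume "\<not> ?thesis"
    then have sub: "I \<subseteq> generated_ideal ?R F" by blast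
    have "\<forall>f\<in>F. \<exists>B. finite B \<and> B \<subseteq> A \<and> f \<in> generated_ideal ?R B"
      using F(2) generated_ideal_finite_subset unfolding I_def by blast
    then obtain B where B: "\<And>f. f \<in> F \<Longrightarrow> finite (B f) \<and> B f \<subseteq> A \<and> f \<in> generated_ideal ?R (B f)"
      by metis
    have "F \<subseteq> generated_ideal ?R (\<Union>f\<in>F. B f)"
      using B generated_ideal_mono[of "B _" "\<Union>f\<in>F. B f" ?R] by blast
    then have "A \<subseteq> generated_ideal ?R (\<Union>f\<in>F. B f)"
      using generated_ideal_least[OF R] sub AI by blast
    then show False using nofin[of "\<Union>f\<in>F. B f"] B F(1) by blast
  qed
  \<comment> \<open>The least length of an expression for \<open>f\<close>, which is one more than its degree.\<close>
  define rank where "rank f = (LEAST n. f \<in> polys_below S t n)" for f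
  have rank: "f \<in> polys_below S t (rank f)" if "f \<in> I" for f
    using that IR LeastI_ex[of "\<lambda>n. f \<in> polys_below S t n"] unfolding rank_def adjoin_def by blast
  have rank_le: "rank f \<le> n" if "f \<in> polys_below S t n" for f n
    unfolding rank_def using that by (rule Least_le)
  define nxt where "nxt F = arg_min rank (\<lambda>f. f \<in> I \<and> f \<notin> generated_ideal ?R F)" for F
  have nxt: "nxt F \<in> I" "nxt F \<notin> generated_ideal ?R F"
    "\<And>g. g \<in> I \<Longrightarrow> g \<notin> generated_ideal ?R F \<Longrightarrow> rank (nxt F) \<le> rank g"
    if "finite F" "F \<subseteq> I" for F
  proof -
    obtain f where f: "f \<in> I \<and> f \<notin> generated_ideal ?R F" using ex[OF \<open>finite F\<close> \<open>F \<subseteq> I\<close>] by blast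
    show "nxt F \<in> I" "nxt F \<notin> generated_ideal ?R F"
      using arg_min_natI[of "\<lambda>f. f \<in> I \<and> f \<notin> generated_ideal ?R F" f rank, OF f] unfolding nxt_def by auto
    show "rank (nxt F) \<le> rank g" if "g \<in> I" "g \<notin> generated_ideal ?R F" for g
      unfolding nxt_def using that by (intro arg_min_nat_le) auto
  qed
  define Fs where "Fs = rec_nat {} (\<lambda>_ F. insert (nxt F) F)"
  define f where "f k = nxt (Fs k)" for k
  have Fs0: "Fs 0 = {}" and FsS: "Fs (Suc k) = insert (f k) (Fs k)" for k
    unfolding Fs_def f_def by auto
  have Fs: "Fs k = f ` {..<k}" for k
    by (induction k) (auto simp: Fs0 FsS lessThan_Suc)
  have FsI: "finite (Fs k) \<and> Fs k \<subseteq> I" for k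
    by (induction k) (auto simp: Fs0 FsS f_def nxt)
  have fI: "f k \<in> I" and fn: "f k \<notin> generated_ideal ?R (Fs k)"
    and fmin: "\<And>g. g \<in> I \<Longrightarrow> g \<notin> generated_ideal ?R (Fs k) \<Longrightarrow> rank (f k) \<le> rank g" for k
    using nxt[of "Fs k"] FsI[of k] unfolding f_def by auto
  have rank_mono: "rank (f i) \<le> rank (f k)" if "i \<le> k" for i k
  proof (rule fmin[OF fI])
    have "Fs i \<subseteq> Fs k" using that by (auto simp: Fs)
    then show "f k \<notin> generated_ideal ?R (Fs i)" using fn[of k] generated_ideal_mono by blast
  qed
  have "rank (f k) \<noteq> 0" for k
  proof
    assume "rank (f k) = 0"
    then have "f k = 0" using rank[OF fI, of k] unfolding polys_below_def by simp
    with fn[of k] show False by (simp add: generated_ideal.zero)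
  qed
  then have "\<forall>k. \<exists>m. rank (f k) = Suc m" by (metis not0_implies_Suc)
  then obtain d where d: "\<And>k. rank (f k) = Suc (d k)" by metis
  have "\<forall>k. \<exists>a\<in>S. f k - a * t ^ d k \<in> polys_below S t (d k)"
    using polys_below_Suc_lead[OF _ S] rank[OF fI] d by metis
  then obtain a where a: "\<And>k. a k \<in> S" "\<And>k. f k - a k * t ^ d k \<in> polys_below S t (d k)" by metis
  obtain N where "\<forall>n. a n \<in> generated_ideal S (a ` {..<N})"
    using noetherian_set_sequence[OF noeth S, of a] a(1) by blast
  then obtain u where u: "\<forall>i. u i \<in> S" "a N = (\<Sum>i<N. u i * a i)"
    using generated_ideal_image[OF S finite_lessThan, of "a N" a N] by blast
  define g where "g = f N - (\<Sum>i<N. (u i * t ^ (d N - d i)) * f i)"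
  have tR: "u i * t ^ k \<in> ?R" for i k
    using u(1) adjoin_base[OF S] adjoin_new[OF S, of t] by (intro subring_setD(4)[OF R] subring_set_power[OF R]) auto
  have comb: "(\<Sum>i<N. (u i * t ^ (d N - d i)) * f i) \<in> generated_ideal ?R (Fs N)"
    by (rule generated_ideal_sum_mem[OF R tR]) (auto simp: Fs)
  have gI: "g \<in> I"
    unfolding g_def I_def
    by (intro generated_ideal_diff[OF R] generated_ideal_sum generated_ideal_mult[OF R tR])
       (use fI in \<open>auto simp: I_def\<close>)
  have gn: "g \<notin> generated_ideal ?R (Fs N)"
  proof
    assume "g \<in> generated_ideal ?R (Fs N)"
    from generated_ideal_add[OF this comb] fn[of N] show False unfolding g_def by simp
  qed
  have "g = (f N - a N * t ^ d N) - (\<Sum>i<N. u i * (t ^ (d N - d i) * (f i - a i * t ^ d i)))"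
  proof -
    have "t ^ (d N - d i) * (a i * t ^ d i) = a i * t ^ d N" if "i < N" for i
      using rank_mono[of i N] that d by (simp add: power_add[symmetric] mult.left_commute)
    then have "(\<Sum>i<N. u i * (t ^ (d N - d i) * (a i * t ^ d i))) = a N * t ^ d N"
      unfolding u(2) sum_distrib_right by (intro sum.cong) (auto simp: mult_ac)
    then show ?thesis unfolding g_def by (simp add: algebra_simps sum_subtractf)
  qed
  also have "\<dots> \<in> polys_below S t (d N)"
  proof (rule polys_below_diff[OF S a(2)], rule polys_below_sum[OF S], rule polys_below_mult[OF S])
    fix i assume "i \<in> {..<N}"
    then have "d i \<le> d N" using rank_mono[of i N] d by simp
    then show "t ^ (d N - d i) * (f i - a i * t ^ d i) \<in> polys_below S t (d N)"
      using polys_below_shift[OF S a(2), of "d N - d i" i] by simp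
  qed (use u in auto)
  finally have "rank g \<le> d N" by (rule rank_le)
  moreover have "rank (f N) \<le> rank g" by (rule fmin[OF gI gn])
  ultimately show False using d[of N] by simp
qed

section \<open>Rings of polynomial expressions in functions\<close>

definition constants :: "('a \<Rightarrow> real) set" where
  "constants = range (\<lambda>c _. c)"

text \<open>The real algebra generated by \<open>f 0, \<dots>, f (k - 1)\<close>. Built one generator at a time, it is
Noetherian by induction, and an element of the next stage is a polynomial in the new generator.\<close>

primrec polys_in :: "(nat \<Rightarrow> 'a \<Rightarrow> real) \<Rightarrow> nat \<Rightarrow> ('a \<Rightarrow> real) set" where
  "polys_in f 0 = constants"
| "polys_in f (Suc k) = adjoin (polys_in f k) (f k)"

lemma subring_constants: "subring_set constants"
  unfolding subring_set_def constants_def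
  by (auto simp: fun_eq_iff one_fun_def plus_fun_def times_fun_def image_iff)

lemma noetherian_constants: "noetherian_set (constants :: ('a \<Rightarrow> real) set)"
  unfolding noetherian_set_def
proof (intro allI impI)
  fix A :: "('a \<Rightarrow> real) set" assume A: "A \<subseteq> constants"
  show "\<exists>B\<subseteq>A. finite B \<and> A \<subseteq> generated_ideal constants B"
  proof (cases "A \<subseteq> {0}")
    case True
    then show ?thesis by (intro exI[of _ "{}"]) (auto intro: generated_ideal.zero)
  next
    case False
    then obtain a where a: "a \<in> A" "a \<noteq> 0" by blast
    from a(1) A have "a \<in> constants" by blast
    then obtain c where c: "a = (\<lambda>_. c)" unfolding constants_def by blast
    with a have "c \<noteq> 0" by (auto simp: zero_fun_def)
    have "x \<in> generated_ideal constants {a}" if "x \<in> A" for x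
    proof -
      have "x \<in> constants" using A that by blast
      then obtain e where e: "x = (\<lambda>_. e)" unfolding constants_def by blast
      have "(\<lambda>_. e / c) * a + 0 \<in> generated_ideal constants {a}"
        by (intro generated_ideal.intros) (auto simp: constants_def)
      also have "(\<lambda>_. e / c) * a + 0 = x" using \<open>c \<noteq> 0\<close> by (auto simp: e c fun_eq_iff)
      finally show ?thesis .
    qed
    then show ?thesis using a by (intro exI[of _ "{a}"]) auto
  qed
qed

lemma subring_polys_in: "subring_set (polys_in f k)"
  by (induction k) (auto intro: subring_constants subring_adjoin)

lemma noetherian_polys_in: "noetherian_set (polys_in f k)"
  by (induction k) (auto intro: noetherian_constants hilbert_basis subring_polys_in)

lemma polys_in_mono: "j \<le> k \<Longrightarrow> polys_in f j \<subseteq> polys_in f k"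
proof (induction rule: dec_induct)
  case (step n)
  then show ?case using adjoin_base[OF subring_polys_in[of f n], of _ "f n"] by auto
qed simp

lemma const_polys_in: "(\<lambda>_. c) \<in> polys_in f k"
  using polys_in_mono[of 0 k f] by (auto simp: constants_def)

lemma var_polys_in: "i < k \<Longrightarrow> f i \<in> polys_in f k"
  using polys_in_mono[of "Suc i" k f] adjoin_new[OF subring_polys_in, of "f i" f i] by auto

lemma polys_in_least:
  assumes "subring_set R" "constants \<subseteq> R" "\<And>i. i < k \<Longrightarrow> f i \<in> R"
  shows "polys_in f k \<subseteq> R"
  using assms(3)
proof (induction k)
  case (Suc k)
  then show ?case using adjoin_least[OF assms(1), of "polys_in f k" "f k"] by simp
qed (use assms(2) in simp)

lemma polys_in_induct [consumes 1, case_names const var add mult]: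
  assumes "p \<in> polys_in f k"
    and const: "\<And>c. P (\<lambda>_. c)" and var: "\<And>i. i < k \<Longrightarrow> P (f i)"
    and add: "\<And>p q. P p \<Longrightarrow> P q \<Longrightarrow> P (\<lambda>x. p x + q x)"
    and mult: "\<And>p q. P p \<Longrightarrow> P q \<Longrightarrow> P (\<lambda>x. p x * q x)"
  shows "P p"
proof -
  have neg: "P (- p)" if "P p" for p
    using mult[OF const[of "-1"] that] by (simp add: fun_Compl_def)
  have "subring_set (Collect P)"
    using const[of 1] add mult neg unfolding subring_set_def by (auto simp: one_fun_def plus_fun_def times_fun_def)
  from polys_in_least[OF this, of k f] assms(1) const var show ?thesis
    by (auto simp: constants_def)
qed

section \<open>Real polynomial functions\<close>

lemma sum_fun_apply: "(\<Sum>i\<in>I. f i) x = (\<Sum>i\<in>I. (f i x :: 'b::comm_monoid_add))"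
  by (induction I rule: infinite_finite_induct) auto

lemma power_fun_apply: "(f ^ n) x = (f x ^ n :: 'b::comm_semiring_1)"
  by (induction n) auto

definition polys :: "(real^'n \<Rightarrow> real) set" where
  "polys = Collect real_polynomial_function"

lemma polys_iff [simp]: "p \<in> polys \<longleftrightarrow> real_polynomial_function p"
  by (simp add: polys_def)

lemma subring_polys: "subring_set polys"
  unfolding subring_set_def
  by (auto simp: plus_fun_def times_fun_def one_fun_def fun_Compl_def
      intro: real_polynomial_function.intros)

lemma real_polynomial_coord: "real_polynomial_function (\<lambda>x::real^'n. x $ j)"
  by (intro real_polynomial_function.intros(1) bounded_linear_vec_nth)

lemma linear_functional_coords:
  fixes f :: "real^'n \<Rightarrow> real"
  assumes "linear f"
  shows "f y = (\<Sum>j\<in>UNIV. y $ j * f (axis j 1))"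
proof -
  have "f (\<Sum>j\<in>UNIV. (y $ j) *\<^sub>R axis j 1) = (\<Sum>j\<in>UNIV. y $ j * f (axis j 1))"
    by (simp add: linear_sum[OF assms] linear_cmul[OF assms])
  then show ?thesis using basis_expansion[of y] by (simp add: scalar_mult_eq_scaleR)
qed

lemma polys_in_coords:
  assumes e: "bij_betw e {..<CARD('n::finite)} (UNIV :: 'n set)"
  shows "polys_in (\<lambda>i x::real^'n. x $ e i) CARD('n) = polys"
proof (intro equalityI subsetI)
  fix p assume "p \<in> polys_in (\<lambda>i x::real^'n. x $ e i) CARD('n)"
  then have "real_polynomial_function p"
    by (induction rule: polys_in_induct) (auto intro: real_polynomial_coord real_polynomial_function.intros)
  then show "p \<in> polys" by simp
next
  let ?S = "polys_in (\<lambda>i x::real^'n. x $ e i) CARD('n)"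
  note S = subring_polys_in[of "\<lambda>i x::real^'n. x $ e i" "CARD('n)"]
  fix p :: "real^'n \<Rightarrow> real" assume "p \<in> polys"
  then have "real_polynomial_function p" by simp
  then show "p \<in> ?S"
  proof induction
    case (linear f)
    have x: "(\<lambda>x. x $ j) \<in> ?S" for j
    proof -
      obtain i where "i < CARD('n)" "e i = j" using e by (metis UNIV_I bij_betw_iff_bijections lessThan_iff)
      then show ?thesis using var_polys_in[of i "CARD('n)" "\<lambda>i x. x $ e i"] by auto
    qed
    have "f = (\<Sum>j\<in>UNIV. (\<lambda>_. f (axis j 1)) * (\<lambda>x. x $ j))"
    proof
      fix y :: "real^'n"
      show "f y = (\<Sum>j\<in>UNIV. (\<lambda>_. f (axis j 1)) * (\<lambda>x. x $ j)) y"
        using linear_functional_coords[OF bounded_linear.linear[OF linear], of y] by (simp add: sum_fun_apply mult.commute)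
    qed
    also have "\<dots> \<in> ?S"
      by (intro subring_set_sum[OF S] subring_setD(4)[OF S] x const_polys_in)
    finally show ?case .
  next
    case (const c) show ?case by (rule const_polys_in)
  next
    case (add f g) then show ?case using subring_setD(3)[OF S, of f g] by (simp add: plus_fun_def)
  next
    case (mult f g) then show ?case using subring_setD(4)[OF S, of f g] by (simp add: times_fun_def)
  qed
qed

lemma ex_enum: "\<exists>e. bij_betw e {..<CARD('n::finite)} (UNIV :: 'n set)"
  using ex_bij_betw_nat_finite[of "UNIV :: 'n set"] by (simp add: atLeast0LessThan)

text \<open>The substitution principle by which polynomial functions enter the auxiliary algebras below.\<close>

lemma compose_polys_in:
  fixes g :: "'a \<Rightarrow> real^'n"
  assumes "real_polynomial_function p" "\<And>j. (\<lambda>z. g z $ j) \<in> polys_in F k"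
  shows "(\<lambda>z. p (g z)) \<in> polys_in F k"
proof -
  obtain e where e: "bij_betw e {..<CARD('n)} (UNIV :: 'n set)" using ex_enum by blast
  have "p \<in> polys_in (\<lambda>i x. x $ e i) CARD('n)" using assms(1) polys_in_coords[OF e] by simp
  then show ?thesis
  proof (induction rule: polys_in_induct)
    case (const c) show ?case by (rule const_polys_in)
  next
    case (var i) show ?case by (rule assms(2))
  next
    case (add p q) then show ?case using subring_setD(3)[OF subring_polys_in add] by (simp add: plus_fun_def)
  next
    case (mult p q) then show ?case using subring_setD(4)[OF subring_polys_in mult] by (simp add: times_fun_def)
  qed
qed

lemma noetherian_polys: "noetherian_set (polys :: (real^'n \<Rightarrow> real) set)"
  using ex_enum[where 'n = 'n] polys_in_coords noetherian_polys_in by metis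

lemma finite_generators_polys:
  assumes "A \<subseteq> (polys :: (real^'n \<Rightarrow> real) set)"
  shows "\<exists>B\<subseteq>A. finite B \<and> A \<subseteq> generated_ideal polys B"
  using noetherian_polys assms unfolding noetherian_set_def by blast

section \<open>Finite maps and integral dependence\<close>

text \<open>The powers \<open>p ^ N\<close> are combinations \<open>\<Sum> s N i \<circ> \<pi> * g i\<close> of the module generators. The
corresponding linear forms \<open>L N = \<Sum> s N i * T i\<close> live in a Noetherian ring with extra variables
\<open>T i\<close>, so some \<open>L M\<close> is a combination of earlier ones. As the \<open>L i\<close> are homogeneous of degree
one in \<open>T\<close>, the coefficients may be evaluated at \<open>T = 0\<close>; substituting the \<open>g i\<close> for
\<open>T i\<close> gives a monic equation for \<open>p\<close>.\<close>

lemma finite_map_integral: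
  fixes \<pi> :: "real^'m \<Rightarrow> real^'n"
  assumes "finite_map Y X \<pi>" "real_polynomial_function p"
  shows "\<exists>(d::nat) a. (\<forall>i<d. real_polynomial_function (a i)) \<and>
    (\<forall>y\<in>Y. p y ^ d + (\<Sum>i<d. a i (\<pi> y) * p y ^ i) = 0)"
proof -
  obtain r :: nat and g where g: "\<And>q. real_polynomial_function q \<Longrightarrow>
     \<exists>a. (\<forall>i<r. real_polynomial_function (a i)) \<and> (\<forall>y\<in>Y. q y = (\<Sum>i<r. a i (\<pi> y) * g i y))"
    using assms(1) unfolding finite_map_def by blast
  have "\<forall>N. \<exists>a. (\<forall>i<r. real_polynomial_function (a i)) \<and> (\<forall>y\<in>Y. p y ^ N = (\<Sum>i<r. a i (\<pi> y) * g i y))"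
    using g[OF real_polynomial_function_power[OF assms(2)]] by blast
  then obtain s where s: "\<And>N i. i < r \<Longrightarrow> real_polynomial_function (s N i :: real^'n \<Rightarrow> real)"
    "\<And>N y. y \<in> Y \<Longrightarrow> p y ^ N = (\<Sum>i<r. s N i (\<pi> y) * g i y)" by metis
  obtain e where e: "bij_betw e {..<CARD('n)} (UNIV :: 'n set)" using ex_enum by blast
  define F :: "nat \<Rightarrow> ((real^'n) \<times> (nat \<Rightarrow> real)) \<Rightarrow> real"
    where "F i = (if i < CARD('n) then (\<lambda>z. fst z $ e i) else (\<lambda>z. snd z (i - CARD('n))))" for i
  define S where "S = polys_in F (CARD('n) + r)"
  have S: "subring_set S" "noetherian_set S"
    unfolding S_def by (rule subring_polys_in noetherian_polys_in)+
  have "(\<lambda>z. fst z $ j) \<in> S" for j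
  proof -
    obtain i where "i < CARD('n)" "e i = j" using e by (metis UNIV_I bij_betw_iff_bijections lessThan_iff)
    then show ?thesis using var_polys_in[of i "CARD('n) + r" F] unfolding S_def by (simp add: F_def)
  qed
  then have base: "(\<lambda>z. q (fst z)) \<in> S" if "real_polynomial_function q" for q
    using compose_polys_in[where g = fst, OF that] unfolding S_def by blast
  have T: "(\<lambda>z. snd z i) \<in> S" if "i < r" for i
    using var_polys_in[of "CARD('n) + i" "CARD('n) + r" F] that unfolding S_def by (simp add: F_def)
  define L where "L N = (\<Sum>i<r. (\<lambda>z. s N i (fst z)) * (\<lambda>z. snd z i))" for N
  have LS: "L N \<in> S" for N
    unfolding L_def by (intro subring_set_sum[OF S(1)] subring_setD(4)[OF S(1)] base T) (auto intro: s)
  obtain M where M: "L M \<in> generated_ideal S (L ` {..<M})"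
    using noetherian_set_sequence[OF S(2,1), of L] LS by blast
  obtain G where G: "\<And>i. G i \<in> S" "L M = (\<Sum>i<M. G i * L i)"
    using generated_ideal_image[OF S(1) finite_lessThan M] by blast
  have GS: "real_polynomial_function (\<lambda>x. h (x, \<lambda>_. 0)) \<and>
      (\<forall>x t. ((\<lambda>c. h (x, \<lambda>i. c * t i)) \<longlongrightarrow> h (x, \<lambda>_. 0)) (at (0::real)))" if "h \<in> S" for h
    using that unfolding S_def
  proof (induction rule: polys_in_induct)
    case (var i)
    have "((\<lambda>c. c * t) \<longlongrightarrow> 0) (at (0::real))" for t :: real
      by (rule tendsto_eq_intros refl | simp)+
    then show ?case by (auto simp: F_def real_polynomial_coord real_polynomial_function.intros(2))
  qed (auto intro: real_polynomial_function.intros tendsto_intros)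
  have Lval: "L N (x, t) = (\<Sum>i<r. s N i x * t i)" for N x t
    by (simp add: L_def sum_fun_apply)
  \<comment> \<open>Replace \<open>t\<close> by \<open>c * t\<close>, divide by \<open>c\<close>, and let \<open>c\<close> tend to \<open>0\<close>.\<close>
  have rel: "L M (x, t) = (\<Sum>i<M. G i (x, \<lambda>_. 0) * L i (x, t))" for x t
  proof -
    have "L M (x, t) = (\<Sum>i<M. G i (x, \<lambda>j. c * t j) * L i (x, t))" if "c \<noteq> 0" for c
    proof -
      have sc: "L N (x, \<lambda>j. c * t j) = c * L N (x, t)" for N
        by (simp add: Lval sum_distrib_left mult_ac)
      have "c * L M (x, t) = (\<Sum>i<M. G i * L i) (x, \<lambda>j. c * t j)"
        using G(2) sc[of M] by simp
      also have "\<dots> = c * (\<Sum>i<M. G i (x, \<lambda>j. c * t j) * L i (x, t))"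
        by (simp add: sum_fun_apply sc sum_distrib_left mult_ac)
      finally show ?thesis using that by simp
    qed
    then have "((\<lambda>c. \<Sum>i<M. G i (x, \<lambda>j. c * t j) * L i (x, t)) \<longlongrightarrow> L M (x, t)) (at (0::real))"
      by (intro tendsto_eventually) (auto simp: eventually_at_filter)
    moreover have "((\<lambda>c. \<Sum>i<M. G i (x, \<lambda>j. c * t j) * L i (x, t)) \<longlongrightarrow>
        (\<Sum>i<M. G i (x, \<lambda>_. 0) * L i (x, t))) (at (0::real))"
      using GS[OF G(1)] by (intro tendsto_intros) auto
    ultimately show ?thesis by (rule tendsto_unique[OF trivial_limit_at])
  qed
  have pw: "p y ^ N = L N (\<pi> y, \<lambda>i. g i y)" if "y \<in> Y" for y N
    using s(2)[OF that] by (simp add: Lval)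
  have "p y ^ M + (\<Sum>i<M. - G i (\<pi> y, \<lambda>_. 0) * p y ^ i) = 0" if "y \<in> Y" for y
    using rel[of "\<pi> y" "\<lambda>i. g i y"] by (simp add: pw[OF that] sum_negf)
  then show ?thesis
    using GS[OF G(1)] by (intro exI[of _ M] exI[of _ "\<lambda>i x. - G i (x, \<lambda>_. 0)"]) auto
qed

section \<open>Irreducible components\<close>

lemma real_algebraic_Int: "real_algebraic A \<Longrightarrow> real_algebraic B \<Longrightarrow> real_algebraic (A \<inter> B)"
  using real_algebraic_Inter[of "{A, B}"] by auto

lemma real_algebraic_zero_set: "real_polynomial_function p \<Longrightarrow> real_algebraic {x. p x = 0}"
  unfolding real_algebraic_def by (intro exI[of _ "{p}"]) auto

lemma real_algebraic_empty: "real_algebraic {}"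
  using real_algebraic_zero_set[OF real_polynomial_function.intros(2), of 1] by simp

lemma real_algebraic_Union:
  assumes "finite K" "\<And>A. A \<in> K \<Longrightarrow> real_algebraic A"
  shows "real_algebraic (\<Union>K)"
  using assms by (induction K) (auto intro: real_algebraic_empty real_algebraic_Un)

lemma real_algebraic_mem:
  "real_algebraic X \<Longrightarrow> x \<in> X \<longleftrightarrow> (\<forall>p\<in>vanishing_ideal X. p x = 0)"
  unfolding real_algebraic_iff_vanishing_ideal by blast

lemma vanishing_ideal_iff: "p \<in> vanishing_ideal X \<longleftrightarrow> real_polynomial_function p \<and> (\<forall>x\<in>X. p x = 0)"
  by (auto simp: vanishing_ideal_def)

lemma generated_ideal_vanishes:
  assumes "h \<in> generated_ideal S A" "\<And>a. a \<in> A \<Longrightarrow> a x = 0"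
  shows "h x = (0::real)"
  using assms(1) by induction (auto simp: assms(2))

text \<open>In an infinite descending chain, a polynomial that vanishes on \<open>X (Suc i)\<close> but not on \<open>X i\<close> is
never in the ideal of its predecessors.\<close>

lemma wf_algebraic: "wf {(A, B :: (real^'n) set). real_algebraic A \<and> real_algebraic B \<and> A \<subset> B}"
  unfolding wf_iff_no_infinite_down_chain
proof
  assume "\<exists>X. \<forall>i. (X (Suc i), X i) \<in> {(A, B :: (real^'n) set). real_algebraic A \<and> real_algebraic B \<and> A \<subset> B}"
  then obtain X :: "nat \<Rightarrow> (real^'n) set" where X': "\<forall>i. (X (Suc i), X i) \<in> {(A, B). real_algebraic A \<and> real_algebraic B \<and> A \<subset> B}" by blast
  then have X: "real_algebraic (X i)" "X (Suc i) \<subset> X i" for i by auto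
  have "\<exists>h\<in>vanishing_ideal (X (Suc i)). \<exists>x\<in>X i. h x \<noteq> 0" for i
    using X(2)[of i] real_algebraic_mem[OF X(1), of _ "Suc i"] by blast
  then obtain h where h: "\<And>i. h i \<in> vanishing_ideal (X (Suc i))" "\<And>i. \<exists>x\<in>X i. h i x \<noteq> 0" by metis
  have "h i \<in> polys" for i using h(1)[of i] by (simp add: vanishing_ideal_iff)
  then obtain N where N: "h N \<in> generated_ideal polys (h ` {..<N})"
    using noetherian_set_sequence[OF noetherian_polys subring_polys, of h] by blast
  obtain x where x: "x \<in> X N" "h N x \<noteq> 0" using h(2) by blast
  have "decseq X" using X(2) by (intro decseq_SucI) auto
  then have "x \<in> X (Suc i)" if "i < N" for i using x(1) that unfolding decseq_def by (meson Suc_leI subsetD)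
  then have "h i x = 0" if "i < N" for i using h(1)[of i] that by (auto simp: vanishing_ideal_iff)
  then have "h N x = 0" by (intro generated_ideal_vanishes[OF N]) auto
  with x show False by simp
qed

lemma irreducible_decomposition:
  assumes "real_algebraic (X :: (real^'n) set)"
  shows "\<exists>K. finite K \<and> (\<forall>V\<in>K. irreducible_algebraic V) \<and> X = \<Union>K"
  using assms
proof (induction X rule: wf_induct_rule[OF wf_algebraic])
  case (1 X)
  consider "X = {}" | "irreducible_algebraic X"
    | A B where "real_algebraic A" "real_algebraic B" "X = A \<union> B" "X \<noteq> A" "X \<noteq> B"
    using 1(2) unfolding irreducible_algebraic_def by blast
  then show ?case
  proof cases
    case 1 then show ?thesis by (intro exI[of _ "{}"]) auto
  next
    case 2 then show ?thesis by (intro exI[of _ "{X}"]) auto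
  next
    case 3
    then have "A \<subset> X" "B \<subset> X" by auto
    with 3 1 obtain K L where "finite K" "\<forall>V\<in>K. irreducible_algebraic V" "A = \<Union>K"
      "finite L" "\<forall>V\<in>L. irreducible_algebraic V" "B = \<Union>L" by (metis (mono_tags, lifting) case_prodI mem_Collect_eq)
    then show ?thesis using 3 by (intro exI[of _ "K \<union> L"]) auto
  qed
qed

lemma irreducible_subset_Un:
  assumes "irreducible_algebraic V" "V \<subseteq> A \<union> B" "real_algebraic A" "real_algebraic B"
  shows "V \<subseteq> A \<or> V \<subseteq> B"
proof -
  have "V = (V \<inter> A) \<union> (V \<inter> B)" using assms(2) by blast
  then have "V = V \<inter> A \<or> V = V \<inter> B"
    using assms(1,3,4) real_algebraic_Int unfolding irreducible_algebraic_def by blast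
  then show ?thesis by blast
qed

lemma irreducible_subset_Union:
  assumes "irreducible_algebraic V" "finite K" "V \<subseteq> \<Union>K" "\<And>A. A \<in> K \<Longrightarrow> real_algebraic A"
  shows "\<exists>A\<in>K. V \<subseteq> A"
  using assms(2-4)
proof (induction K)
  case empty then show ?case using assms(1) by (auto simp: irreducible_algebraic_def)
next
  case (insert A K)
  then have "V \<subseteq> A \<or> V \<subseteq> \<Union>K"
    by (intro irreducible_subset_Un[OF assms(1)] real_algebraic_Union) auto
  then show ?case using insert by auto
qed

lemma irreducible_prime:
  assumes "irreducible_algebraic V" "real_polynomial_function p" "real_polynomial_function q"
    "\<And>x. x \<in> V \<Longrightarrow> p x * q x = 0"
  shows "(\<forall>x\<in>V. p x = 0) \<or> (\<forall>x\<in>V. q x = 0)"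
  using irreducible_subset_Un[OF assms(1), of "{x. p x = 0}" "{x. q x = 0}"]
    real_algebraic_zero_set assms(2-4) by auto

text \<open>The two consequences of the topological definition that are used: openness gives a complement of an
algebraic set, density says that polynomial identities extend.\<close>

lemma zariski_dense_openD:
  assumes "zariski_dense_open U X"
  shows "\<exists>C. real_algebraic C \<and> U = X - C"
    and "U \<subseteq> D \<Longrightarrow> real_algebraic D \<Longrightarrow> X \<subseteq> D"
proof -
  obtain W where W: "openin zariski W" "U = W \<inter> X"
    using assms unfolding zariski_dense_open_def openin_subtopology by blast
  then show "\<exists>C. real_algebraic C \<and> U = X - C"
    by (intro exI[of _ "- W"]) (auto simp: openin_zariski)
  assume D: "U \<subseteq> D" "real_algebraic D"
  have "closedin (subtopology zariski X) (D \<inter> X)"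
    using D by (auto simp: closedin_subtopology closedin_zariski)
  moreover have "U \<subseteq> D \<inter> X" using D W by auto
  ultimately have "subtopology zariski X closure_of U \<subseteq> D \<inter> X" by (rule closure_of_minimal[rotated])
  then show "X \<subseteq> D" using assms unfolding zariski_dense_open_def by auto
qed

lemma zariski_dense_open_self: "zariski_dense_open X X"
  unfolding zariski_dense_open_def
  using closure_of_topspace[of "subtopology zariski X"] openin_topspace[of "subtopology zariski X"] by simp

text \<open>A component contained in the complement of \<open>U\<close> could be dropped from the finite decomposition of
\<open>X\<close>: the remaining components would still contain \<open>U\<close>, hence \<open>X\<close>. A polynomial separates
the component from the complement.\<close>

lemma component_meets_dense_open:
  assumes "real_algebraic X" "V \<in> irreducible_components X" "zariski_dense_open U X"
  shows "\<exists>q. real_polynomial_function q \<and> (\<forall>x\<in>X - U. q x = 0) \<and> (\<exists>v\<in>V. q v \<noteq> 0)"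
proof -
  obtain C where C: "real_algebraic C" "U = X - C" using zariski_dense_openD(1)[OF assms(3)] by blast
  have V: "irreducible_algebraic V" "V \<subseteq> X"
    and max: "\<And>W. irreducible_algebraic W \<Longrightarrow> V \<subseteq> W \<Longrightarrow> W \<subseteq> X \<Longrightarrow> W = V"
    using assms(2) unfolding irreducible_components_def by auto
  have "\<not> V \<subseteq> C"
  proof
    assume "V \<subseteq> C"
    obtain K where K: "finite K" "\<forall>W\<in>K. irreducible_algebraic W" "X = \<Union>K"
      using irreducible_decomposition[OF assms(1)] by blast
    have alg: "real_algebraic W" if "W \<in> K" for W using K that by (auto simp: irreducible_algebraic_def)
    have "U \<subseteq> \<Union>(K - {V})" using C \<open>V \<subseteq> C\<close> K by auto
    then have "X \<subseteq> \<Union>(K - {V})"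
      by (rule zariski_dense_openD(2)[OF assms(3)]) (use K alg in \<open>auto intro: real_algebraic_Union\<close>)
    then have "\<exists>W\<in>K - {V}. V \<subseteq> W"
      using V K alg by (intro irreducible_subset_Union) auto
    then obtain W where "W \<in> K" "W \<noteq> V" "V \<subseteq> W" by blast
    then show False using max[of W] K by auto
  qed
  then obtain v where v: "v \<in> V" "v \<notin> C" by blast
  then obtain q where "q \<in> vanishing_ideal C" "q v \<noteq> 0" using real_algebraic_mem[OF C(1)] by blast
  then show ?thesis using v C by (intro exI[of _ q]) (auto simp: vanishing_ideal_iff)
qed

section \<open>Relations among functions and tangent vectors\<close>

text \<open>\<open>Q\<close> is not required to be a subset of \<open>R\<close>, so that one \<open>Q\<close> serves for all stages of an
increasing chain of rings.\<close>

definition prime_ideal_in :: "'a::comm_ring_1 set \<Rightarrow> 'a set \<Rightarrow> bool" where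
  "prime_ideal_in R Q \<longleftrightarrow> 0 \<in> Q \<and> 1 \<notin> Q \<and> (\<forall>x\<in>Q. \<forall>y\<in>Q. x + y \<in> Q) \<and>
     (\<forall>r\<in>R. \<forall>x\<in>Q. r * x \<in> Q) \<and> (\<forall>x\<in>R. \<forall>y\<in>R. x * y \<in> Q \<longrightarrow> x \<in> Q \<or> y \<in> Q)"

lemma prime_ideal_inD:
  assumes "prime_ideal_in R Q"
  shows "0 \<in> Q" "1 \<notin> Q" "x \<in> Q \<Longrightarrow> y \<in> Q \<Longrightarrow> x + y \<in> Q" "r \<in> R \<Longrightarrow> x \<in> Q \<Longrightarrow> r * x \<in> Q"
    "r \<in> R \<Longrightarrow> s \<in> R \<Longrightarrow> r * s \<in> Q \<Longrightarrow> r \<in> Q \<or> s \<in> Q"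
  using assms unfolding prime_ideal_in_def by blast+

lemma prime_ideal_in_mono: "prime_ideal_in R Q \<Longrightarrow> S \<subseteq> R \<Longrightarrow> prime_ideal_in S Q"
  unfolding prime_ideal_in_def by blast

lemma prime_ideal_in_diff:
  assumes "prime_ideal_in R Q" "subring_set R" "x \<in> Q" "y \<in> Q"
  shows "x - y \<in> Q"
  using prime_ideal_inD(3)[OF assms(1,3) prime_ideal_inD(4)[OF assms(1) _ assms(4), of "-1"]] assms(2)
  by (simp add: subring_setD)

lemma prime_ideal_in_prod:
  assumes "prime_ideal_in R Q" "subring_set R" "finite I" "\<And>i. i \<in> I \<Longrightarrow> f i \<in> R \<and> f i \<notin> Q"
  shows "prod f I \<in> R \<and> prod f I \<notin> Q"
  using assms(3,4)
proof (induction I)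
  case empty
  then show ?case using prime_ideal_inD[OF assms(1)] subring_setD[OF assms(2)] by simp
next
  case (insert i I)
  then have "f i \<in> R" "f i \<notin> Q" "prod f I \<in> R" "prod f I \<notin> Q" by auto
  then show ?case using insert prime_ideal_inD(5)[OF assms(1)] subring_setD(4)[OF assms(2)] by auto
qed

text \<open>The class of \<open>t\<close> is transcendental over the fraction field of \<open>S\<close> modulo \<open>Q\<close>.\<close>

definition transcendental_mod :: "'a::comm_ring_1 set \<Rightarrow> 'a set \<Rightarrow> 'a \<Rightarrow> bool" where
  "transcendental_mod S Q t \<longleftrightarrow>
     (\<forall>n c. (\<forall>i. c i \<in> S) \<longrightarrow> (\<Sum>i<n. c i * t ^ i) \<in> Q \<longrightarrow> (\<forall>i<n. c i \<in> Q))"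

text \<open>The relation plays the role of the minimal polynomial of \<open>t\<close>, and the last conjunct is
pseudo-division by it. The derivative is not in \<open>Q\<close> because its length is smaller and, as the positive
integers are invertible, its leading coefficient is not in \<open>Q\<close>.\<close>

lemma minimal_relation:
  fixes t :: "'a::comm_ring_1" and n :: nat
  assumes S: "subring_set S" and Q: "prime_ideal_in (adjoin S t) Q"
    and inv: "\<And>n. \<exists>r\<in>S. r * of_nat (Suc n) = 1"
    and alg: "\<not> transcendental_mod S Q t"
  shows "\<exists>e a. (\<forall>i. a i \<in> S) \<and> (\<Sum>i<Suc e. a i * t ^ i) \<in> Q
     \<and> (\<Sum>i<Suc e. a i * (of_nat i * t ^ (i - 1))) \<notin> Q
     \<and> (\<forall>p\<in>adjoin S t \<inter> Q. \<exists>c B r. c \<in> S \<and> c \<notin> Q \<and> B \<in> adjoin S t \<and> (\<forall>i. r i \<in> S \<inter> Q)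
          \<and> c * p = B * (\<Sum>i<Suc e. a i * t ^ i) + (\<Sum>i<e. r i * t ^ i))"
proof -
  let ?R = "adjoin S t"
  note R = subring_adjoin[OF S, of t]
  have SR: "S \<subseteq> ?R" using adjoin_base[OF S] by blast
  have tR: "t ^ k \<in> ?R" for k using subring_set_power[OF R adjoin_new[OF S]] by blast
  note Qdiff = prime_ideal_in_diff[OF Q R]
  define rel where "rel e \<longleftrightarrow> (\<exists>a. (\<forall>i. a i \<in> S) \<and> a e \<notin> Q \<and> (\<Sum>i<Suc e. a i * t ^ i) \<in> Q)" for e
  have rel_ex: "\<exists>e<n. rel e" if "\<forall>i. c i \<in> S" "(\<Sum>i<n. c i * t ^ i) \<in> Q" "\<exists>i<n. c i \<notin> Q" for n c
    using that
  proof (induction n)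
    case (Suc n)
    show ?case
    proof (cases "c n \<in> Q")
      case False
      then show ?thesis using Suc unfolding rel_def by blast
    next
      case True
      then have "t ^ n * c n \<in> Q" by (intro prime_ideal_inD(4)[OF Q] tR)
      then have "(\<Sum>i<n. c i * t ^ i) \<in> Q"
        using Qdiff[OF Suc.prems(2), of "t ^ n * c n"] by (simp add: mult.commute)
      moreover have "\<exists>i<n. c i \<notin> Q" using Suc.prems(3) True less_Suc_eq by metis
      ultimately show ?thesis using Suc less_Suc_eq by blast
    qed
  qed simp
  define e where "e = (LEAST e. rel e)"
  have "\<exists>e. rel e" using alg rel_ex unfolding transcendental_mod_def by blast
  then have "rel e" unfolding e_def by (rule LeastI_ex)
  then obtain a where a: "\<forall>i. a i \<in> S" "a e \<notin> Q" "(\<Sum>i<Suc e. a i * t ^ i) \<in> Q" unfolding rel_def by blast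
  \<comment> \<open>Minimality of \<open>e\<close>: a shorter relation modulo \<open>Q\<close> has all coefficients in \<open>Q\<close>.\<close>
  have low: "c i \<in> Q" if c: "\<forall>i. c i \<in> S" "(\<Sum>i<n. c i * t ^ i) \<in> Q" "n \<le> e" "i < n" for n c i
  proof (rule ccontr)
    assume "c i \<notin> Q"
    then obtain k where "k < n" "rel k" using rel_ex[OF c(1,2)] c(4) by blast
    then show False using Least_le[of rel k] c(3) unfolding e_def by simp
  qed
  have ofnat: "of_nat k \<in> S" for k :: nat
    by (induction k) (auto simp: subring_setD[OF S])
  have "(\<Sum>i<Suc e. a i * (of_nat i * t ^ (i - 1))) \<notin> Q"
  proof
    assume "(\<Sum>i<Suc e. a i * (of_nat i * t ^ (i - 1))) \<in> Q"
    also have "(\<Sum>i<Suc e. a i * (of_nat i * t ^ (i - 1))) = (\<Sum>i<e. (of_nat (Suc i) * a (Suc i)) * t ^ i)"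
      by (subst sum.lessThan_Suc_shift) (simp add: mult_ac)
    finally have mem: "(\<Sum>i<e. (of_nat (Suc i) * a (Suc i)) * t ^ i) \<in> Q" .
    show False
    proof (cases e)
      case 0 then show False using a by simp
    next
      case (Suc k)
      have "\<forall>i. of_nat (Suc i) * a (Suc i) \<in> S" using a(1) ofnat subring_setD(4)[OF S] by blast
      from low[OF this mem, of k] have "of_nat (Suc k) * a (Suc k) \<in> Q" using Suc by simp
      moreover obtain r where "r \<in> S" "r * of_nat (Suc k) = 1" using inv by blast
      ultimately have "r * (of_nat (Suc k) * a (Suc k)) \<in> Q" using prime_ideal_inD(4)[OF Q] SR by blast
      then have "a (Suc k) \<in> Q" using \<open>r * of_nat (Suc k) = 1\<close> by (metis mult.assoc mult_1)
      then show False using a Suc by simp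
    qed
  qed
  moreover define G where "G = (\<Sum>i<Suc e. a i * t ^ i)"
  have GQ: "G \<in> Q" unfolding G_def by (rule a(3))
  have div: "\<exists>c B r. c \<in> S \<and> c \<notin> Q \<and> B \<in> ?R \<and> (\<forall>i. r i \<in> S \<inter> Q) \<and> c * p = B * G + (\<Sum>i<e. r i * t ^ i)"
    if "p \<in> polys_below S t n" "p \<in> Q" for p n
    using that
  proof (induction n arbitrary: p)
    case 0
    then have "p = 0" unfolding polys_below_def by simp
    then show ?case using prime_ideal_inD[OF Q] subring_setD[OF S] subring_setD[OF R]
      by (intro exI[of _ 1] exI[of _ 0] exI[of _ "\<lambda>_. 0"]) auto
  next
    case (Suc n)
    obtain b where b: "\<forall>i. b i \<in> S" "p = (\<Sum>i<Suc n. b i * t ^ i)"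
      using Suc.prems(1) unfolding polys_below_def by blast
    show ?case
    proof (cases "Suc n \<le> e")
      case True
      have bQ: "b i \<in> Q" if "i < Suc n" for i using low[of b, OF b(1) _ True that] b(2) Suc.prems(2) by simp
      have "p = (\<Sum>i<e. (if i < Suc n then b i else 0) * t ^ i)"
        unfolding b(2) using True by (intro sum.mono_neutral_cong_left) auto
      then show ?thesis using prime_ideal_inD[OF Q] subring_setD[OF S] subring_setD[OF R] b bQ
        by (intro exI[of _ 1] exI[of _ 0] exI[of _ "\<lambda>i. if i < Suc n then b i else 0"]) auto
    next
      case False
      then have en: "e \<le> n" by simp
      have bt: "b n * t ^ (n - e) \<in> ?R" using b SR tR subring_setD(4)[OF R] by blast
      \<comment> \<open>Cancel the leading term of \<open>p\<close> against a multiple of the relation.\<close>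
      define p' where "p' = a e * p - (b n * t ^ (n - e)) * G"
      have "p' \<in> Q" unfolding p'_def
        using a(1) SR bt by (intro Qdiff prime_ideal_inD(4)[OF Q] Suc.prems GQ) auto
      have "p' = a e * (\<Sum>i<n. b i * t ^ i) - b n * (t ^ (n - e) * (\<Sum>i<e. a i * t ^ i))"
      proof -
        have "t ^ (n - e) * t ^ e = t ^ n" using en by (simp add: power_add[symmetric])
        then have "b n * t ^ (n - e) * (a e * t ^ e) = a e * (b n * t ^ n)" by (simp add: mult_ac)
        then show ?thesis unfolding p'_def G_def b(2) by (simp add: algebra_simps)
      qed
      also have "\<dots> \<in> polys_below S t n"
      proof (rule polys_below_diff[OF S])
        show "a e * (\<Sum>i<n. b i * t ^ i) \<in> polys_below S t n"
          using a(1) b(1) S by (intro polys_below_mult[OF S] polys_belowI) auto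
        have "t ^ (n - e) * (\<Sum>i<e. a i * t ^ i) \<in> polys_below S t (e + (n - e))"
          using a(1) S by (intro polys_below_shift[OF S] polys_belowI) auto
        then show "b n * (t ^ (n - e) * (\<Sum>i<e. a i * t ^ i)) \<in> polys_below S t n"
          using en b(1) by (simp add: polys_below_mult[OF S])
      qed
      finally obtain c B r where cBr: "c \<in> S" "c \<notin> Q" "B \<in> ?R" "\<forall>i. r i \<in> S \<inter> Q"
        "c * p' = B * G + (\<Sum>i<e. r i * t ^ i)" using Suc.IH[OF _ \<open>p' \<in> Q\<close>] by blast
      have "(c * a e) * p = (B + c * (b n * t ^ (n - e))) * G + (\<Sum>i<e. r i * t ^ i)"
        using cBr(5) unfolding p'_def by (simp add: algebra_simps)
      moreover have "c * a e \<in> S" using cBr a subring_setD[OF S] by auto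
      moreover have "c * a e \<notin> Q" using prime_ideal_inD(5)[OF Q, of c "a e"] cBr a SR by blast
      moreover have "B + c * (b n * t ^ (n - e)) \<in> ?R"
        using cBr(1) SR by (intro subring_setD(3)[OF R cBr(3)] subring_setD(4)[OF R _ bt]) auto
      ultimately show ?thesis using cBr(4) by blast
    qed
  qed
  then have "\<forall>p\<in>?R \<inter> Q. \<exists>c B r. c \<in> S \<and> c \<notin> Q \<and> B \<in> ?R \<and> (\<forall>i. r i \<in> S \<inter> Q)
     \<and> c * p = B * G + (\<Sum>i<e. r i * t ^ i)" unfolding adjoin_def by blast
  ultimately show ?thesis using a unfolding G_def by blast
qed

abbreviation coord_polys :: "nat \<Rightarrow> ((nat \<Rightarrow> real) \<Rightarrow> real) set" where
  "coord_polys \<equiv> polys_in (\<lambda>i z. z i)"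

text \<open>Polynomials in the first \<open>j\<close> coordinates are realised as functions on sequences, so that the number
of variables can be varied within one type.\<close>

lemma coord_polys_local:
  assumes "p \<in> coord_polys j" "\<And>i. i < j \<Longrightarrow> z i = z' i"
  shows "p z = p z'"
  using assms(1) by (induction rule: polys_in_induct) (auto simp: assms(2))

definition dir_deriv :: "((nat \<Rightarrow> real) \<Rightarrow> real) \<Rightarrow> (nat \<Rightarrow> real) \<Rightarrow> (nat \<Rightarrow> real) \<Rightarrow> real" where
  "dir_deriv p z w = deriv (\<lambda>s. p (\<lambda>i. z i + s * w i)) 0"

lemma has_dir_deriv:
  assumes "p \<in> coord_polys m"
  shows "((\<lambda>s. p (\<lambda>i. z i + s * w i)) has_real_derivative dir_deriv p z w) (at 0)"
proof -
  have lin: "(\<lambda>s. a + s * b) field_differentiable (at 0)" for a b :: real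
    by (intro field_differentiable_add field_differentiable_mult field_differentiable_const
        field_differentiable_ident)
  have "(\<lambda>s. p (\<lambda>i. z i + s * w i)) field_differentiable (at 0)"
    using assms
    by (induction rule: polys_in_induct)
       (auto intro: field_differentiable_add field_differentiable_mult field_differentiable_const lin)
  then show ?thesis unfolding dir_deriv_def by (rule field_differentiable_derivI)
qed

lemma dir_derivI:
  "((\<lambda>s. p (\<lambda>i. z i + s * w i)) has_real_derivative D) (at 0) \<Longrightarrow> dir_deriv p z w = D"
  unfolding dir_deriv_def by (rule DERIV_imp_deriv)

lemma dir_deriv_local:
  assumes "p \<in> coord_polys j" "\<And>i. i < j \<Longrightarrow> w i = w' i"
  shows "dir_deriv p z w = dir_deriv p z w'"
proof -
  have "p (\<lambda>i. z i + s * w i) = p (\<lambda>i. z i + s * w' i)" for s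
    by (rule coord_polys_local[OF assms(1)]) (simp add: assms(2))
  then show ?thesis unfolding dir_deriv_def by simp
qed

lemma dir_deriv_const [simp]: "dir_deriv (\<lambda>_. c) z w = 0"
  by (rule dir_derivI) simp

lemma dir_deriv_var: "dir_deriv (\<lambda>z. z i) z w = w i"
  by (rule dir_derivI) (auto intro!: derivative_eq_intros)

lemma dir_deriv_add:
  assumes "p \<in> coord_polys m" "q \<in> coord_polys m"
  shows "dir_deriv (p + q) z w = dir_deriv p z w + dir_deriv q z w"
  by (rule dir_derivI) (auto intro!: DERIV_add has_dir_deriv assms)

lemma dir_deriv_mult:
  assumes "p \<in> coord_polys m" "q \<in> coord_polys m"
  shows "dir_deriv (p * q) z w = dir_deriv p z w * q z + dir_deriv q z w * p z"
  by (rule dir_derivI) (use DERIV_mult[OF has_dir_deriv[OF assms(1), of z w] has_dir_deriv[OF assms(2), of z w]] in simp)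

lemma dir_deriv_sum:
  assumes "\<And>i. i \<in> I \<Longrightarrow> f i \<in> coord_polys m"
  shows "dir_deriv (sum f I) z w = (\<Sum>i\<in>I. dir_deriv (f i) z w)"
  using assms
proof (induction I rule: infinite_finite_induct)
  case (insert i I)
  then have "dir_deriv (f i + sum f I) z w = dir_deriv (f i) z w + dir_deriv (sum f I) z w"
    by (intro dir_deriv_add subring_set_sum[OF subring_polys_in]) auto
  moreover have "dir_deriv (sum f I) z w = (\<Sum>i\<in>I. dir_deriv (f i) z w)" using insert by blast
  ultimately show ?case by (simp only: sum.insert[OF insert.hyps])
qed (simp_all add: zero_fun_def)

lemma coord_power_mem: "j < m \<Longrightarrow> (\<lambda>z. z j) ^ k \<in> coord_polys m"
  using var_polys_in[of j m "\<lambda>i z. z i"] by (intro subring_set_power[OF subring_polys_in])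

lemma dir_deriv_power: "dir_deriv ((\<lambda>z. z j) ^ k) z w = of_nat k * z j ^ (k - 1) * w j"
proof (rule dir_derivI)
  have "((\<lambda>s. (z j + s * w j) ^ k) has_real_derivative of_nat k * z j ^ (k - 1) * w j) (at 0)"
    by (auto intro!: derivative_eq_intros)
  then show "((\<lambda>s. ((\<lambda>z. z j) ^ k) (\<lambda>i. z i + s * w i)) has_real_derivative of_nat k * z j ^ (k - 1) * w j) (at 0)"
    by (simp add: power_fun_apply)
qed

text \<open>The derivative in direction \<open>w\<close> is affine in the component \<open>w j\<close>, with the formal derivative as
slope; therefore the equation \<open>dir_deriv p z w = 0\<close> can be solved for \<open>w j\<close> where that slope is
nonzero.\<close>

lemma dir_deriv_poly_in_coord:
  assumes "\<And>k. a k \<in> coord_polys j"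
  shows "dir_deriv (\<Sum>k<n. a k * (\<lambda>z. z j) ^ k) z w =
    (\<Sum>k<n. dir_deriv (a k) z w * z j ^ k) + w j * (\<Sum>k<n. a k * (of_nat k * (\<lambda>z. z j) ^ (k - 1))) z"
proof -
  have a: "a k \<in> coord_polys (Suc j)" for k using assms polys_in_mono[of j "Suc j"] by fastforce
  have t: "(\<lambda>z. z j) ^ k \<in> coord_polys (Suc j)" for k by (rule coord_power_mem) simp
  have "dir_deriv (\<Sum>k<n. a k * (\<lambda>z. z j) ^ k) z w = (\<Sum>k<n. dir_deriv (a k * (\<lambda>z. z j) ^ k) z w)"
    by (rule dir_deriv_sum[of _ _ "Suc j"]) (intro subring_setD(4)[OF subring_polys_in] a t)
  also have "\<dots> = (\<Sum>k<n. dir_deriv (a k) z w * z j ^ k + of_nat k * z j ^ (k - 1) * w j * a k z)"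
    by (simp add: dir_deriv_mult[OF a t] dir_deriv_power power_fun_apply)
  finally show ?thesis
    by (simp add: sum.distrib sum_fun_apply sum_distrib_left power_fun_apply mult_ac)
qed

text \<open>At a generic zero \<open>z\<close> of the prime \<open>Q\<close>, the components of a tangent vector along transcendental
coordinates can be prescribed freely. Each algebraic coordinate \<open>i\<close> has a minimal relation \<open>G i\<close>
over the preceding ones, and \<open>dir_deriv (G i) z w = 0\<close> determines \<open>w i\<close>. By successive
pseudo-division every element of \<open>Q\<close>, times some \<open>c\<close> outside \<open>Q\<close>, is a combination of the
\<open>G i\<close>, so it is annihilated as well where \<open>c\<close> is nonzero. Geometrically, this is the existence of
enough derivations on a finitely generated field of characteristic zero.\<close>

lemma tangent_vectors_extend:
  fixes Q :: "((nat \<Rightarrow> real) \<Rightarrow> real) set"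
  assumes Q: "prime_ideal_in (coord_polys m) Q"
    and P: "finite P" "P \<subseteq> coord_polys m \<inter> Q"
  shows "\<exists>E c. finite E \<and> E \<subseteq> coord_polys m \<inter> Q \<and> c \<in> coord_polys m - Q \<and>
    (\<forall>z w0. (\<forall>g\<in>E. g z = 0) \<and> c z \<noteq> 0 \<longrightarrow>
      (\<exists>w. (\<forall>i<m. transcendental_mod (coord_polys i) Q (\<lambda>z. z i) \<longrightarrow> w i = w0 i) \<and>
           (\<forall>p\<in>P. dir_deriv p z w = 0)))"
proof -
  let ?t = "\<lambda>i z::nat \<Rightarrow> real. z i"
  let ?free = "\<lambda>i. transcendental_mod (coord_polys i) Q (?t i)"
  define A where "A = {i. i < m \<and> \<not> ?free i}"
  have le: "coord_polys i \<subseteq> coord_polys m" if "i \<le> m" for i using that by (rule polys_in_mono)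
  have inv: "\<exists>r\<in>coord_polys i. r * of_nat (Suc n) = 1" for i n
  proof
    show "(\<lambda>_. 1 / of_nat (Suc n)) \<in> coord_polys i" by (rule const_polys_in)
    have "1 + real n \<noteq> 0" by linarith
    then show "(\<lambda>_. 1 / of_nat (Suc n)) * of_nat (Suc n) = (1 :: (nat \<Rightarrow> real) \<Rightarrow> real)"
      by (auto simp: fun_eq_iff)
  qed
  define minrel where "minrel i e a \<longleftrightarrow> (\<forall>k. a k \<in> coord_polys i) \<and> (\<Sum>k<Suc e. a k * ?t i ^ k) \<in> Q
     \<and> (\<Sum>k<Suc e. a k * (of_nat k * ?t i ^ (k - 1))) \<notin> Q
     \<and> (\<forall>p\<in>coord_polys (Suc i) \<inter> Q. \<exists>c B r. c \<in> coord_polys i \<and> c \<notin> Q \<and> B \<in> coord_polys (Suc i)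
          \<and> (\<forall>k. r k \<in> coord_polys i \<inter> Q)
          \<and> c * p = B * (\<Sum>k<Suc e. a k * ?t i ^ k) + (\<Sum>k<e. r k * ?t i ^ k))" for i and e :: nat and a
  have "\<forall>i\<in>A. \<exists>e a. minrel i e a"
  proof
    fix i assume i: "i \<in> A"
    then have "coord_polys (Suc i) \<subseteq> coord_polys m" by (intro le) (simp add: A_def)
    then have "prime_ideal_in (adjoin (coord_polys i) (?t i)) Q"
      using prime_ideal_in_mono[OF Q] by simp
    from minimal_relation[OF subring_polys_in this inv] i
    show "\<exists>e a. minrel i e a" unfolding minrel_def polys_in.simps(2) by (simp only: A_def mem_Collect_eq) blast
  qed
  then obtain e a where mr: "\<And>i. i \<in> A \<Longrightarrow> minrel i (e i) (a i)" by metis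
  have ea: "\<And>i k. i \<in> A \<Longrightarrow> a i k \<in> coord_polys i"
    "\<And>i. i \<in> A \<Longrightarrow> (\<Sum>k<Suc (e i). a i k * ?t i ^ k) \<in> Q"
    "\<And>i. i \<in> A \<Longrightarrow> (\<Sum>k<Suc (e i). a i k * (of_nat k * ?t i ^ (k - 1))) \<notin> Q"
    "\<And>i p. i \<in> A \<Longrightarrow> p \<in> coord_polys (Suc i) \<inter> Q \<Longrightarrow> \<exists>c B r. c \<in> coord_polys i \<and> c \<notin> Q
        \<and> B \<in> coord_polys (Suc i) \<and> (\<forall>k. r k \<in> coord_polys i \<inter> Q)
        \<and> c * p = B * (\<Sum>k<Suc (e i). a i k * ?t i ^ k) + (\<Sum>k<e i. r k * ?t i ^ k)"
    using mr unfolding minrel_def by blast+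
  define G where "G i = (\<Sum>k<Suc (e i). a i k * ?t i ^ k)" for i
  define G' where "G' i = (\<Sum>k<Suc (e i). a i k * (of_nat k * ?t i ^ (k - 1)))" for i
  have aS: "a i k \<in> coord_polys (Suc i)" if "i \<in> A" for i k
    using ea(1)[OF that] polys_in_mono[of i "Suc i"] by fastforce
  have Gmem: "G i \<in> coord_polys (Suc i)" if "i \<in> A" for i
    unfolding G_def using that
    by (intro subring_set_sum[OF subring_polys_in] subring_setD(4)[OF subring_polys_in] aS coord_power_mem) auto
  have of_nat_mem: "of_nat k \<in> coord_polys i" for k i
    using const_polys_in[of "of_nat k" "\<lambda>i z. z i" i] by (simp add: of_nat_fun)
  have G'mem: "G' i \<in> coord_polys (Suc i)" if "i \<in> A" for i
    unfolding G'_def using that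
    by (intro subring_set_sum[OF subring_polys_in] subring_setD(4)[OF subring_polys_in] aS coord_power_mem of_nat_mem) auto
  have Am: "Suc i \<le> m" if "i \<in> A" for i using that by (auto simp: A_def)
  \<comment> \<open>Where the relations and their derivatives in direction \<open>w\<close> vanish, so do those of any \<open>p\<close>
    in \<open>Q\<close>, up to a multiplier \<open>c\<close>.\<close>
  have step: "\<exists>c\<in>coord_polys j - Q. \<forall>z w. (\<forall>i\<in>A. i < j \<longrightarrow> G i z = 0 \<and> dir_deriv (G i) z w = 0) \<longrightarrow> c z \<noteq> 0
       \<longrightarrow> p z = 0 \<and> dir_deriv p z w = 0"
    if "j \<le> m" "p \<in> coord_polys j \<inter> Q" for j p
    using that
  proof (induction j arbitrary: p)
    case 0
    then obtain c where c: "p = (\<lambda>_. c)" by (auto simp: constants_def)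
    have "c = 0"
    proof (rule ccontr)
      assume "c \<noteq> 0"
      then have "(\<lambda>_. 1 / c) * p = 1" by (auto simp: c fun_eq_iff)
      moreover have "(\<lambda>_. 1 / c) * p \<in> Q"
        using 0 by (intro prime_ideal_inD(4)[OF Q] const_polys_in) auto
      ultimately show False using prime_ideal_inD(2)[OF Q] by simp
    qed
    then show ?case using prime_ideal_inD(2)[OF Q] subring_setD(1)[OF subring_polys_in[of "\<lambda>i z. z i" 0]]
      by (intro bexI[of _ 1]) (auto simp: c)
  next
    case (Suc j)
    let ?good = "\<lambda>k z w. \<forall>i\<in>A. i < k \<longrightarrow> G i z = 0 \<and> dir_deriv (G i) z w = 0"
    have jm: "j \<le> m" and Sj: "coord_polys j \<subseteq> coord_polys (Suc j)"
      using Suc.prems polys_in_mono[of j "Suc j"] by auto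
    note Qj = prime_ideal_in_mono[OF Q le[OF jm]]
    note QS = prime_ideal_in_mono[OF Q le[OF Suc.prems(1)]]
    have lowterms: "\<exists>c\<in>coord_polys j - Q. \<forall>z w. ?good j z w \<longrightarrow> c z \<noteq> 0 \<longrightarrow>
        (\<Sum>k<n. r k * ?t j ^ k) z = 0 \<and> dir_deriv (\<Sum>k<n. r k * ?t j ^ k) z w = 0"
      if r: "\<And>k. k < n \<Longrightarrow> r k \<in> coord_polys j \<inter> Q" for n :: nat and r
    proof -
      define ok where "ok k c \<longleftrightarrow> c \<in> coord_polys j - Q \<and>
        (\<forall>z w. ?good j z w \<longrightarrow> c z \<noteq> 0 \<longrightarrow> r k z = 0 \<and> dir_deriv (r k) z w = 0)" for k c
      have "\<forall>k. \<exists>c. k < n \<longrightarrow> ok k c" using Suc.IH[OF jm r] unfolding ok_def by blast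
      then obtain c where ok: "\<And>k. k < n \<Longrightarrow> ok k (c k)" by metis
      have c: "\<And>k. k < n \<Longrightarrow> c k \<in> coord_polys j - Q"
        "\<And>k z w. k < n \<Longrightarrow> ?good j z w \<Longrightarrow> c k z \<noteq> 0 \<Longrightarrow> r k z = 0 \<and> dir_deriv (r k) z w = 0"
        using ok unfolding ok_def by blast+
      define r' where "r' k = (if k < n then r k else 0)" for k
      have r': "r' k \<in> coord_polys j" for k
        using r subring_setD(2)[OF subring_polys_in] by (auto simp: r'_def)
      have sum_eq: "(\<Sum>k<n. r k * ?t j ^ k) = (\<Sum>k<n. r' k * ?t j ^ k)" by (simp add: r'_def)
      show ?thesis
      proof (intro bexI allI impI)
        show "(\<Prod>k<n. c k) \<in> coord_polys j - Q"
          using prime_ideal_in_prod[OF Qj subring_polys_in, of "{..<n}" c] c(1) by auto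
      next
        fix z w assume g: "?good j z w" and nz: "(\<Prod>k<n. c k) z \<noteq> 0"
        have "(\<Prod>k\<in>K. c k) z = (\<Prod>k\<in>K. c k z)" for K
          by (induction K rule: infinite_finite_induct) auto
        then have "c k z \<noteq> 0" if "k < n" for k using nz that by auto
        then have "r' k z = 0 \<and> dir_deriv (r' k) z w = 0" if "k < n" for k
          using c(2)[OF that g] that by (simp add: r'_def)
        then show "(\<Sum>k<n. r k * ?t j ^ k) z = 0 \<and> dir_deriv (\<Sum>k<n. r k * ?t j ^ k) z w = 0"
          unfolding sum_eq dir_deriv_poly_in_coord[OF r'] by (simp add: sum_fun_apply)
      qed
    qed
    show ?case
    proof (cases "j \<in> A")
      case False
      then have "?free j" using Suc.prems by (auto simp: A_def)
      obtain n c where c: "\<forall>k. c k \<in> coord_polys j" "p = (\<Sum>k<n. c k * ?t j ^ k)"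
        using Suc.prems(2) by (auto simp: adjoin_def polys_below_def)
      then have "\<And>k. k < n \<Longrightarrow> c k \<in> coord_polys j \<inter> Q"
        using \<open>?free j\<close> Suc.prems(2) unfolding transcendental_mod_def by blast
      from lowterms[of n c, OF this, folded c(2)] obtain d where d: "d \<in> coord_polys j - Q"
        "\<forall>z w. ?good j z w \<longrightarrow> d z \<noteq> 0 \<longrightarrow> p z = 0 \<and> dir_deriv p z w = 0" ..
      have "?good j z w" if "?good (Suc j) z w" for z w using that by simp
      with d Sj show ?thesis by (intro bexI[of _ d]) blast+
    next
      case True
      obtain c B r where cBr: "c \<in> coord_polys j" "c \<notin> Q" "B \<in> coord_polys (Suc j)"
        "\<forall>k. r k \<in> coord_polys j \<inter> Q" "c * p = B * G j + (\<Sum>k<e j. r k * ?t j ^ k)"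
        using ea(4)[OF True Suc.prems(2)] unfolding G_def by blast
      have "r k \<in> coord_polys j \<inter> Q" for k using cBr(4) by blast
      from lowterms[of "e j" r, OF this] obtain d where d: "d \<in> coord_polys j - Q"
        "\<forall>z w. ?good j z w \<longrightarrow> d z \<noteq> 0 \<longrightarrow>
         (\<Sum>k<e j. r k * ?t j ^ k) z = 0 \<and> dir_deriv (\<Sum>k<e j. r k * ?t j ^ k) z w = 0" ..
      have cS: "c \<in> coord_polys (Suc j)" using cBr Sj by blast
      have sumS: "(\<Sum>k<e j. r k * ?t j ^ k) \<in> coord_polys (Suc j)"
        using cBr(4) Sj
        by (intro subring_set_sum[OF subring_polys_in] subring_setD(4)[OF subring_polys_in] coord_power_mem) auto
      show ?thesis
      proof (intro bexI allI impI)
        show "c * d \<in> coord_polys (Suc j) - Q"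
          using cBr d Sj prime_ideal_inD(5)[OF Qj, of c d] subring_setD(4)[OF subring_polys_in, of c "\<lambda>i z. z i" j d] by auto
      next
        fix z w assume g: "?good (Suc j) z w" and nz: "(c * d) z \<noteq> 0"
        then have sums: "(\<Sum>k<e j. r k * ?t j ^ k) z = 0" "dir_deriv (\<Sum>k<e j. r k * ?t j ^ k) z w = 0"
          and Gj: "G j z = 0" "dir_deriv (G j) z w = 0"
          using d(2)[rule_format, of z w] True by auto
        have "(c * p) z = 0" using Gj sums unfolding cBr(5) by simp
        then have pz: "p z = 0" using nz by simp
        have BG: "B * G j \<in> coord_polys (Suc j)"
          using cBr Gmem[OF True] by (intro subring_setD(4)[OF subring_polys_in])
        have "dir_deriv (c * p) z w = 0"
          unfolding cBr(5) by (simp add: dir_deriv_add[OF BG sumS] dir_deriv_mult[OF cBr(3) Gmem[OF True]] Gj sums)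
        moreover have "p \<in> coord_polys (Suc j)" using Suc.prems by blast
        ultimately show "p z = 0 \<and> dir_deriv p z w = 0"
          using nz pz by (simp add: dir_deriv_mult[OF cS])
      qed
    qed
  qed
  have solve: "\<exists>w. (\<forall>i. i \<notin> A \<longrightarrow> w i = w0 i) \<and> (\<forall>i\<in>A. i < j \<longrightarrow> dir_deriv (G i) z w = 0)"
    if "\<forall>i\<in>A. G' i z \<noteq> 0" for z w0 j
  proof (induction j)
    case 0 then show ?case by auto
  next
    case (Suc j)
    then obtain w where w: "\<forall>i. i \<notin> A \<longrightarrow> w i = w0 i" "\<forall>i\<in>A. i < j \<longrightarrow> dir_deriv (G i) z w = 0" by blast
    show ?case
    proof (cases "j \<in> A")
      case False
      then show ?thesis using w less_Suc_eq by (intro exI[of _ w]) auto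
    next
      case True
      define v where "v = - (\<Sum>k<Suc (e j). dir_deriv (a j k) z w * z j ^ k) / G' j z"
      define w' where "w' = w(j := v)"
      have "dir_deriv (a j k) z w' = dir_deriv (a j k) z w" for k
        by (rule dir_deriv_local[OF ea(1)[OF True]]) (simp add: w'_def)
      then have "dir_deriv (G j) z w' = (\<Sum>k<Suc (e j). dir_deriv (a j k) z w * z j ^ k) + v * G' j z"
        unfolding G_def dir_deriv_poly_in_coord[OF ea(1)[OF True]] G'_def by (simp add: w'_def)
      also have "\<dots> = 0" using that True by (simp add: v_def)
      finally have "dir_deriv (G j) z w' = 0" .
      moreover have "dir_deriv (G i) z w' = dir_deriv (G i) z w" if "i \<in> A" "i < j" for i
        by (rule dir_deriv_local[OF Gmem[OF that(1)]]) (use that in \<open>simp add: w'_def\<close>)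
      moreover have "\<forall>i. i \<notin> A \<longrightarrow> w' i = w0 i" using w(1) True by (auto simp: w'_def)
      ultimately show ?thesis using w(2) True less_Suc_eq
        by (intro exI[of _ w']) auto
    qed
  qed
  define ok where "ok p c \<longleftrightarrow> c \<in> coord_polys m - Q \<and> (\<forall>z w. (\<forall>i\<in>A. i < m \<longrightarrow> G i z = 0 \<and> dir_deriv (G i) z w = 0)
      \<longrightarrow> c z \<noteq> 0 \<longrightarrow> p z = 0 \<and> dir_deriv p z w = 0)" for p c
  have "\<forall>p. \<exists>c. p \<in> P \<longrightarrow> ok p c"
    using step[OF order_refl] P(2) unfolding ok_def by blast
  then obtain C where ok: "\<And>p. p \<in> P \<Longrightarrow> ok p (C p)" by metis
  have C: "\<And>p. p \<in> P \<Longrightarrow> C p \<in> coord_polys m - Q"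
    "\<And>p z w. p \<in> P \<Longrightarrow> \<forall>i\<in>A. i < m \<longrightarrow> G i z = 0 \<and> dir_deriv (G i) z w = 0 \<Longrightarrow> C p z \<noteq> 0 \<Longrightarrow> dir_deriv p z w = 0"
    using ok unfolding ok_def by blast+
  have finA: "finite A" by (simp add: A_def)
  define c where "c = (\<Prod>i\<in>A. G' i) * (\<Prod>p\<in>P. C p)"
  have G'Q: "(\<Prod>i\<in>A. G' i) \<in> coord_polys m \<and> (\<Prod>i\<in>A. G' i) \<notin> Q"
    using G'mem ea(3) le[OF Am] by (intro prime_ideal_in_prod[OF Q subring_polys_in finA]) (auto simp: G'_def)
  have CQ: "(\<Prod>p\<in>P. C p) \<in> coord_polys m \<and> (\<Prod>p\<in>P. C p) \<notin> Q"
    using C(1) by (intro prime_ideal_in_prod[OF Q subring_polys_in P(1)]) auto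
  have prod_apply: "prod f I z = (\<Prod>i\<in>I. f i z)" for f :: "'i \<Rightarrow> (nat \<Rightarrow> real) \<Rightarrow> real" and I z
    by (induction I rule: infinite_finite_induct) auto
  show ?thesis
  proof (rule exI[of _ "G ` A"], rule exI[of _ c], intro conjI allI impI)
    show "finite (G ` A)" using finA by simp
    show "G ` A \<subseteq> coord_polys m \<inter> Q" using Gmem le[OF Am] ea(2) by (auto simp: G_def)
    show "c \<in> coord_polys m - Q"
      using G'Q CQ prime_ideal_inD(5)[OF Q] subring_setD(4)[OF subring_polys_in] unfolding c_def by blast
  next
    fix z w0 assume z: "(\<forall>g\<in>G ` A. g z = 0) \<and> c z \<noteq> 0"
    then have nz: "(\<Prod>i\<in>A. G' i z) \<noteq> 0" "(\<Prod>p\<in>P. C p z) \<noteq> 0" by (auto simp: c_def prod_apply)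
    then have "\<forall>i\<in>A. G' i z \<noteq> 0" using finA by auto
    from solve[OF this, of w0 m] obtain w where w: "\<forall>i. i \<notin> A \<longrightarrow> w i = w0 i"
      "\<forall>i\<in>A. i < m \<longrightarrow> dir_deriv (G i) z w = 0" by blast
    have "dir_deriv p z w = 0" if "p \<in> P" for p
      using C(2)[OF that, of z w] w z nz P(1) that by auto
    then show "\<exists>w. (\<forall>i<m. ?free i \<longrightarrow> w i = w0 i) \<and> (\<forall>p\<in>P. dir_deriv p z w = 0)"
      using w(1) by (intro exI[of _ w]) (auto simp: A_def)
  qed
qed

lemma real_polynomial_has_derivative:
  "real_polynomial_function p \<Longrightarrow> (p has_derivative frechet_derivative p (at x)) (at x)"
  using differentiable_at_real_polynomial_function frechet_derivative_works by blast

lemma real_polynomial_linear_derivative: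
  "real_polynomial_function p \<Longrightarrow> linear (frechet_derivative p (at x))"
  using real_polynomial_has_derivative has_derivative_linear by blast

lemma card_le_dim_of_dual_family:
  fixes v :: "nat \<Rightarrow> 'a::euclidean_space"
  assumes "\<And>i. i < k \<Longrightarrow> v i \<in> W" "\<And>l. l < k \<Longrightarrow> linear (\<phi> l)"
    "\<And>i l. i < k \<Longrightarrow> l < k \<Longrightarrow> \<phi> l (v i) = (if i = l then 1 else (0::real))"
  shows "k \<le> dim W"
proof -
  have inj: "inj_on v {..<k}"
  proof (rule inj_onI)
    fix i l assume "i \<in> {..<k}" "l \<in> {..<k}" "v i = v l"
    then show "i = l" using assms(3)[of i l] assms(3)[of l l] by (auto split: if_splits)
  qed
  have "independent (v ` {..<k})"
  proof (rule independent_if_scalars_zero)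
    fix f u assume 0: "(\<Sum>x\<in>v ` {..<k}. f x *\<^sub>R x) = 0" and "u \<in> v ` {..<k}"
    then obtain l where l: "l < k" "u = v l" by blast
    have "(\<Sum>i<k. f (v i) *\<^sub>R v i) = 0" using 0 by (simp add: sum.reindex[OF inj])
    then have "\<phi> l (\<Sum>i<k. f (v i) *\<^sub>R v i) = 0" using linear_0[OF assms(2)[OF l(1)]] by simp
    then have "(\<Sum>i<k. f (v i) * \<phi> l (v i)) = 0"
      by (simp add: linear_sum[OF assms(2)[OF l(1)]] linear_cmul[OF assms(2)[OF l(1)]])
    also have "(\<Sum>i<k. f (v i) * \<phi> l (v i)) = (\<Sum>i<k. if i = l then f (v i) else 0)"
      using assms(3) l by (intro sum.cong) auto
    finally show "f u = 0" using l by simp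
  qed simp
  then have "card (v ` {..<k}) \<le> dim W"
    using assms(1) by (intro independent_card_le_dim) auto
  then show ?thesis by (simp add: card_image[OF inj])
qed

text \<open>A function that is polynomial in a free coordinate and vanishes identically has coefficients zero.\<close>

lemma transcendental_coord:
  assumes "\<And>h. h \<in> coord_polys (Suc j) \<Longrightarrow> h \<in> Q \<Longrightarrow> h = 0" "0 \<in> Q"
  shows "transcendental_mod (coord_polys j) Q (\<lambda>z. z j)"
  unfolding transcendental_mod_def
proof (intro allI impI)
  fix n i :: nat and c :: "nat \<Rightarrow> (nat \<Rightarrow> real) \<Rightarrow> real"
  assume c: "\<forall>i. c i \<in> coord_polys j" "(\<Sum>i<n. c i * (\<lambda>z. z j) ^ i) \<in> Q" and i: "i < n"
  have "(\<Sum>i<n. c i * (\<lambda>z. z j) ^ i) \<in> coord_polys (Suc j)"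
    using c(1) by (auto simp: adjoin_def polys_below_def)
  then have 0: "(\<Sum>i<n. c i * (\<lambda>z. z j) ^ i) = 0" using assms(1) c(2) by blast
  have "c i z = 0" for z
  proof -
    have "(\<Sum>i\<le>n. (if i < n then c i z else 0) * v ^ i) = 0" for v
    proof -
      have "c i (z(j := v)) = c i z" for i
        by (rule coord_polys_local[OF c(1)[rule_format]]) simp
      then have "(\<Sum>i<n. c i z * v ^ i) = (\<Sum>i<n. c i * (\<lambda>z. z j) ^ i) (z(j := v))"
        by (simp add: sum_fun_apply power_fun_apply)
      also have "\<dots> = 0" using 0 by simp
      also have "(\<Sum>i<n. c i z * v ^ i) = (\<Sum>i\<le>n. (if i < n then c i z else 0) * v ^ i)"
        by (intro sum.mono_neutral_cong_left) auto
      finally show ?thesis .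
    qed
    then have "\<forall>i\<le>n. (if i < n then c i z else 0) = 0"
      using polyfun_eq_0[of "\<lambda>i. if i < n then c i z else 0" n] by blast
    from this[rule_format, of i] i show ?thesis by simp
  qed
  then have "c i = 0" by (auto simp: fun_eq_iff)
  then show "c i \<in> Q" using assms(2) by simp
qed

text \<open>The polynomials that vanish eventually along \<open>F\<close> form a prime ideal (or everything, when \<open>F\<close> is
trivial). With a principal filter this is the vanishing ideal of a set, with a filter of neighbourhoods
the ideal of a germ; both occur below.\<close>

definition prime_filter :: "(real^'n) filter \<Rightarrow> bool" where
  "prime_filter F \<longleftrightarrow> (\<forall>p q. real_polynomial_function p \<longrightarrow> real_polynomial_function q \<longrightarrow>
     (\<forall>\<^sub>F x in F. p x * q x = 0) \<longrightarrow> (\<forall>\<^sub>F x in F. p x = 0) \<or> (\<forall>\<^sub>F x in F. q x = 0))"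

lemma clear_denominators:
  fixes b :: "real^'n \<Rightarrow> real"
  assumes "h \<in> coord_polys m" "real_polynomial_function b"
    "\<And>i. i < m \<Longrightarrow> \<exists>N q. real_polynomial_function q \<and> (\<forall>x. b x \<noteq> 0 \<longrightarrow> q x = b x ^ N * \<zeta> x i)"
  shows "\<exists>N q. real_polynomial_function q \<and> (\<forall>x. b x \<noteq> 0 \<longrightarrow> q x = b x ^ N * h (\<zeta> x))"
  using assms(1)
proof (induction rule: polys_in_induct)
  case (const c)
  show ?case by (intro exI[of _ 0] exI[of _ "\<lambda>_. c"]) (auto intro: real_polynomial_function.intros)
next
  case (var i) then show ?case by (rule assms(3))
next
  case (add h1 h2)
  then obtain N1 q1 N2 q2 where q: "real_polynomial_function q1" "\<forall>x. b x \<noteq> 0 \<longrightarrow> q1 x = b x ^ N1 * h1 (\<zeta> x)"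
    "real_polynomial_function q2" "\<forall>x. b x \<noteq> 0 \<longrightarrow> q2 x = b x ^ N2 * h2 (\<zeta> x)" by metis
  have "\<forall>x. b x \<noteq> 0 \<longrightarrow> b x ^ N2 * q1 x + b x ^ N1 * q2 x = b x ^ (N1 + N2) * (h1 (\<zeta> x) + h2 (\<zeta> x))"
    using q by (simp add: algebra_simps power_add)
  moreover have "real_polynomial_function (\<lambda>x. b x ^ N2 * q1 x + b x ^ N1 * q2 x)"
    using q assms(2) by (intro real_polynomial_function.intros(3,4) real_polynomial_function_power)
  ultimately show ?case by (intro exI[of _ "N1 + N2"] exI[of _ "\<lambda>x. b x ^ N2 * q1 x + b x ^ N1 * q2 x"]) auto
next
  case (mult h1 h2)
  then obtain N1 q1 N2 q2 where q: "real_polynomial_function q1" "\<forall>x. b x \<noteq> 0 \<longrightarrow> q1 x = b x ^ N1 * h1 (\<zeta> x)"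
    "real_polynomial_function q2" "\<forall>x. b x \<noteq> 0 \<longrightarrow> q2 x = b x ^ N2 * h2 (\<zeta> x)" by metis
  have "\<forall>x. b x \<noteq> 0 \<longrightarrow> q1 x * q2 x = b x ^ (N1 + N2) * (h1 (\<zeta> x) * h2 (\<zeta> x))"
    using q by (simp add: algebra_simps power_add)
  moreover have "real_polynomial_function (\<lambda>x. q1 x * q2 x)"
    using q by (intro real_polynomial_function.intros(4))
  ultimately show ?case by (intro exI[of _ "N1 + N2"] exI[of _ "\<lambda>x. q1 x * q2 x"]) auto
qed

text \<open>The transcendence degree is bounded by the dimension of the space cut out by differentials of
elements of the ideal. In the polynomial ring with variables for the \<open>k\<close> fractions followed by the
ambient coordinates, the first \<open>k\<close> variables are transcendental modulo the ideal of relations, because the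
fractions are independent. So by \<open>tangent_vectors_extend\<close> there are vectors tangent to all
relations with any prescribed components in those variables. The relations \<open>b z\<^sub>i = a\<^sub>i\<close> identify the
prescribed components with derivatives of the fractions, and this makes \<open>k\<close> linear functionals
independent on the kernel of the differentials of \<open>P\<close>.\<close>

theorem independent_functions_le_tangent_dim:
  fixes F :: "(real^'n) filter" and a :: "nat \<Rightarrow> real^'n \<Rightarrow> real"
  assumes F: "prime_filter F"
    and b: "real_polynomial_function b" "\<not> (\<forall>\<^sub>F x in F. b x = 0)"
    and a: "\<And>i. i < k \<Longrightarrow> real_polynomial_function (a i)"
    and indep: "\<And>h. h \<in> coord_polys k \<Longrightarrow> \<forall>\<^sub>F x in F. b x \<noteq> 0 \<longrightarrow> h (\<lambda>i. a i x / b x) = 0 \<Longrightarrow> h = 0"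
    and P: "finite P" "\<And>p. p \<in> P \<Longrightarrow> real_polynomial_function p" "\<And>p. p \<in> P \<Longrightarrow> \<forall>\<^sub>F x in F. p x = 0"
    and D: "\<forall>\<^sub>F x in F. dim {v. \<forall>p\<in>P. frechet_derivative p (at x) v = 0} \<le> D"
  shows "k \<le> D"
proof -
  obtain e where e: "bij_betw e {..<CARD('n)} (UNIV :: 'n set)" using ex_enum by blast
  define \<iota> where "\<iota> = inv_into {..<CARD('n)} e"
  have \<iota>: "\<iota> j < CARD('n)" "e (\<iota> j) = j" for j
    using e by (auto simp: \<iota>_def bij_betw_def f_inv_into_f intro: inv_into_into[of _ _ "{..<_}", simplified])
  define m where "m = k + CARD('n)"
  define \<zeta> where "\<zeta> x i = (if i < k then a i x / b x else x $ e (i - k))" for x i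
  define \<tau> :: "(nat \<Rightarrow> real) \<Rightarrow> real^'n" where "\<tau> z = (\<chi> j. z (k + \<iota> j))" for z
  have \<tau>\<zeta>: "\<tau> (\<zeta> x) = x" for x by (simp add: \<tau>_def \<zeta>_def vec_eq_iff \<iota>)
  define Q :: "((nat \<Rightarrow> real) \<Rightarrow> real) set" where "Q = {h. \<forall>\<^sub>F x in F. b x \<noteq> 0 \<longrightarrow> h (\<zeta> x) = 0}"
  have denom: "\<exists>N q. real_polynomial_function q \<and> (\<forall>x. b x \<noteq> 0 \<longrightarrow> q x = b x ^ N * h (\<zeta> x))"
    if "h \<in> coord_polys m" for h
  proof (rule clear_denominators[OF that b(1)])
    fix i
    show "\<exists>N q. real_polynomial_function q \<and> (\<forall>x. b x \<noteq> 0 \<longrightarrow> q x = b x ^ N * \<zeta> x i)"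
    proof (cases "i < k")
      case True
      then show ?thesis using a by (intro exI[of _ 1] exI[of _ "a i"]) (auto simp: \<zeta>_def)
    next
      case False
      then show ?thesis by (intro exI[of _ 0] exI[of _ "\<lambda>x. x $ e (i - k)"]) (auto simp: \<zeta>_def real_polynomial_coord)
    qed
  qed
  have Q: "prime_ideal_in (coord_polys m) Q"
    unfolding prime_ideal_in_def
  proof (intro conjI ballI impI)
    show "0 \<in> Q" by (simp add: Q_def)
    show "1 \<notin> Q" using b(2) by (simp add: Q_def)
  next
    fix h g assume "h \<in> Q" "g \<in> Q"
    then have "\<forall>\<^sub>F x in F. b x \<noteq> 0 \<longrightarrow> h (\<zeta> x) = 0" "\<forall>\<^sub>F x in F. b x \<noteq> 0 \<longrightarrow> g (\<zeta> x) = 0"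
      by (auto simp: Q_def)
    then show "h + g \<in> Q" unfolding Q_def by (simp, eventually_elim) auto
  next
    fix h g assume "h \<in> Q"
    then have "\<forall>\<^sub>F x in F. b x \<noteq> 0 \<longrightarrow> h (\<zeta> x) = 0" by (auto simp: Q_def)
    then show "g * h \<in> Q" unfolding Q_def by (simp, eventually_elim) auto
  next
    fix h g assume h: "h \<in> coord_polys m" and g: "g \<in> coord_polys m" and hg: "h * g \<in> Q"
    obtain N p where p: "real_polynomial_function p" "\<forall>x. b x \<noteq> 0 \<longrightarrow> p x = b x ^ N * h (\<zeta> x)" using denom[OF h] by blast
    obtain M q where q: "real_polynomial_function q" "\<forall>x. b x \<noteq> 0 \<longrightarrow> q x = b x ^ M * g (\<zeta> x)" using denom[OF g] by blast
    have "\<forall>\<^sub>F x in F. b x \<noteq> 0 \<longrightarrow> h (\<zeta> x) * g (\<zeta> x) = 0" using hg by (auto simp: Q_def)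
    then have "\<forall>\<^sub>F x in F. b x * (p x * q x) = 0" by eventually_elim (use p q in auto)
    then have "\<forall>\<^sub>F x in F. p x * q x = 0"
      using F b real_polynomial_function.intros(4)[OF p(1) q(1)] unfolding prime_filter_def by blast
    then have "(\<forall>\<^sub>F x in F. p x = 0) \<or> (\<forall>\<^sub>F x in F. q x = 0)"
      using F p q unfolding prime_filter_def by blast
    moreover have "h \<in> Q" if "\<forall>\<^sub>F x in F. p x = 0"
      using that unfolding Q_def by (simp, eventually_elim) (use p in auto)
    moreover have "g \<in> Q" if "\<forall>\<^sub>F x in F. q x = 0"
      using that unfolding Q_def by (simp, eventually_elim) (use q in auto)
    ultimately show "h \<in> Q \<or> g \<in> Q" by blast
  qed
  have free: "transcendental_mod (coord_polys i) Q (\<lambda>z. z i)" if "i < k" for i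
  proof (rule transcendental_coord)
    fix h assume h: "h \<in> coord_polys (Suc i)" "h \<in> Q"
    have hk: "h \<in> coord_polys k" using polys_in_mono[of "Suc i" k] that h(1) by fastforce
    have "h (\<zeta> x) = h (\<lambda>i. a i x / b x)" for x
      by (rule coord_polys_local[OF hk]) (simp add: \<zeta>_def)
    then show "h = 0" using h(2) by (intro indep[OF hk]) (simp add: Q_def)
  qed (simp add: Q_def)
  have lift: "(\<lambda>z. p (\<tau> z)) \<in> coord_polys m" if "real_polynomial_function p" for p
  proof (rule compose_polys_in[OF that])
    show "(\<lambda>z. \<tau> z $ j) \<in> coord_polys m" for j
      using var_polys_in[of "k + \<iota> j" m "\<lambda>i z. z i"] \<iota>(1)[of j] by (simp add: \<tau>_def m_def)
  qed
  have lift_deriv: "dir_deriv (\<lambda>z. p (\<tau> z)) z w = frechet_derivative p (at (\<tau> z)) (\<tau> w)"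
    if p: "real_polynomial_function p" for p z w
  proof (rule dir_derivI)
    have \<tau>lin: "\<tau> (\<lambda>i. z i + s * w i) = \<tau> z + s *\<^sub>R \<tau> w" for s by (simp add: \<tau>_def vec_eq_iff)
    have 1: "((\<lambda>s. \<tau> z + s *\<^sub>R \<tau> w) has_derivative (\<lambda>s. s *\<^sub>R \<tau> w)) (at 0)"
      by (auto intro!: derivative_eq_intros)
    have "((\<lambda>s. p (\<tau> z + s *\<^sub>R \<tau> w)) has_derivative (\<lambda>s. frechet_derivative p (at (\<tau> z)) (s *\<^sub>R \<tau> w))) (at 0)"
      using has_derivative_compose[OF 1, of p "frechet_derivative p (at (\<tau> z))"] real_polynomial_has_derivative[OF p] by simp
    then show "((\<lambda>s. p (\<tau> (\<lambda>i. z i + s * w i))) has_real_derivative frechet_derivative p (at (\<tau> z)) (\<tau> w)) (at 0)"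
      unfolding \<tau>lin has_field_derivative_def
      by (simp add: linear_cmul[OF real_polynomial_linear_derivative[OF p]] mult_commute_abs)
  qed
  \<comment> \<open>The relation \<open>b * z i - a i = 0\<close> between the \<open>i\<close>-th fraction and the coordinates.\<close>
  define rel where "rel i = (\<lambda>z. b (\<tau> z)) * (\<lambda>z. z i) + (\<lambda>_. -1) * (\<lambda>z. a i (\<tau> z))" for i
  have cm: "(\<lambda>z. z i) \<in> coord_polys m" if "i < k" for i
    using that by (intro var_polys_in) (simp add: m_def)
  have relmem: "rel i \<in> coord_polys m" if "i < k" for i
    unfolding rel_def using that
    by (intro subring_setD(3,4)[OF subring_polys_in] lift b cm a const_polys_in)
  have relQ: "rel i \<in> Q" if "i < k" for i
    using that by (simp add: Q_def rel_def \<tau>\<zeta>) (simp add: \<zeta>_def)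
  have rel_deriv: "dir_deriv (rel i) z w = frechet_derivative b (at (\<tau> z)) (\<tau> w) * z i + b (\<tau> z) * w i
      - frechet_derivative (a i) (at (\<tau> z)) (\<tau> w)" if i: "i < k" for i z w
  proof -
    note B = lift[OF b(1)] and A = lift[OF a[OF i]] and X = cm[OF i]
      and C = const_polys_in[of "-1" "\<lambda>i z. z i" m]
    have "dir_deriv (rel i) z w = dir_deriv ((\<lambda>z. b (\<tau> z)) * (\<lambda>z. z i)) z w
       + dir_deriv ((\<lambda>_. -1) * (\<lambda>z. a i (\<tau> z))) z w"
      unfolding rel_def by (rule dir_deriv_add[where m = m]) (intro subring_setD(4)[OF subring_polys_in] B A X C)+
    then show ?thesis
      by (simp add: dir_deriv_mult[OF B X] dir_deriv_mult[OF C A] dir_deriv_var lift_deriv[OF b(1)] lift_deriv[OF a[OF i]])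
  qed
  define P' where "P' = (\<lambda>p z. p (\<tau> z)) ` P \<union> rel ` {..<k}"
  have "finite P'" using P(1) by (simp add: P'_def)
  moreover have "P' \<subseteq> coord_polys m \<inter> Q"
  proof -
    have "(\<lambda>z. p (\<tau> z)) \<in> Q" if "p \<in> P" for p
      using P(3)[OF that] by (simp add: Q_def \<tau>\<zeta>) (erule eventually_mono, simp)
    then show ?thesis using lift P(2) relmem relQ by (auto simp: P'_def)
  qed
  ultimately obtain E c where E: "finite E" "E \<subseteq> coord_polys m \<inter> Q" and c: "c \<in> coord_polys m - Q"
    and ext: "\<forall>z w0. (\<forall>g\<in>E. g z = 0) \<and> c z \<noteq> 0 \<longrightarrow>
      (\<exists>w. (\<forall>i<m. transcendental_mod (coord_polys i) Q (\<lambda>z. z i) \<longrightarrow> w i = w0 i) \<and>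
           (\<forall>p\<in>P'. dir_deriv p z w = 0))"
    using tangent_vectors_extend[OF Q, of P'] by blast
  have "\<forall>\<^sub>F x in F. \<forall>g\<in>E. b x \<noteq> 0 \<longrightarrow> g (\<zeta> x) = 0"
    using E by (intro eventually_ball_finite) (auto simp: Q_def)
  with D have ev: "\<forall>\<^sub>F x in F. dim {v. \<forall>p\<in>P. frechet_derivative p (at x) v = 0} \<le> D \<and>
      (\<forall>g\<in>E. b x \<noteq> 0 \<longrightarrow> g (\<zeta> x) = 0)" by (rule eventually_conj)
  have "\<exists>\<^sub>F x in F. b x \<noteq> 0 \<and> c (\<zeta> x) \<noteq> 0"
    using c unfolding Q_def frequently_def by (simp add: imp_conv_disj)
  from frequently_ex[OF frequently_eventually_frequently[OF this ev]]
  obtain x where x: "b x \<noteq> 0" "c (\<zeta> x) \<noteq> 0" "\<forall>g\<in>E. g (\<zeta> x) = 0"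
    "dim {v. \<forall>p\<in>P. frechet_derivative p (at x) v = 0} \<le> D" by blast
  define ok where "ok i w \<longleftrightarrow> (\<forall>l<k. w l = (if i = l then 1 else (0::real))) \<and> (\<forall>p\<in>P'. dir_deriv p (\<zeta> x) w = 0)"
    for i :: nat and w
  have "\<exists>w. ok i w" for i
  proof -
    from ext[THEN spec[of _ "\<zeta> x"], THEN spec[of _ "\<lambda>l. if i = l then 1 else 0"], THEN mp, OF conjI[OF x(3,2)]]
    obtain w where w: "\<forall>l<m. transcendental_mod (coord_polys l) Q (\<lambda>z. z l) \<longrightarrow> w l = (if i = l then 1 else 0)"
      "\<forall>p\<in>P'. dir_deriv p (\<zeta> x) w = 0" by (elim exE conjE)
    have "w l = (if i = l then 1 else 0)" if "l < k" for l
      using w(1)[THEN spec[of _ l]] free[OF that] that by (simp add: m_def)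
    then show ?thesis using w(2) unfolding ok_def by blast
  qed
  then obtain w where ok: "\<And>i. ok i (w i)" by metis
  have w: "\<And>i l. l < k \<Longrightarrow> w i l = (if i = l then 1 else (0::real))"
    "\<And>i p. p \<in> P' \<Longrightarrow> dir_deriv p (\<zeta> x) (w i) = 0" using ok unfolding ok_def by blast+
  let ?W = "{v. \<forall>p\<in>P. frechet_derivative p (at x) v = 0}"
  let ?\<phi> = "\<lambda>l v. (frechet_derivative (a l) (at x) v - frechet_derivative b (at x) v * (a l x / b x)) / b x"
  have "k \<le> dim ?W"
  proof (rule card_le_dim_of_dual_family[where v = "\<lambda>i. \<tau> (w i)" and \<phi> = ?\<phi>])
    fix i assume "i < k"
    have "frechet_derivative p (at x) (\<tau> (w i)) = 0" if "p \<in> P" for p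
      using w(2)[of "\<lambda>z. p (\<tau> z)" i] that lift_deriv[OF P(2)[OF that], of "\<zeta> x" "w i"] by (simp add: P'_def \<tau>\<zeta>)
    then show "\<tau> (w i) \<in> ?W" by blast
  next
    fix l assume l: "l < k"
    note la = real_polynomial_linear_derivative[OF a[OF l], of x] and lb = real_polynomial_linear_derivative[OF b(1), of x]
    show "linear (?\<phi> l)"
      by (rule linearI) (simp_all add: linear_add[OF la] linear_add[OF lb] linear_cmul[OF la] linear_cmul[OF lb] x(1) field_simps)
    fix i assume "i < k"
    have "0 = frechet_derivative b (at x) (\<tau> (w i)) * (a l x / b x) + b x * w i l
      - frechet_derivative (a l) (at x) (\<tau> (w i))"
      using w(2)[of "rel l" i] l rel_deriv[OF l, of "\<zeta> x" "w i"] by (simp add: P'_def \<tau>\<zeta>) (simp add: \<zeta>_def)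
    then have "?\<phi> l (\<tau> (w i)) = w i l" using x(1) by (simp add: field_simps)
    then show "?\<phi> l (\<tau> (w i)) = (if i = l then 1 else 0)" using w(1)[OF l] by simp
  qed
  then show ?thesis using x(4) by simp
qed

section \<open>Powers of the maximal ideal of a point\<close>

text \<open>The powers of the maximal ideal of \<open>c\<close> in the polynomial ring.\<close>

primrec vanishing_order :: "real^'n \<Rightarrow> nat \<Rightarrow> (real^'n \<Rightarrow> real) set" where
  "vanishing_order c 0 = polys"
| "vanishing_order c (Suc k) = {\<Sum>j\<in>UNIV. (\<lambda>y. y $ j - c $ j) * a j | a. \<forall>j. a j \<in> vanishing_order c k}"

lemma shifted_coord_poly: "(\<lambda>y::real^'n. y $ j - c $ j) \<in> polys"
  by (simp add: real_polynomial_function_diff real_polynomial_coord real_polynomial_function.intros(2))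

lemma vanishing_order_polys: "p \<in> vanishing_order c k \<Longrightarrow> p \<in> polys"
proof (induction k arbitrary: p)
  case (Suc k)
  then obtain a where a: "\<forall>j. a j \<in> vanishing_order c k" "p = (\<Sum>j\<in>UNIV. (\<lambda>y. y $ j - c $ j) * a j)" by auto
  have "(\<Sum>j\<in>UNIV. (\<lambda>y. y $ j - c $ j) * a j) \<in> polys"
    using a Suc.IH by (intro subring_set_sum[OF subring_polys] subring_setD(4)[OF subring_polys] shifted_coord_poly) auto
  then show ?case using a by simp
qed simp

lemma vanishing_order_add:
  "p \<in> vanishing_order c k \<Longrightarrow> q \<in> vanishing_order c k \<Longrightarrow> p + q \<in> vanishing_order c k"
proof (induction k arbitrary: p q)
  case 0 then show ?case using subring_setD(3)[OF subring_polys] by (simp only: vanishing_order.simps)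
next
  case (Suc k)
  then obtain a b where "\<forall>j. a j \<in> vanishing_order c k" "p = (\<Sum>j\<in>UNIV. (\<lambda>y. y $ j - c $ j) * a j)"
    "\<forall>j. b j \<in> vanishing_order c k" "q = (\<Sum>j\<in>UNIV. (\<lambda>y. y $ j - c $ j) * b j)" by auto
  then have "p + q = (\<Sum>j\<in>UNIV. (\<lambda>y. y $ j - c $ j) * (a j + b j))" "\<forall>j. a j + b j \<in> vanishing_order c k"
    using Suc.IH by (simp only: distrib_left sum.distrib, blast)
  then show ?case by auto
qed

lemma vanishing_order_mult_poly:
  "p \<in> polys \<Longrightarrow> q \<in> vanishing_order c k \<Longrightarrow> p * q \<in> vanishing_order c k"
proof (induction k arbitrary: q)
  case 0 then show ?case using subring_setD(4)[OF subring_polys] by (simp only: vanishing_order.simps)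
next
  case (Suc k)
  then obtain a where a: "\<forall>j. a j \<in> vanishing_order c k" "q = (\<Sum>j\<in>UNIV. (\<lambda>y. y $ j - c $ j) * a j)" by auto
  then have "p * q = (\<Sum>j\<in>UNIV. (\<lambda>y. y $ j - c $ j) * (p * a j))"
    by (simp only: sum_distrib_left mult.left_commute)
  moreover have "\<forall>j. p * a j \<in> vanishing_order c k" using Suc a by blast
  ultimately show ?case by auto
qed

lemma vanishing_order_zero: "0 \<in> vanishing_order c k"
proof (induction k)
  case 0 show ?case using subring_setD(2)[OF subring_polys] by (simp only: vanishing_order.simps)
next
  case (Suc k)
  have "0 = (\<Sum>j\<in>UNIV. (\<lambda>y. y $ j - c $ j) * (\<lambda>_. 0) j)" by (simp only: mult_zero_right sum.neutral_const)
  then show ?case using Suc unfolding vanishing_order.simps by (intro CollectI exI[of _ "\<lambda>_. 0"] conjI allI)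
qed

lemma vanishing_order_sum:
  "(\<And>i. i \<in> I \<Longrightarrow> f i \<in> vanishing_order c k) \<Longrightarrow> sum f I \<in> vanishing_order c k"
  by (induction I rule: infinite_finite_induct) (simp_all only: sum.infinite sum.empty sum.insert vanishing_order_zero vanishing_order_add insert_iff simp_thms)

lemma vanishing_order_mult:
  "p \<in> vanishing_order c k \<Longrightarrow> q \<in> vanishing_order c l \<Longrightarrow> p * q \<in> vanishing_order c (k + l)"
proof (induction k arbitrary: p)
  case 0 then show ?case by (simp only: vanishing_order.simps add_0) (rule vanishing_order_mult_poly)
next
  case (Suc k)
  then obtain a where a: "\<forall>j. a j \<in> vanishing_order c k" "p = (\<Sum>j\<in>UNIV. (\<lambda>y. y $ j - c $ j) * a j)" by auto
  then have "p * q = (\<Sum>j\<in>UNIV. (\<lambda>y. y $ j - c $ j) * (a j * q))"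
    by (simp only: sum_distrib_right mult.assoc)
  moreover have "\<forall>j. a j * q \<in> vanishing_order c (k + l)" using Suc a by blast
  ultimately show ?case by auto
qed

lemma vanishing_order_Suc: "p \<in> vanishing_order c (Suc k) \<Longrightarrow> p \<in> vanishing_order c k"
  by (auto intro!: vanishing_order_sum vanishing_order_mult_poly shifted_coord_poly)

lemma vanishing_order_antimono: "l \<le> k \<Longrightarrow> p \<in> vanishing_order c k \<Longrightarrow> p \<in> vanishing_order c l"
  by (induction rule: dec_induct) (auto dest: vanishing_order_Suc simp del: vanishing_order.simps)

lemma shifted_coord_order: "(\<lambda>y::real^'n. y $ j - c $ j) \<in> vanishing_order c 1"
proof -
  have "(\<lambda>y::real^'n. y $ j - c $ j) = (\<Sum>i\<in>UNIV. (\<lambda>y. y $ i - c $ i) * (\<lambda>_. if i = j then 1 else 0))"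
    by (auto simp: fun_eq_iff sum_fun_apply if_distrib[of "\<lambda>x. _ * x"] cong: if_cong)
  moreover have "\<forall>i. (\<lambda>_::real^'n. if i = j then 1 else (0::real)) \<in> polys" by (simp add: real_polynomial_function.intros(2))
  ultimately show ?thesis unfolding One_nat_def vanishing_order.simps
    by (intro CollectI exI[of _ "\<lambda>i _. if i = j then 1 else 0"]) blast
qed

lemma poly_order_one:
  "real_polynomial_function p \<Longrightarrow> (\<lambda>y. p y - p c) \<in> vanishing_order c 1"
proof (induction rule: real_polynomial_function.induct)
  case (linear f)
  have "(\<lambda>y. f y - f c) = (\<Sum>j\<in>UNIV. (\<lambda>_. f (axis j 1)) * (\<lambda>y. y $ j - c $ j))"
  proof
    fix y
    have "f y - f c = f (y - c)" using linear by (simp add: bounded_linear.linear linear_diff)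
    then show "f y - f c = (\<Sum>j\<in>UNIV. (\<lambda>_. f (axis j 1)) * (\<lambda>y. y $ j - c $ j)) y"
      using linear_functional_coords[OF bounded_linear.linear[OF linear], of "y - c"]
      by (simp add: sum_fun_apply mult.commute)
  qed
  also have "\<dots> \<in> vanishing_order c 1"
    by (intro vanishing_order_sum vanishing_order_mult_poly shifted_coord_order)
       (simp add: real_polynomial_function.intros(2))
  finally show ?case .
next
  case (const d) then show ?case using vanishing_order_zero[of c 1] by (simp add: zero_fun_def del: vanishing_order.simps)
next
  case (add f g)
  have "(\<lambda>y. f y + g y - (f c + g c)) = (\<lambda>y. f y - f c) + (\<lambda>y. g y - g c)" by auto
  then show ?case using vanishing_order_add[OF add.IH] by presburger
next
  case (mult f g)
  have "(\<lambda>y. f y * g y - f c * g c) = g * (\<lambda>y. f y - f c) + (\<lambda>_. f c) * (\<lambda>y. g y - g c)"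
    by (auto simp: algebra_simps)
  also have "\<dots> \<in> vanishing_order c 1"
    by (intro vanishing_order_add vanishing_order_mult_poly mult.IH)
       (simp_all add: mult.hyps real_polynomial_function.intros(2))
  finally show ?case .
qed

text \<open>First-order Taylor expansion: in \<open>p y - p c = \<Sum> (y\<^sub>j - c\<^sub>j) a\<^sub>j y\<close> the values \<open>a\<^sub>j c\<close> are
the partial derivatives at \<open>c\<close>.\<close>

lemma poly_order_two:
  fixes p :: "real^'n \<Rightarrow> real"
  assumes "real_polynomial_function p"
  shows "(\<lambda>y. p y - p c - frechet_derivative p (at c) (y - c)) \<in> vanishing_order c 2"
proof -
  have "(\<lambda>y. p y - p c) \<in> {\<Sum>j\<in>UNIV. (\<lambda>y. y $ j - c $ j) * a j | a. \<forall>j. a j \<in> vanishing_order c 0}"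
    using poly_order_one[OF assms, of c] unfolding One_nat_def vanishing_order.simps .
  then obtain a where a: "\<forall>j. a j \<in> polys" "(\<lambda>y. p y - p c) = (\<Sum>j\<in>UNIV. (\<lambda>y. y $ j - c $ j) * a j)" by auto
  have pa: "p y - p c = (\<Sum>j\<in>UNIV. (y $ j - c $ j) * a j y)" for y
    using fun_cong[OF a(2), of y] by (simp add: sum_fun_apply)
  have "((\<lambda>y. p c + (\<Sum>j\<in>UNIV. (y $ j - c $ j) * a j y)) has_derivative
      (\<lambda>v. 0 + (\<Sum>j\<in>UNIV. (c $ j - c $ j) * frechet_derivative (a j) (at c) v + (v $ j - 0) * a j c))) (at c)"
    using a(1) by (intro has_derivative_add has_derivative_const has_derivative_sum has_derivative_mult
        has_derivative_diff real_polynomial_has_derivative bounded_linear.has_derivative[OF bounded_linear_vec_nth] has_derivative_ident) auto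
  moreover have "(\<lambda>y. p c + (\<Sum>j\<in>UNIV. (y $ j - c $ j) * a j y)) = p"
    using pa by (auto simp: fun_eq_iff) (metis add_diff_cancel_left' add_diff_eq)
  ultimately have "(p has_derivative (\<lambda>v. \<Sum>j\<in>UNIV. v $ j * a j c)) (at c)" by simp
  then have D: "frechet_derivative p (at c) = (\<lambda>v. \<Sum>j\<in>UNIV. v $ j * a j c)"
    by (rule frechet_derivative_at[symmetric])
  have "(\<lambda>y. p y - p c - frechet_derivative p (at c) (y - c))
      = (\<Sum>j\<in>UNIV. (\<lambda>y. y $ j - c $ j) * (\<lambda>y. a j y - a j c))"
    by (auto simp: fun_eq_iff pa D sum_fun_apply algebra_simps sum_subtractf sum.distrib)
  moreover have "\<forall>j. (\<lambda>y. a j y - a j c) \<in> vanishing_order c 1"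
    using a(1) poly_order_one by (auto simp del: vanishing_order.simps)
  ultimately show ?thesis unfolding numeral_2_eq_2 vanishing_order.simps(2)[of c "Suc 0"]
    by (intro CollectI exI[of _ "\<lambda>j y. a j y - a j c"]) (simp del: vanishing_order.simps)
qed

lemma continuous_on_real_polynomial: "real_polynomial_function p \<Longrightarrow> continuous_on S p"
  using differentiable_on_real_polynomial_function differentiable_imp_continuous_on by blast

lemma vanishing_order_bound:
  fixes p :: "real^'n \<Rightarrow> real"
  assumes "p \<in> vanishing_order c k"
  shows "\<exists>C\<ge>0. \<forall>y. norm (y - c) \<le> 1 \<longrightarrow> \<bar>p y\<bar> \<le> C * norm (y - c) ^ k"
  using assms
proof (induction k arbitrary: p)
  case 0
  have "compact (p ` cball c 1)"
    using 0 by (intro compact_continuous_image continuous_on_real_polynomial) auto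
  then obtain C where C: "\<And>x. x \<in> p ` cball c 1 \<Longrightarrow> \<bar>x\<bar> \<le> C"
    using bounded_real compact_imp_bounded by metis
  have "\<bar>p c\<bar> \<le> C" using C by auto
  then have "C \<ge> 0" by linarith
  then show ?case using C by (intro exI[of _ C]) (auto simp: dist_norm norm_minus_commute)
next
  case (Suc k)
  then obtain a where a: "\<And>j. a j \<in> vanishing_order c k" "p = (\<Sum>j\<in>UNIV. (\<lambda>y. y $ j - c $ j) * a j)" by auto
  from Suc.IH[OF a(1)] obtain C where C: "\<And>j. C j \<ge> 0"
    "\<And>j y. norm (y - c) \<le> 1 \<Longrightarrow> \<bar>a j y\<bar> \<le> C j * norm (y - c) ^ k" by metis
  have "\<bar>p y\<bar> \<le> (\<Sum>j\<in>UNIV. C j) * norm (y - c) ^ Suc k" if "norm (y - c) \<le> 1" for y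
  proof -
    have "\<bar>p y\<bar> \<le> (\<Sum>j\<in>UNIV. \<bar>(y $ j - c $ j) * a j y\<bar>)"
      unfolding a(2) by (simp add: sum_fun_apply)
    also have "\<dots> \<le> (\<Sum>j\<in>UNIV. norm (y - c) * (C j * norm (y - c) ^ k))"
      unfolding abs_mult using C that component_le_norm_cart[of "y - c"]
      by (intro sum_mono mult_mono) auto
    also have "\<dots> = (\<Sum>j\<in>UNIV. C j) * norm (y - c) ^ Suc k"
      by (simp add: sum_distrib_right mult_ac)
    finally show ?thesis .
  qed
  then show ?case using C(1) by (intro exI[of _ "\<Sum>j\<in>UNIV. C j"]) (auto intro: sum_nonneg)
qed

section \<open>Krull's intersection theorem at a point\<close>

text \<open>Write \<open>h = \<kappa> N + f N\<close> with \<open>\<kappa> N\<close> in the ideal of \<open>P\<close> and \<open>f N\<close> in the \<open>N\<close>-th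
power of the maximal ideal. The elements \<open>f N * s ^ N\<close> belong to the Rees algebra, which is generated
by the coordinates \<open>y\<^sub>j\<close> and the products \<open>(y\<^sub>j - c\<^sub>j) s\<close> and hence is Noetherian. So one of them is a
combination of elements of \<open>P\<close> and earlier ones. In the coefficient of \<open>s ^ N\<close> every earlier \<open>f i\<close>
is multiplied by an element of the maximal ideal; modulo the ideal of \<open>P\<close> this reads \<open>h = \<mu> * h\<close>
with \<open>\<mu> c = 0\<close>, and \<open>1 - \<mu>\<close> is the required multiplier.\<close>

theorem krull_intersection_at_point:
  fixes c :: "real^'n"
  assumes P: "P \<subseteq> polys" and h: "h \<in> polys"
    and flat: "\<And>N. \<exists>\<kappa>\<in>generated_ideal polys P. h - \<kappa> \<in> vanishing_order c N"
  shows "\<exists>u\<in>polys. u c \<noteq> 0 \<and> u * h \<in> generated_ideal polys P"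
proof -
  obtain \<kappa> where \<kappa>: "\<And>N. \<kappa> N \<in> generated_ideal polys P" "\<And>N. h - \<kappa> N \<in> vanishing_order c N"
    using flat by metis
  define f where "f N = h - \<kappa> N" for N
  obtain e where e: "bij_betw e {..<CARD('n)} (UNIV :: 'n set)" using ex_enum by blast
  define F :: "nat \<Rightarrow> (real^'n) \<times> real \<Rightarrow> real"
    where "F i = (if i < CARD('n) then (\<lambda>z. fst z $ e i)
      else (\<lambda>z. (fst z $ e (i - CARD('n)) - c $ e (i - CARD('n))) * snd z))" for i
  define S where "S = polys_in F (CARD('n) + CARD('n))"
  have S: "subring_set S" "noetherian_set S" unfolding S_def by (rule subring_polys_in noetherian_polys_in)+
  have "(\<lambda>z. fst z $ j) \<in> S" for j
  proof -
    obtain i where "i < CARD('n)" "e i = j" using e by (metis UNIV_I bij_betw_iff_bijections lessThan_iff)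
    then show ?thesis using var_polys_in[of i "CARD('n) + CARD('n)" F] unfolding S_def by (simp add: F_def)
  qed
  then have base: "(\<lambda>z. q (fst z)) \<in> S" if "q \<in> polys" for q
    using compose_polys_in[where g = fst, OF that[unfolded polys_iff]] unfolding S_def by blast
  have gen: "(\<lambda>z. (fst z $ j - c $ j) * snd z) \<in> S" for j
  proof -
    obtain i where "i < CARD('n)" "e i = j" using e by (metis UNIV_I bij_betw_iff_bijections lessThan_iff)
    then show ?thesis using var_polys_in[of "CARD('n) + i" "CARD('n) + CARD('n)" F]
      unfolding S_def by (simp add: F_def)
  qed
  have rees: "(\<lambda>z. p (fst z) * snd z ^ k) \<in> S" if "p \<in> vanishing_order c k" for p k
    using that
  proof (induction k arbitrary: p)
    case 0 then show ?case using base by simp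
  next
    case (Suc k)
    then obtain a where a: "\<forall>j. a j \<in> vanishing_order c k" "p = (\<Sum>j\<in>UNIV. (\<lambda>y. y $ j - c $ j) * a j)" by auto
    have "(\<lambda>z. p (fst z) * snd z ^ Suc k) = (\<Sum>j\<in>UNIV. (\<lambda>z. (fst z $ j - c $ j) * snd z) * (\<lambda>z. a j (fst z) * snd z ^ k))"
      by (auto simp: fun_eq_iff a(2) sum_fun_apply sum_distrib_left mult_ac)
    also have "\<dots> \<in> S"
      using a Suc.IH by (intro subring_set_sum[OF S(1)] subring_setD(4)[OF S(1)] gen) auto
    finally show ?case .
  qed
  have expand: "\<exists>\<gamma>. (\<forall>y s. g (y, s) = poly (\<gamma> y) s) \<and> (\<forall>k. (\<lambda>y. coeff (\<gamma> y) k) \<in> vanishing_order c k)"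
    if "g \<in> S" for g
    using that unfolding S_def
  proof (induction rule: polys_in_induct)
    case (const d)
    have "(\<lambda>y. coeff [:d:] k) \<in> vanishing_order c k" for k
    proof (cases k)
      case (Suc l) then show ?thesis using vanishing_order_zero[of c k] by (simp add: zero_fun_def del: vanishing_order.simps)
    qed (simp add: real_polynomial_function.intros(2))
    then show ?case by (intro exI[of _ "\<lambda>_. [:d:]"]) auto
  next
    case (var i)
    show ?case
    proof (cases "i < CARD('n)")
      case True
      have "(\<lambda>y::real^'n. coeff [:y $ e i:] k) \<in> vanishing_order c k" for k
      proof (cases k)
        case (Suc l) then show ?thesis using vanishing_order_zero[of c k] by (simp add: zero_fun_def del: vanishing_order.simps)
      qed (simp add: real_polynomial_coord)
      then show ?thesis using True by (intro exI[of _ "\<lambda>y. [:y $ e i:]"]) (auto simp: F_def)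
    next
      case False
      let ?j = "e (i - CARD('n))"
      have "(\<lambda>y::real^'n. coeff [:0, y $ ?j - c $ ?j:] k) \<in> vanishing_order c k" for k
      proof (cases "k = 1")
        case True then show ?thesis using shifted_coord_order[of ?j c] by (simp del: vanishing_order.simps)
      next
        case False
        then have "(\<lambda>y::real^'n. coeff [:0, y $ ?j - c $ ?j:] k) = 0"
          by (auto simp: fun_eq_iff coeff_pCons split: nat.splits)
        then show ?thesis using vanishing_order_zero by metis
      qed
      then show ?thesis using False by (intro exI[of _ "\<lambda>y. [:0, y $ ?j - c $ ?j:]"]) (auto simp: F_def)
    qed
  next
    case (add p q)
    then obtain \<gamma> \<delta> where \<gamma>: "\<forall>y s. p (y, s) = poly (\<gamma> y) s" "\<forall>k. (\<lambda>y. coeff (\<gamma> y) k) \<in> vanishing_order c k"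
      and \<delta>: "\<forall>y s. q (y, s) = poly (\<delta> y) s" "\<forall>k. (\<lambda>y. coeff (\<delta> y) k) \<in> vanishing_order c k" by (elim exE conjE)
    have "(\<lambda>y. coeff (\<gamma> y + \<delta> y) k) \<in> vanishing_order c k" for k
      using vanishing_order_add[OF \<gamma>(2)[rule_format, of k] \<delta>(2)[rule_format, of k]] by (simp add: plus_fun_def)
    then show ?case using \<gamma> \<delta> by (intro exI[of _ "\<lambda>y. \<gamma> y + \<delta> y"]) auto
  next
    case (mult p q)
    then obtain \<gamma> \<delta> where \<gamma>: "\<forall>y s. p (y, s) = poly (\<gamma> y) s" "\<forall>k. (\<lambda>y. coeff (\<gamma> y) k) \<in> vanishing_order c k"
      and \<delta>: "\<forall>y s. q (y, s) = poly (\<delta> y) s" "\<forall>k. (\<lambda>y. coeff (\<delta> y) k) \<in> vanishing_order c k" by (elim exE conjE)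
    have "(\<lambda>y. coeff (\<gamma> y * \<delta> y) k) \<in> vanishing_order c k" for k
    proof -
      have "(\<lambda>y. coeff (\<gamma> y) i) * (\<lambda>y. coeff (\<delta> y) (k - i)) \<in> vanishing_order c k" if "i \<le> k" for i
        using vanishing_order_mult[OF \<gamma>(2)[rule_format, of i] \<delta>(2)[rule_format, of "k - i"]] that by simp
      then have "(\<Sum>i\<le>k. (\<lambda>y. coeff (\<gamma> y) i) * (\<lambda>y. coeff (\<delta> y) (k - i))) \<in> vanishing_order c k"
        by (intro vanishing_order_sum) auto
      also have "(\<Sum>i\<le>k. (\<lambda>y. coeff (\<gamma> y) i) * (\<lambda>y. coeff (\<delta> y) (k - i))) = (\<lambda>y. coeff (\<gamma> y * \<delta> y) k)"
        by (auto simp: fun_eq_iff sum_fun_apply coeff_mult)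
      finally show ?thesis .
    qed
    then show ?case using \<gamma> \<delta> by (intro exI[of _ "\<lambda>y. \<gamma> y * \<delta> y"]) auto
  qed
  define pt where "pt p = (\<lambda>z::(real^'n) \<times> real. p (fst z))" for p :: "real^'n \<Rightarrow> real"
  define ft where "ft N = (\<lambda>z::(real^'n) \<times> real. f N (fst z) * snd z ^ N)" for N
  define A where "A = pt ` P \<union> range ft"
  have "A \<subseteq> S"
    using base rees \<kappa>(2) P unfolding A_def pt_def ft_def f_def by blast
  then obtain B where B: "B \<subseteq> A" "finite B" "A \<subseteq> generated_ideal S B"
    using S(2) unfolding noetherian_set_def by blast
  have "finite (B \<inter> range ft)" using B(2) by blast
  then obtain C where C: "finite C" "B \<inter> range ft = ft ` C"
    using finite_subset_image[of "B \<inter> range ft" ft UNIV] by auto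
  obtain N where N: "C \<subseteq> {..<N}" using C(1) finite_nat_iff_bounded by blast
  have "B \<subseteq> pt ` P \<union> ft ` {..<N}" using B(1) C(2) N unfolding A_def by blast
  then have mem: "ft N \<in> generated_ideal S (pt ` P \<union> ft ` {..<N})"
    using B(3) generated_ideal_mono[of B "pt ` P \<union> ft ` {..<N}" S] unfolding A_def by blast
  let ?K = "generated_ideal polys P"
  \<comment> \<open>The coefficient of \<open>s ^ N\<close> of any combination is, modulo the ideal of \<open>P\<close>, a multiple of \<open>h\<close>
    by an element that vanishes at \<open>c\<close>: a contribution of \<open>ft i\<close> with \<open>i < N\<close> carries a coefficient of
    \<open>s ^ (N - i)\<close> in the Rees algebra, which lies in the maximal ideal.\<close>
  have coeff_N: "\<exists>\<gamma>. (\<forall>y s. x (y, s) = poly (\<gamma> y) s) \<and>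
      (\<exists>\<kappa>\<in>?K. \<exists>\<mu>\<in>vanishing_order c 1. (\<lambda>y. coeff (\<gamma> y) N) = \<kappa> + \<mu> * h)"
    if "x \<in> generated_ideal S (pt ` P \<union> ft ` {..<N})" for x
    using that
  proof induction
    case zero
    show ?case
      by (rule exI[of _ "\<lambda>_. 0"]) (auto simp: fun_eq_iff intro!: bexI[OF _ generated_ideal.zero] bexI[OF _ vanishing_order_zero] simp del: vanishing_order.simps)
  next
    case (step a g u)
    obtain \<gamma> where \<gamma>: "\<forall>y s. g (y, s) = poly (\<gamma> y) s" "\<forall>k. (\<lambda>y. coeff (\<gamma> y) k) \<in> vanishing_order c k"
      using expand[OF step(2)] by (elim exE conjE)
    obtain \<delta> \<kappa>1 \<mu>1 where \<delta>: "\<forall>y s. u (y, s) = poly (\<delta> y) s" "\<kappa>1 \<in> ?K" "\<mu>1 \<in> vanishing_order c 1"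
      "(\<lambda>y. coeff (\<delta> y) N) = \<kappa>1 + \<mu>1 * h" using step.IH by (elim exE conjE bexE)
    have "\<exists>\<epsilon>. (\<forall>y s. (g * a) (y, s) = poly (\<epsilon> y) s) \<and>
      (\<exists>\<kappa>\<in>?K. \<exists>\<mu>\<in>vanishing_order c 1. (\<lambda>y. coeff (\<epsilon> y) N) = \<kappa> + \<mu> * h)"
      using step(1)
    proof
      assume "a \<in> pt ` P"
      then obtain p where p: "p \<in> P" "a = pt p" by blast
      have "(\<lambda>y. coeff (\<gamma> y) N) * p \<in> ?K"
        using vanishing_order_polys[OF \<gamma>(2)[rule_format]] p(1)
        by (intro generated_ideal_mult[OF subring_polys] generated_ideal_base[OF subring_polys])
      moreover have "(\<lambda>y. coeff (smult (p y) (\<gamma> y)) N) = (\<lambda>y. coeff (\<gamma> y) N) * p + 0 * h"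
        by (auto simp: fun_eq_iff)
      moreover have "\<forall>y s. (g * a) (y, s) = poly (smult (p y) (\<gamma> y)) s"
        using \<gamma>(1) p(2) by (simp add: pt_def)
      ultimately show ?thesis using vanishing_order_zero
        by (intro exI[of _ "\<lambda>y. smult (p y) (\<gamma> y)"]) blast
    next
      assume "a \<in> ft ` {..<N}"
      then obtain i where i: "i < N" "a = ft i" by blast
      define \<mu> where "\<mu> = (\<lambda>y. coeff (\<gamma> y) (N - i))"
      have \<mu>: "\<mu> \<in> vanishing_order c 1"
        using i(1) vanishing_order_antimono[OF _ \<gamma>(2)[rule_format, of "N - i"], of 1] unfolding \<mu>_def by simp
      have "(- \<mu>) * \<kappa> i \<in> ?K"
        using vanishing_order_polys[OF \<mu>] \<kappa>(1) subring_setD(5)[OF subring_polys]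
        by (intro generated_ideal_mult[OF subring_polys]) blast+
      moreover have "(\<lambda>y. coeff (monom (f i y) i * \<gamma> y) N) = (- \<mu>) * \<kappa> i + \<mu> * h"
      proof
        fix y
        have "coeff (monom (f i y) i * \<gamma> y) N = f i y * \<mu> y"
          using i(1) by (simp add: coeff_monom_mult \<mu>_def)
        then show "coeff (monom (f i y) i * \<gamma> y) N = ((- \<mu>) * \<kappa> i + \<mu> * h) y"
          by (simp add: f_def algebra_simps)
      qed
      moreover have "\<forall>y s. (g * a) (y, s) = poly (monom (f i y) i * \<gamma> y) s"
        using \<gamma>(1) i(2) by (simp add: ft_def poly_monom)
      ultimately show ?thesis using \<mu> by (intro exI[of _ "\<lambda>y. monom (f i y) i * \<gamma> y"]) blast
    qed
    then obtain \<epsilon> \<kappa>2 \<mu>2 where \<epsilon>: "\<forall>y s. (g * a) (y, s) = poly (\<epsilon> y) s" "\<kappa>2 \<in> ?K" "\<mu>2 \<in> vanishing_order c 1"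
      "(\<lambda>y. coeff (\<epsilon> y) N) = \<kappa>2 + \<mu>2 * h" by (elim exE conjE bexE)
    have "(\<lambda>y. coeff (\<epsilon> y + \<delta> y) N) = (\<kappa>2 + \<kappa>1) + (\<mu>2 + \<mu>1) * h"
      using fun_cong[OF \<epsilon>(4)] fun_cong[OF \<delta>(4)] by (auto simp: fun_eq_iff algebra_simps)
    moreover have "\<forall>y s. (g * a + u) (y, s) = poly (\<epsilon> y + \<delta> y) s" using \<epsilon>(1) \<delta>(1) by simp
    ultimately show ?case
      using generated_ideal_add[OF \<epsilon>(2) \<delta>(2)] vanishing_order_add[OF \<epsilon>(3) \<delta>(3)]
      by (intro exI[of _ "\<lambda>y. \<epsilon> y + \<delta> y"]) blast
  qed
  obtain \<gamma> \<kappa>' \<mu> where \<gamma>: "\<forall>y s. ft N (y, s) = poly (\<gamma> y) s" "\<kappa>' \<in> ?K" "\<mu> \<in> vanishing_order c 1"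
    "(\<lambda>y. coeff (\<gamma> y) N) = \<kappa>' + \<mu> * h" using coeff_N[OF mem] by (elim exE conjE bexE)
  have "\<gamma> y = monom (f N y) N" for y
  proof (rule poly_ext)
    fix s show "poly (\<gamma> y) s = poly (monom (f N y) N) s"
      using \<gamma>(1)[rule_format, of y s] by (simp add: ft_def poly_monom)
  qed
  then have "f N = \<kappa>' + \<mu> * h" using \<gamma>(4) by simp
  then have "(1 - \<mu>) * h = \<kappa> N + \<kappa>'" by (simp add: f_def algebra_simps)
  then have "(1 - \<mu>) * h \<in> ?K" using generated_ideal_add[OF \<kappa>(1) \<gamma>(2)] by metis
  moreover have "1 - \<mu> \<in> polys" using subring_setD(6)[OF subring_polys] subring_setD(1)[OF subring_polys] vanishing_order_polys[OF \<gamma>(3)] by blast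
  moreover have "\<mu> c = 0"
    using \<gamma>(3) by (auto simp: sum_fun_apply)
  then have "(1 - \<mu>) c \<noteq> 0" by (simp add: fun_diff_def)
  ultimately show ?thesis by blast
qed

section \<open>The local ring of a complete intersection with independent differentials\<close>

primrec homogeneous :: "nat \<Rightarrow> (real^'n \<Rightarrow> real) set" where
  "homogeneous 0 = constants"
| "homogeneous (Suc k) = {\<Sum>j\<in>UNIV. (\<lambda>v. v $ j) * a j | a. \<forall>j. a j \<in> homogeneous k}"

lemma homogeneous_scale: "Q \<in> homogeneous k \<Longrightarrow> Q (s *\<^sub>R v) = s ^ k * Q v"
proof (induction k arbitrary: Q)
  case 0 then show ?case by (auto simp: constants_def)
next
  case (Suc k)
  then obtain a where a: "\<forall>j. a j \<in> homogeneous k" "Q = (\<Sum>j\<in>UNIV. (\<lambda>v. v $ j) * a j)" by auto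
  then have "a j (s *\<^sub>R v) = s ^ k * a j v" for j using Suc.IH by blast
  then show ?case by (simp add: a(2) sum_fun_apply sum_distrib_left mult_ac)
qed

lemma homogeneous_polys: "Q \<in> homogeneous k \<Longrightarrow> Q \<in> polys"
proof (induction k arbitrary: Q)
  case 0 then show ?case by (auto simp: constants_def real_polynomial_function.intros(2))
next
  case (Suc k)
  then obtain a where a: "\<forall>j. a j \<in> homogeneous k" "Q = (\<Sum>j\<in>UNIV. (\<lambda>v. v $ j) * a j)" by auto
  have "(\<Sum>j\<in>UNIV. (\<lambda>v. v $ j) * a j) \<in> polys"
    using a Suc.IH by (intro subring_set_sum[OF subring_polys] subring_setD(4)[OF subring_polys]) (auto simp: real_polynomial_coord)
  then show ?case using a by simp
qed

lemma real_polynomial_finite_roots: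
  fixes r :: "real \<Rightarrow> real"
  assumes "real_polynomial_function r" "r s0 \<noteq> 0"
  shows "finite {s. r s = 0}"
proof -
  obtain a n where r: "r = (\<lambda>x. \<Sum>i\<le>n. a i * x ^ i)" using assms(1) unfolding real_polynomial_function_iff_sum by blast
  have "\<exists>i\<le>n. a i \<noteq> 0"
  proof (rule ccontr)
    assume "\<not> ?thesis"
    then have "r s0 = 0" unfolding r by simp
    then show False using assms(2) by simp
  qed
  then show ?thesis using polyfun_finite_roots[where n = n and c = a] unfolding r by blast
qed

text \<open>On the line through \<open>x\<close> and \<open>y\<close> each of the two polynomials has only finitely many zeros.\<close>

lemma real_polynomial_common_nonzero:
  fixes f g :: "real^'n \<Rightarrow> real"
  assumes f: "real_polynomial_function f" "f x \<noteq> 0" and g: "real_polynomial_function g" "g y \<noteq> 0"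
  shows "\<exists>z. f z \<noteq> 0 \<and> g z \<noteq> 0"
proof -
  have line: "polynomial_function (\<lambda>s::real. x + s *\<^sub>R (y - x))"
    by (intro polynomial_function_add polynomial_function_const polynomial_function_mult polynomial_function_id)
  have "finite {s. (f \<circ> (\<lambda>s. x + s *\<^sub>R (y - x))) s = 0}"
    by (rule real_polynomial_finite_roots[OF real_polynomial_function_compose[OF line f(1)], of 0]) (use f in simp)
  moreover have "finite {s. (g \<circ> (\<lambda>s. x + s *\<^sub>R (y - x))) s = 0}"
    by (rule real_polynomial_finite_roots[OF real_polynomial_function_compose[OF line g(1)], of 1]) (use g in simp)
  ultimately have "finite ({s. f (x + s *\<^sub>R (y - x)) = 0} \<union> {s. g (x + s *\<^sub>R (y - x)) = 0})" by simp
  then obtain s where "s \<notin> {s. f (x + s *\<^sub>R (y - x)) = 0} \<union> {s. g (x + s *\<^sub>R (y - x)) = 0}"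
    using ex_new_if_finite[OF infinite_UNIV_char_0] by blast
  then show ?thesis by blast
qed

lemma real_polynomial_derivative_poly:
  "real_polynomial_function q \<Longrightarrow> real_polynomial_function (\<lambda>y. frechet_derivative q (at y) v)"
proof (induction rule: real_polynomial_function.induct)
  case (linear f)
  have "frechet_derivative f (at y) = f" for y
    using frechet_derivative_at[OF bounded_linear_imp_has_derivative[OF linear]] by metis
  then show ?case by (simp add: real_polynomial_function.intros(2))
next
  case (const c)
  then show ?case by (simp add: frechet_derivative_const real_polynomial_function.intros(2))
next
  case (add f g)
  have "frechet_derivative (\<lambda>x. f x + g x) (at y) = (\<lambda>v. frechet_derivative f (at y) v + frechet_derivative g (at y) v)" for y
    using frechet_derivative_at[OF has_derivative_add[OF real_polynomial_has_derivative[OF add.hyps(1)] real_polynomial_has_derivative[OF add.hyps(2)]]] by metis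
  then show ?case using add.IH by (simp add: real_polynomial_function.intros(3))
next
  case (mult f g)
  have "frechet_derivative (\<lambda>x. f x * g x) (at y) = (\<lambda>v. f y * frechet_derivative g (at y) v + frechet_derivative f (at y) v * g y)" for y
    using frechet_derivative_at[OF has_derivative_mult[OF real_polynomial_has_derivative[OF mult.hyps(1)] real_polynomial_has_derivative[OF mult.hyps(2)]]] by metis
  then show ?case using mult by (simp add: real_polynomial_function.intros(3,4))
qed

lemma dim_common_kernel:
  fixes g :: "'b \<Rightarrow> 'a::euclidean_space"
  shows "dim {v. \<forall>b\<in>B. g b \<bullet> v = 0} + dim (span (g ` B)) = DIM('a)"
proof -
  have "{v. \<forall>b\<in>B. g b \<bullet> v = 0} = {y \<in> UNIV. \<forall>x\<in>span (g ` B). orthogonal x y}"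
  proof (intro equalityI subsetI)
    fix v assume v: "v \<in> {v. \<forall>b\<in>B. g b \<bullet> v = 0}"
    have "orthogonal v x" if "x \<in> span (g ` B)" for x
      using that v by (intro orthogonal_to_span[OF that]) (auto simp: orthogonal_def inner_commute)
    then show "v \<in> {y \<in> UNIV. \<forall>x\<in>span (g ` B). orthogonal x y}" by (simp add: orthogonal_commute)
  next
    fix v assume "v \<in> {y \<in> UNIV. \<forall>x\<in>span (g ` B). orthogonal x y}"
    then show "v \<in> {v. \<forall>b\<in>B. g b \<bullet> v = 0}" using span_base[of _ "g ` B"] by (auto simp: orthogonal_def)
  qed
  then show ?thesis using dim_subspace_orthogonal_to_vectors[OF subspace_span subspace_UNIV, of "g ` B"] by simp
qed

text \<open>Orthonormality of the gradients costs nothing, since a linear combination of equations is again an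
equation, and it makes the differential of the chart below the identity.\<close>

locale regular_equations =
  fixes c :: "real^'n" and B :: "(real^'n) set" and p :: "real^'n \<Rightarrow> real^'n \<Rightarrow> real"
  assumes fin: "finite B"
    and orthonormal: "\<And>a b. a \<in> B \<Longrightarrow> b \<in> B \<Longrightarrow> a \<bullet> b = (if a = b then 1 else 0)"
    and poly: "\<And>b. b \<in> B \<Longrightarrow> real_polynomial_function (p b)"
    and at_point: "\<And>b. b \<in> B \<Longrightarrow> p b c = 0"
    and gradient: "\<And>b v. b \<in> B \<Longrightarrow> frechet_derivative (p b) (at c) v = b \<bullet> v"
begin

definition zeros :: "(real^'n) set" where "zeros = {y. \<forall>b\<in>B. p b y = 0}"

text \<open>The punctual germ at \<open>c\<close> of the zero set, as a filter.\<close>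

definition germ :: "(real^'n) filter" where "germ = inf (nhds c) (principal zeros)"

definition equations :: "(real^'n \<Rightarrow> real) set" where "equations = generated_ideal polys (p ` B)"

text \<open>The orthogonal projection onto the tangent space.\<close>

definition proj :: "real^'n \<Rightarrow> real^'n" where "proj v = v - (\<Sum>b\<in>B. (b \<bullet> v) *\<^sub>R b)"

lemma linear_proj: "linear proj"
  unfolding proj_def
  by (rule linearI) (simp_all add: inner_add_right scaleR_add_left sum.distrib scaleR_diff_right scaleR_sum_right algebra_simps)

lemma proj_orthogonal: "b \<in> B \<Longrightarrow> b \<bullet> proj v = 0"
proof -
  assume b: "b \<in> B"
  have "(\<Sum>a\<in>B. (a \<bullet> v) * (b \<bullet> a)) = (\<Sum>a\<in>B. if a = b then a \<bullet> v else 0)"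
    using b by (intro sum.cong) (auto simp: orthonormal)
  then show ?thesis using b fin by (simp add: proj_def inner_diff_right inner_sum_right)
qed

lemma poly_proj:
  assumes "Q \<in> polys" shows "(\<lambda>y. Q (proj (y - c))) \<in> polys"
proof -
  have "polynomial_function proj"
    by (intro polynomial_function_bounded_linear linear_conv_bounded_linear[THEN iffD1] linear_proj)
  moreover have "polynomial_function (\<lambda>y. y - c)" by (intro polynomial_function_diff) auto
  ultimately have "polynomial_function (proj \<circ> (\<lambda>y. y - c))" by (rule polynomial_function_compose[rotated])
  then show ?thesis using real_polynomial_function_compose[of "proj \<circ> (\<lambda>y. y - c)" Q] assms by (simp add: o_def)
qed

lemma equations_vanish: "h \<in> equations \<Longrightarrow> y \<in> zeros \<Longrightarrow> h y = 0"
  unfolding equations_def zeros_def by (erule generated_ideal_vanishes) auto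

lemma equations_base: "b \<in> B \<Longrightarrow> p b \<in> equations"
  unfolding equations_def by (intro generated_ideal_base[OF subring_polys]) auto

lemma equations_add: "g \<in> equations \<Longrightarrow> h \<in> equations \<Longrightarrow> g + h \<in> equations"
  unfolding equations_def by (rule generated_ideal_add)

lemma equations_mult: "g \<in> polys \<Longrightarrow> h \<in> equations \<Longrightarrow> g * h \<in> equations"
  unfolding equations_def by (rule generated_ideal_mult[OF subring_polys])

lemma equations_sum: "(\<And>i. i \<in> I \<Longrightarrow> f i \<in> equations) \<Longrightarrow> sum f I \<in> equations"
  unfolding equations_def by (rule generated_ideal_sum)

lemma equations_zero: "0 \<in> equations"
  unfolding equations_def by (rule generated_ideal.zero)

lemma proj_coord_order: "(\<lambda>y. proj (y - c) $ j) \<in> vanishing_order c 1"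
proof -
  have "(\<lambda>y. (\<lambda>v. v $ j) (proj (y - c))) \<in> polys" by (rule poly_proj) (simp add: real_polynomial_coord)
  from poly_order_one[of "\<lambda>y. proj (y - c) $ j" c] this
  show ?thesis by (simp add: linear_0[OF linear_proj] del: vanishing_order.simps)
qed

lemma homogeneous_proj_order:
  "Q \<in> homogeneous k \<Longrightarrow> (\<lambda>y. Q (proj (y - c))) \<in> vanishing_order c k"
proof (induction k arbitrary: Q)
  case 0
  then show ?case by (auto simp: constants_def real_polynomial_function.intros(2))
next
  case (Suc k)
  then obtain a where a: "\<forall>j. a j \<in> homogeneous k" "Q = (\<Sum>j\<in>UNIV. (\<lambda>v. v $ j) * a j)" by auto
  have "(\<lambda>y. proj (y - c) $ j) * (\<lambda>y. a j (proj (y - c))) \<in> vanishing_order c (1 + k)" for j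
    using a Suc.IH by (intro vanishing_order_mult proj_coord_order) auto
  then have "(\<Sum>j\<in>UNIV. (\<lambda>y. proj (y - c) $ j) * (\<lambda>y. a j (proj (y - c)))) \<in> vanishing_order c (1 + k)"
    by (rule vanishing_order_sum)
  also have "(\<Sum>j\<in>UNIV. (\<lambda>y. proj (y - c) $ j) * (\<lambda>y. a j (proj (y - c)))) = (\<lambda>y. Q (proj (y - c)))"
    by (auto simp: a(2) fun_eq_iff sum_fun_apply)
  finally show ?case by (simp only: plus_1_eq_Suc)
qed

text \<open>Modulo the equations and terms of second order, the coordinates are linear functions on the tangent
space.\<close>

lemma coord_decomposition:
  "\<exists>\<kappa>\<in>equations. \<exists>r\<in>vanishing_order c 2. (\<lambda>y. y $ j - c $ j) = (\<lambda>y. proj (y - c) $ j) + \<kappa> + r"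
proof -
  define r where "r b = (\<lambda>y. p b y - p b c - frechet_derivative (p b) (at c) (y - c))" for b
  have r: "r b \<in> vanishing_order c 2" if "b \<in> B" for b
    unfolding r_def by (rule poly_order_two[OF poly[OF that]])
  have const: "(\<lambda>_::real^'n. d) \<in> polys" for d by (simp add: real_polynomial_function.intros(2))
  define \<kappa> where "\<kappa> = (\<Sum>b\<in>B. (\<lambda>_. b $ j) * p b)"
  define R where "R = (\<Sum>b\<in>B. (\<lambda>_. - b $ j) * r b)"
  have "\<kappa> \<in> equations" unfolding \<kappa>_def by (intro equations_sum equations_mult const equations_base)
  moreover have "R \<in> vanishing_order c 2" unfolding R_def by (intro vanishing_order_sum vanishing_order_mult_poly const r)
  moreover have "(\<lambda>y. y $ j - c $ j) = (\<lambda>y. proj (y - c) $ j) + \<kappa> + R"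
  proof
    fix y
    have "b \<bullet> (y - c) = p b y - r b y" if "b \<in> B" for b
      using that by (simp add: r_def at_point gradient)
    then have "(\<Sum>b\<in>B. (b \<bullet> (y - c)) *\<^sub>R b) $ j = (\<Sum>b\<in>B. (p b y - r b y) * b $ j)"
      by simp
    then show "y $ j - c $ j = ((\<lambda>y. proj (y - c) $ j) + \<kappa> + R) y"
      by (simp add: proj_def \<kappa>_def R_def sum_fun_apply algebra_simps sum_subtractf sum_negf)
  qed
  ultimately show ?thesis by blast
qed

text \<open>The associated graded ring of the local ring of the zero set is generated by linear forms on the
tangent space.\<close>

lemma initial_form:
  assumes "h \<in> vanishing_order c k"
  shows "\<exists>Q\<in>homogeneous k. \<exists>\<kappa>\<in>equations. \<exists>r\<in>vanishing_order c (Suc k). h = \<kappa> + (\<lambda>y. Q (proj (y - c))) + r"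
  using assms
proof (induction k arbitrary: h)
  case 0
  then have "(\<lambda>y. h y - h c) \<in> vanishing_order c (Suc 0)" using poly_order_one[of h c] by (simp del: vanishing_order.simps(2))
  moreover have "h = 0 + (\<lambda>y. h c) + (\<lambda>y. h y - h c)" by auto
  moreover have "(\<lambda>_. h c) \<in> homogeneous 0" by (simp add: constants_def)
  ultimately show ?case using equations_zero by (intro bexI[of _ "\<lambda>_. h c"] bexI[of _ 0] bexI[of _ "\<lambda>y. h y - h c"])
next
  case (Suc k)
  then obtain a where a: "\<And>j. a j \<in> vanishing_order c k" "h = (\<Sum>j\<in>UNIV. (\<lambda>y. y $ j - c $ j) * a j)" by auto
  define ok where "ok j Q \<kappa> r \<longleftrightarrow> Q \<in> homogeneous k \<and> \<kappa> \<in> equations \<and> r \<in> vanishing_order c (Suc k) \<and>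
    a j = \<kappa> + (\<lambda>y. Q (proj (y - c))) + r" for j Q \<kappa> r
  have "\<forall>j. \<exists>Q \<kappa> r. ok j Q \<kappa> r" using Suc.IH[OF a(1)] unfolding ok_def by blast
  then obtain Q \<kappa> r where ok: "\<And>j. ok j (Q j) (\<kappa> j) (r j)" by metis
  define ok2 where "ok2 j \<eta> s \<longleftrightarrow> \<eta> \<in> equations \<and> s \<in> vanishing_order c 2 \<and>
    (\<lambda>y. y $ j - c $ j) = (\<lambda>y. proj (y - c) $ j) + \<eta> + s" for j \<eta> s
  have "\<forall>j. \<exists>\<eta> s. ok2 j \<eta> s" using coord_decomposition unfolding ok2_def by blast
  then obtain \<eta> s where ok2: "\<And>j. ok2 j (\<eta> j) (s j)" by metis
  define Qp where "Qp j = (\<lambda>y. Q j (proj (y - c)))" for j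
  define X where "X j = (\<lambda>y. y $ j - c $ j)" for j
  define Y where "Y j = (\<lambda>y. proj (y - c) $ j)" for j
  have A: "a j = \<kappa> j + Qp j + r j" "X j = Y j + \<eta> j + s j" for j
    using ok[of j] ok2[of j] unfolding ok_def ok2_def Qp_def X_def Y_def by blast+
  have X1: "X j \<in> vanishing_order c 1" for j unfolding X_def by (rule shifted_coord_order)
  have Qpk: "Qp j \<in> vanishing_order c k" for j using ok[of j] homogeneous_proj_order unfolding ok_def Qp_def by blast
  have split: "X j * a j = (X j * \<kappa> j + Qp j * \<eta> j) + Y j * Qp j + (s j * Qp j + X j * r j)" for j
  proof -
    have "X j * a j = X j * \<kappa> j + X j * Qp j + X j * r j" by (simp only: A(1) distrib_left)
    moreover have "X j * Qp j = Y j * Qp j + Qp j * \<eta> j + s j * Qp j"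
      unfolding A(2) by (simp only: distrib_right mult.commute[of "Qp j"])
    ultimately show ?thesis by (simp only: add_ac)
  qed
  have "X j * \<kappa> j + Qp j * \<eta> j \<in> equations" for j
    using ok[of j] ok2[of j] vanishing_order_polys[OF X1] vanishing_order_polys[OF Qpk]
    unfolding ok_def ok2_def by (intro equations_add equations_mult) blast+
  then have 1: "(\<Sum>j\<in>UNIV. X j * \<kappa> j + Qp j * \<eta> j) \<in> equations" by (intro equations_sum)
  have "s j * Qp j \<in> vanishing_order c (2 + k)" for j
    using ok2[of j] Qpk unfolding ok2_def by (intro vanishing_order_mult) blast+
  moreover have "X j * r j \<in> vanishing_order c (1 + Suc k)" for j
    using ok[of j] X1 unfolding ok_def by (intro vanishing_order_mult) blast+
  ultimately have "s j * Qp j + X j * r j \<in> vanishing_order c (Suc (Suc k))" for j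
    by (intro vanishing_order_add) (simp_all del: vanishing_order.simps)
  then have 2: "(\<Sum>j\<in>UNIV. s j * Qp j + X j * r j) \<in> vanishing_order c (Suc (Suc k))" by (intro vanishing_order_sum)
  define Q' where "Q' = (\<Sum>j\<in>UNIV. (\<lambda>v. v $ j) * Q j)"
  have "Q' \<in> homogeneous (Suc k)" using ok unfolding Q'_def ok_def by auto
  moreover have "(\<Sum>j\<in>UNIV. Y j * Qp j) = (\<lambda>y. Q' (proj (y - c)))"
    by (auto simp: Q'_def Y_def Qp_def fun_eq_iff sum_fun_apply)
  moreover have "h = (\<Sum>j\<in>UNIV. X j * \<kappa> j + Qp j * \<eta> j) + (\<Sum>j\<in>UNIV. Y j * Qp j) + (\<Sum>j\<in>UNIV. s j * Qp j + X j * r j)"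
    unfolding a(2) X_def[symmetric] split sum.distrib by (simp only: add_ac)
  ultimately have Q': "Q' \<in> homogeneous (Suc k)" "h = (\<Sum>j\<in>UNIV. X j * \<kappa> j + Qp j * \<eta> j) +
    (\<lambda>y. Q' (proj (y - c))) + (\<Sum>j\<in>UNIV. s j * Qp j + X j * r j)" by simp_all
  show ?case by (rule bexI[OF _ Q'(1)], rule bexI[OF _ 1], rule bexI[OF _ 2], rule Q'(2))
qed

definition chart :: "real^'n \<Rightarrow> real^'n" where
  "chart y = proj (y - c) + (\<Sum>b\<in>B. p b y *\<^sub>R b)"

lemma chart_derivative: "(chart has_derivative (\<lambda>v. v)) (at c)"
proof -
  have bl: "bounded_linear proj" using linear_conv_bounded_linear linear_proj by blast
  have "((\<lambda>y. proj (y - c) + (\<Sum>b\<in>B. p b y *\<^sub>R b)) has_derivative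
      (\<lambda>v. proj (v - 0) + (\<Sum>b\<in>B. frechet_derivative (p b) (at c) v *\<^sub>R b))) (at c)"
    by (intro has_derivative_add bounded_linear.has_derivative[OF bl] has_derivative_diff has_derivative_ident
        has_derivative_const has_derivative_sum bounded_linear.has_derivative[OF bounded_linear_scaleR_left]
        real_polynomial_has_derivative poly)
  moreover have "proj (v - 0) + (\<Sum>b\<in>B. frechet_derivative (p b) (at c) v *\<^sub>R b) = v" for v
    by (simp add: gradient proj_def)
  ultimately show ?thesis by (simp add: chart_def[abs_def])
qed

lemma chart_inner: "b \<in> B \<Longrightarrow> b \<bullet> chart y = p b y"
proof -
  assume b: "b \<in> B"
  have "(\<Sum>a\<in>B. p a y * (b \<bullet> a)) = (\<Sum>a\<in>B. if a = b then p a y else 0)"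
    using b by (intro sum.cong) (auto simp: orthonormal)
  then show ?thesis using b fin by (simp add: chart_def inner_add_right inner_sum_right proj_orthogonal)
qed

text \<open>The chart has the identity as differential at \<open>c\<close>, so it maps every neighbourhood of \<open>c\<close> onto a
neighbourhood of \<open>0\<close> and distorts distances from \<open>c\<close> by at most the factor \<open>2\<close> near \<open>c\<close>. A
preimage of \<open>s *\<^sub>R w\<close>, with \<open>w\<close> tangent, satisfies all equations.\<close>

lemma curve_in_zeros:
  assumes w: "\<And>b. b \<in> B \<Longrightarrow> b \<bullet> w = 0"
  shows "\<exists>\<gamma> s0. s0 > (0::real) \<and> (\<forall>s. 0 < s \<and> s < s0 \<longrightarrow>
     \<gamma> s \<in> zeros \<and> proj (\<gamma> s - c) = s *\<^sub>R w \<and> norm (\<gamma> s - c) \<le> 2 * s * norm w)"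
proof -
  have c0: "chart c = 0" by (simp add: chart_def linear_0[OF linear_proj] at_point)
  have alt: "\<forall>e>0. \<exists>d>0. \<forall>y. norm (y - c) < d \<longrightarrow> norm (chart y - chart c - (y - c)) \<le> e * norm (y - c)"
    using chart_derivative unfolding has_derivative_at_alt by blast
  from alt[THEN spec[of _ "1/2"]] obtain d where d0: "d > 0"
    "\<forall>y. norm (y - c) < d \<longrightarrow> norm (chart y - chart c - (y - c)) \<le> 1/2 * norm (y - c)" by auto
  then have d: "d > 0" "\<And>y. norm (y - c) < d \<Longrightarrow> norm (chart y - (y - c)) \<le> 1/2 * norm (y - c)"
    using c0 by simp_all
  have "continuous_on UNIV chart"
    unfolding chart_def
    by (intro continuous_intros linear_continuous_on_compose[OF _ linear_proj] continuous_on_real_polynomial poly)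
  then have "chart c \<in> interior (chart ` ball c d)"
    using sussmann_open_mapping[OF open_UNIV _ UNIV_I chart_derivative, of "\<lambda>v. v" "ball c d"] d(1)
    by (simp add: fun_eq_iff)
  then obtain \<delta> where \<delta>: "\<delta> > 0" "ball 0 \<delta> \<subseteq> chart ` ball c d" using c0 by (auto simp: mem_interior)
  have "\<exists>y. y \<in> zeros \<and> proj (y - c) = s *\<^sub>R w \<and> norm (y - c) \<le> 2 * s * norm w"
    if s: "0 < s" "s < \<delta> / (norm w + 1)" for s
  proof -
    have "s * norm w \<le> s * (norm w + 1)" using s by simp
    also have "\<dots> < \<delta>" using s by (simp add: pos_less_divide_eq add_nonneg_pos)
    finally have "s *\<^sub>R w \<in> ball 0 \<delta>" using s by simp
    then have "s *\<^sub>R w \<in> chart ` ball c d" using \<delta>(2) by blast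
    then obtain y where "s *\<^sub>R w = chart y" "y \<in> ball c d" by (rule imageE)
    then have y: "chart y = s *\<^sub>R w" "norm (y - c) < d" by (simp_all add: dist_norm norm_minus_commute)
    have z: "p b y = 0" if "b \<in> B" for b using chart_inner[OF that, of y] y(1) w[OF that] by simp
    then have pr: "proj (y - c) = s *\<^sub>R w" using y(1) by (simp add: chart_def)
    have "norm (y - c) \<le> norm (chart y) + norm (chart y - (y - c))"
      using norm_triangle_ineq4[of "chart y" "chart y - (y - c)"] by simp
    with d(2)[OF y(2)] have "norm (y - c) \<le> 2 * norm (chart y)" by linarith
    then show ?thesis using z pr y(1) s(1) by (intro exI[of _ y]) (auto simp: zeros_def)
  qed
  then have "\<exists>\<gamma>. \<forall>s. 0 < s \<and> s < \<delta> / (norm w + 1) \<longrightarrow>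
     \<gamma> s \<in> zeros \<and> proj (\<gamma> s - c) = s *\<^sub>R w \<and> norm (\<gamma> s - c) \<le> 2 * s * norm w"
    by metis
  moreover have "\<delta> / (norm w + 1) > 0" using \<delta>(1) by (simp add: add_nonneg_pos)
  ultimately show ?thesis by blast
qed

text \<open>Along the curve the initial form is of exact order \<open>s ^ k\<close> and the remainder is of order
\<open>s ^ Suc k\<close>.\<close>

lemma nonzero_along_curve:
  assumes \<gamma>: "s0 > 0" "\<And>s. 0 < s \<Longrightarrow> s < s0 \<Longrightarrow> \<gamma> s \<in> zeros \<and> proj (\<gamma> s - c) = s *\<^sub>R w \<and> norm (\<gamma> s - c) \<le> 2 * s * norm w"
    and Q: "Q \<in> homogeneous k" "Q w \<noteq> 0"
    and h: "\<kappa> \<in> equations" "r \<in> vanishing_order c (Suc k)" "h = \<kappa> + (\<lambda>y. Q (proj (y - c))) + r"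
  shows "\<forall>\<^sub>F s in at_right 0. h (\<gamma> s) \<noteq> 0"
proof -
  obtain C where C: "C \<ge> 0" "\<And>y. norm (y - c) \<le> 1 \<Longrightarrow> \<bar>r y\<bar> \<le> C * norm (y - c) ^ Suc k"
    using vanishing_order_bound[OF h(2)] by blast
  define D where "D = C * (2 * norm w) ^ Suc k + 1"
  have D: "D > 0" using C(1) by (simp add: D_def add_nonneg_pos)
  \<comment> \<open>Small enough to stay within distance \<open>1\<close> of \<open>c\<close> and to make the remainder, which is at most
    \<open>D * s ^ Suc k\<close>, smaller than \<open>s ^ k * \<bar>Q w\<bar>\<close>.\<close>
  define s1 where "s1 = min (min s0 (1 / (2 * norm w + 1))) (\<bar>Q w\<bar> / D)"
  have "s1 > 0" using \<gamma>(1) Q(2) D by (simp add: s1_def add_nonneg_pos)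
  moreover have "h (\<gamma> s) \<noteq> 0" if s: "0 < s" "s < s1" for s
  proof
    assume "h (\<gamma> s) = 0"
    note g = \<gamma>(2)[of s]
    have s2: "s < s0" "s < 1 / (2 * norm w + 1)" "s < \<bar>Q w\<bar> / D" using s by (auto simp: s1_def)
    have "s * (2 * norm w + 1) < 1" using s2(2) by (simp add: pos_less_divide_eq add_nonneg_pos)
    then have "2 * s * norm w \<le> 1" using s(1) by (simp add: algebra_simps)
    then have n1: "norm (\<gamma> s - c) \<le> 1" using g s s2 by linarith
    have "\<kappa> (\<gamma> s) = 0" using equations_vanish[OF h(1)] g s s2 by blast
    then have "r (\<gamma> s) = - (s ^ k * Q w)"
      using \<open>h (\<gamma> s) = 0\<close> g s s2 homogeneous_scale[OF Q(1)] by (simp add: h(3))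
    then have "s ^ k * \<bar>Q w\<bar> = \<bar>r (\<gamma> s)\<bar>" using s by (simp add: abs_mult)
    also have "\<dots> \<le> C * norm (\<gamma> s - c) ^ Suc k" by (rule C(2)[OF n1])
    also have "\<dots> \<le> C * (2 * s * norm w) ^ Suc k"
      using g s s2 C(1) by (intro mult_left_mono power_mono) auto
    also have "\<dots> = s ^ k * (s * (C * (2 * norm w) ^ Suc k))" by (simp add: power_mult_distrib mult_ac)
    also have "\<dots> \<le> s ^ k * (s * D)" using s by (intro mult_left_mono) (auto simp: D_def)
    finally have "\<bar>Q w\<bar> \<le> s * D" using s by simp
    moreover have "s * D < \<bar>Q w\<bar>" using s2(3) D by (simp add: pos_less_divide_eq)
    ultimately show False by simp
  qed
  ultimately show ?thesis unfolding eventually_at_right_field by blast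
qed

lemma curve_tends_to_germ:
  assumes "s0 > 0" "\<And>s. 0 < s \<Longrightarrow> s < s0 \<Longrightarrow> \<gamma> s \<in> zeros \<and> norm (\<gamma> s - c) \<le> 2 * s * norm w"
  shows "filterlim \<gamma> germ (at_right 0)"
proof -
  have ev: "\<forall>\<^sub>F s in at_right 0. \<gamma> s \<in> zeros \<and> norm (\<gamma> s - c) \<le> 2 * s * norm w"
    unfolding eventually_at_right_field using assms by blast
  have "((\<lambda>s. \<gamma> s - c) \<longlongrightarrow> 0) (at_right 0)"
  proof (rule Lim_null_comparison)
    show "\<forall>\<^sub>F s in at_right 0. norm (\<gamma> s - c) \<le> 2 * s * norm w" using ev by eventually_elim simp
    show "((\<lambda>s. 2 * s * norm w) \<longlongrightarrow> 0) (at_right 0)" by (rule tendsto_eq_intros refl | simp)+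
  qed
  then have "(\<gamma> \<longlongrightarrow> c) (at_right 0)" by (rule LIM_zero_cancel)
  then show ?thesis unfolding germ_def filterlim_inf filterlim_principal
    using ev by (auto elim: eventually_mono)
qed

text \<open>If the process of splitting off initial forms never stops, \<open>h\<close> lies in all powers of the maximal ideal
modulo the equations, and Krull's theorem applies.\<close>

lemma vanishing_germ_or_initial_form:
  assumes "h \<in> polys"
  shows "(\<exists>u\<in>polys. u c \<noteq> 0 \<and> u * h \<in> equations) \<or>
    (\<exists>k Q \<kappa> r. Q \<in> homogeneous k \<and> (\<exists>v. Q (proj v) \<noteq> 0) \<and> \<kappa> \<in> equations \<and>
       r \<in> vanishing_order c (Suc k) \<and> h = \<kappa> + (\<lambda>y. Q (proj (y - c))) + r)"
proof (cases "\<forall>N. \<exists>\<kappa>\<in>equations. h - \<kappa> \<in> vanishing_order c N")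
  case True
  have "p ` B \<subseteq> polys" using poly by auto
  then show ?thesis using krull_intersection_at_point[of "p ` B" h c] assms True
    unfolding equations_def by blast
next
  case False
  then obtain N where N: "\<not> (\<exists>\<kappa>\<in>equations. h - \<kappa> \<in> vanishing_order c N)" by blast
  define flat where "flat N \<longleftrightarrow> (\<exists>\<kappa>\<in>equations. h - \<kappa> \<in> vanishing_order c N)" for N
  have "flat 0" unfolding flat_def using assms equations_zero by (intro bexI[of _ 0]) auto
  then have "\<exists>k. flat k \<and> \<not> flat (Suc k)" using N nat_induct[of flat N] unfolding flat_def by blast
  then obtain k where k: "flat k" "\<not> flat (Suc k)" by blast
  then obtain \<kappa> where \<kappa>: "\<kappa> \<in> equations" "h - \<kappa> \<in> vanishing_order c k" unfolding flat_def by blast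
  from initial_form[OF \<kappa>(2)] obtain Q \<kappa>' r where Q: "Q \<in> homogeneous k" "\<kappa>' \<in> equations"
    "r \<in> vanishing_order c (Suc k)" "h - \<kappa> = \<kappa>' + (\<lambda>y. Q (proj (y - c))) + r" by blast
  have eq: "h = (\<kappa> + \<kappa>') + (\<lambda>y. Q (proj (y - c))) + r"
  proof -
    have "h = \<kappa> + (h - \<kappa>)" by simp
    then show ?thesis unfolding Q(4) by (simp only: add.assoc)
  qed
  have "\<exists>v. Q (proj v) \<noteq> 0"
  proof (rule ccontr)
    assume "\<not> ?thesis"
    then have "(\<lambda>y. Q (proj (y - c))) = 0" by auto
    then have "h - (\<kappa> + \<kappa>') = r" using eq by simp
    then have "flat (Suc k)" unfolding flat_def using Q(3) equations_add[OF \<kappa>(1) Q(2)] by metis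
    with k(2) show False by simp
  qed
  with eq Q(1,3) equations_add[OF \<kappa>(1) Q(2)] show ?thesis by metis
qed

lemma vanishing_germ_imp:
  assumes "u \<in> polys" "u c \<noteq> 0" "u * h \<in> equations"
  shows "\<forall>\<^sub>F y in germ. h y = 0"
proof -
  have "isCont u c" using continuous_on_real_polynomial[of u UNIV] assms(1) by (simp add: continuous_on_eq_continuous_at)
  then have "\<forall>\<^sub>F y in nhds c. u y \<noteq> 0"
    using assms(2) by (simp add: continuous_at_imp_continuous_at_within isCont_def tendsto_imp_eventually_ne eventually_nhds_conv_at)
  then have "\<forall>\<^sub>F y in nhds c. y \<in> zeros \<longrightarrow> h y = 0"
  proof eventually_elim
    case (elim y)
    then show ?case using equations_vanish[OF assms(3), of y] by auto
  qed
  then show ?thesis unfolding germ_def eventually_inf_principal .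
qed

text \<open>A tangent direction in which both initial forms are nonzero gives a curve along which both functions
are nonzero.\<close>

lemma not_both_vanish:
  assumes Q1: "Q1 \<in> homogeneous k1" "Q1 (proj v1) \<noteq> 0" "\<kappa>1 \<in> equations" "r1 \<in> vanishing_order c (Suc k1)"
      "h1 = \<kappa>1 + (\<lambda>y. Q1 (proj (y - c))) + r1"
    and Q2: "Q2 \<in> homogeneous k2" "Q2 (proj v2) \<noteq> 0" "\<kappa>2 \<in> equations" "r2 \<in> vanishing_order c (Suc k2)"
      "h2 = \<kappa>2 + (\<lambda>y. Q2 (proj (y - c))) + r2"
  shows "\<not> (\<forall>\<^sub>F y in germ. h1 y * h2 y = 0)"
proof
  assume ev: "\<forall>\<^sub>F y in germ. h1 y * h2 y = 0"
  have "(\<lambda>y. Q (proj (y - c))) \<in> polys" if "Q \<in> homogeneous k" for Q k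
    using poly_proj homogeneous_polys that by blast
  then have "\<exists>z. Q1 (proj (z - c)) \<noteq> 0 \<and> Q2 (proj (z - c)) \<noteq> 0"
    using Q1 Q2 by (intro real_polynomial_common_nonzero[of "\<lambda>y. Q1 (proj (y - c))" "v1 + c" "\<lambda>y. Q2 (proj (y - c))" "v2 + c"]) auto
  then obtain z where z: "Q1 (proj (z - c)) \<noteq> 0" "Q2 (proj (z - c)) \<noteq> 0" by blast
  define w where "w = proj (z - c)"
  have "b \<bullet> w = 0" if "b \<in> B" for b unfolding w_def using that by (rule proj_orthogonal)
  then obtain \<gamma> s0 where \<gamma>: "s0 > 0" "\<And>s. 0 < s \<Longrightarrow> s < s0 \<Longrightarrow>
     \<gamma> s \<in> zeros \<and> proj (\<gamma> s - c) = s *\<^sub>R w \<and> norm (\<gamma> s - c) \<le> 2 * s * norm w"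
    using curve_in_zeros[of w] by blast
  have 1: "\<forall>\<^sub>F s in at_right 0. h1 (\<gamma> s) \<noteq> 0"
    by (rule nonzero_along_curve[OF \<gamma> Q1(1) _ Q1(3-5)]) (use z w_def in auto)
  have 2: "\<forall>\<^sub>F s in at_right 0. h2 (\<gamma> s) \<noteq> 0"
    by (rule nonzero_along_curve[OF \<gamma> Q2(1) _ Q2(3-5)]) (use z w_def in auto)
  have "filterlim \<gamma> germ (at_right 0)" by (rule curve_tends_to_germ[OF \<gamma>(1)]) (use \<gamma>(2) in blast)
  then have "\<forall>\<^sub>F s in at_right 0. h1 (\<gamma> s) * h2 (\<gamma> s) = 0"
    using ev unfolding filterlim_iff by blast
  with 1 2 have "\<forall>\<^sub>F s in at_right (0::real). False" by eventually_elim auto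
  then show False by simp
qed

text \<open>The analytic germ of the zero set and its algebraic local ring define the same ideal.\<close>

lemma germ_vanishing_iff:
  assumes "h \<in> polys"
  shows "(\<forall>\<^sub>F y in germ. h y = 0) \<longleftrightarrow> (\<exists>u\<in>polys. u c \<noteq> 0 \<and> u * h \<in> equations)"
proof
  assume ev: "\<forall>\<^sub>F y in germ. h y = 0"
  show "\<exists>u\<in>polys. u c \<noteq> 0 \<and> u * h \<in> equations"
  proof (rule ccontr)
    assume "\<not> ?thesis"
    with vanishing_germ_or_initial_form[OF assms] obtain k Q \<kappa> r v where Q: "Q \<in> homogeneous k" "Q (proj v) \<noteq> 0"
      "\<kappa> \<in> equations" "r \<in> vanishing_order c (Suc k)" "h = \<kappa> + (\<lambda>y. Q (proj (y - c))) + r" by blast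
    from not_both_vanish[OF Q Q] ev show False by simp
  qed
qed (blast intro: vanishing_germ_imp)

lemma prime_filter_germ: "prime_filter germ"
  unfolding prime_filter_def
proof (intro allI impI)
  fix f g :: "real^'n \<Rightarrow> real" assume f: "real_polynomial_function f" and g: "real_polynomial_function g"
    and ev: "\<forall>\<^sub>F x in germ. f x * g x = 0"
  show "(\<forall>\<^sub>F x in germ. f x = 0) \<or> (\<forall>\<^sub>F x in germ. g x = 0)"
  proof (rule ccontr)
    assume "\<not> ?thesis"
    then have nf: "\<not> (\<exists>u\<in>polys. u c \<noteq> 0 \<and> u * f \<in> equations)" and ng: "\<not> (\<exists>u\<in>polys. u c \<noteq> 0 \<and> u * g \<in> equations)"
      using germ_vanishing_iff f g by auto
    have f': "f \<in> polys" and g': "g \<in> polys" using f g by auto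
    obtain k Q \<kappa> r v where Q: "Q \<in> homogeneous k" "Q (proj v) \<noteq> 0"
      "\<kappa> \<in> equations" "r \<in> vanishing_order c (Suc k)" "f = \<kappa> + (\<lambda>y. Q (proj (y - c))) + r"
      using vanishing_germ_or_initial_form[OF f'] nf by blast
    obtain k' Q' \<kappa>' r' v' where Q': "Q' \<in> homogeneous k'" "Q' (proj v') \<noteq> 0"
      "\<kappa>' \<in> equations" "r' \<in> vanishing_order c (Suc k')" "g = \<kappa>' + (\<lambda>y. Q' (proj (y - c))) + r'"
      using vanishing_germ_or_initial_form[OF g'] ng by blast
    from not_both_vanish[OF Q Q'] ev show False by simp
  qed
qed

definition grad :: "real^'n \<Rightarrow> real^'n \<Rightarrow> real^'n" where
  "grad b y = (\<chi> j. frechet_derivative (p b) (at y) (axis j 1))"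

lemma grad_inner: "b \<in> B \<Longrightarrow> grad b y \<bullet> v = frechet_derivative (p b) (at y) v"
  using linear_functional_coords[OF real_polynomial_linear_derivative[OF poly], of b y v]
  by (simp add: grad_def inner_vec_def mult.commute)

lemma dim_kernel_at: "dim {v. \<forall>b\<in>B. b \<bullet> v = 0} = CARD('n) - card B"
proof -
  have "independent B"
    using orthonormal by (intro pairwise_orthogonal_independent) (auto simp: pairwise_def orthogonal_def, fastforce)
  then have "dim (span B) = card B" by (simp add: dim_eq_card_independent)
  with dim_common_kernel[where g = "\<lambda>b. b" and B = B]
  show ?thesis by simp
qed

text \<open>Near \<open>c\<close> the gradients stay within \<open>\<epsilon>\<close> of an orthonormal family, so the projection onto the
tangent space at \<open>c\<close> is injective on their common kernel. This bounds its dimension from above; the number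
of equations bounds it from below.\<close>

lemma dim_kernel_near:
  "\<forall>\<^sub>F y in nhds c. dim {v. \<forall>b\<in>B. frechet_derivative (p b) (at y) v = 0} = CARD('n) - card B"
proof -
  \<comment> \<open>The estimate needs \<open>card B * \<epsilon>\<^sup>2 < 1\<close>.\<close>
  define \<epsilon> where "\<epsilon> = 1 / (real (card B) + 1)"
  have \<epsilon>: "\<epsilon> > 0" by (simp add: \<epsilon>_def add_nonneg_pos)
  have gc: "grad b c = b" if "b \<in> B" for b
    by (simp add: vec_eq_iff grad_def gradient[OF that] inner_axis)
  have "\<forall>\<^sub>F y in nhds c. \<forall>b\<in>B. dist (grad b y) b < \<epsilon>"
  proof (rule eventually_ball_finite[OF fin], rule ballI)
    fix b assume b: "b \<in> B"
    have "isCont (grad b) c"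
      using continuous_on_real_polynomial[OF real_polynomial_derivative_poly[OF poly[OF b]], of UNIV]
      unfolding grad_def[abs_def] by (simp add: continuous_on_eq_continuous_at isCont_def tendsto_vec_lambda)
    then have "(grad b \<longlongrightarrow> b) (nhds c)" using gc[OF b] by (simp add: isCont_def tendsto_nhds_iff)
    then show "\<forall>\<^sub>F y in nhds c. dist (grad b y) b < \<epsilon>" using \<epsilon> by (rule tendstoD)
  qed
  then show ?thesis
  proof eventually_elim
    case (elim y)
    define W where "W = {v. \<forall>b\<in>B. grad b y \<bullet> v = 0}"
    have W: "{v. \<forall>b\<in>B. frechet_derivative (p b) (at y) v = 0} = W" by (auto simp: W_def grad_inner)
    have subW: "subspace W" unfolding W_def subspace_def by (simp add: inner_add_right)
    have "dim (span ((\<lambda>b. grad b y) ` B)) \<le> card B"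
      using dim_le_card'[of "(\<lambda>b. grad b y) ` B"] card_image_le[OF fin, of "\<lambda>b. grad b y"] fin by simp
    then have lower: "dim W \<ge> CARD('n) - card B"
      using dim_common_kernel[where g = "\<lambda>b. grad b y" and B = B] unfolding W_def by simp
    have "v = 0" if v: "v \<in> W" "proj v = 0" for v
    proof -
      have "v = (\<Sum>b\<in>B. (b \<bullet> v) *\<^sub>R b)" using v(2) by (simp add: proj_def)
      then have "v \<bullet> v = (\<Sum>b\<in>B. (b \<bullet> v) * (b \<bullet> v))"
        by (metis (mono_tags, lifting) inner_sum_left inner_scaleR_left sum.cong)
      also have "\<dots> \<le> (\<Sum>b\<in>B. (\<epsilon> * norm v) * (\<epsilon> * norm v))"
      proof (rule sum_mono)
        fix b assume b: "b \<in> B"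
        have "b \<bullet> v = (b - grad b y) \<bullet> v" using v(1) b by (simp add: W_def inner_diff_left)
        also have "\<bar>\<dots>\<bar> \<le> norm (b - grad b y) * norm v" by (rule Cauchy_Schwarz_ineq2)
        also have "\<dots> \<le> \<epsilon> * norm v"
          using elim b by (intro mult_right_mono) (auto simp: dist_norm norm_minus_commute less_imp_le)
        finally have le: "\<bar>b \<bullet> v\<bar> \<le> \<epsilon> * norm v" .
        have "(b \<bullet> v) * (b \<bullet> v) = \<bar>b \<bullet> v\<bar> * \<bar>b \<bullet> v\<bar>" by simp
        also have "\<dots> \<le> (\<epsilon> * norm v) * (\<epsilon> * norm v)" using le \<epsilon> by (intro mult_mono) auto
        finally show "(b \<bullet> v) * (b \<bullet> v) \<le> (\<epsilon> * norm v) * (\<epsilon> * norm v)" .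
      qed
      also have "\<dots> = (real (card B) * \<epsilon>) * \<epsilon> * (v \<bullet> v)" by (simp add: dot_square_norm power2_eq_square)
      finally have le: "v \<bullet> v \<le> (real (card B) * \<epsilon>) * \<epsilon> * (v \<bullet> v)" .
      have "real (card B) * \<epsilon> < 1" "\<epsilon> \<le> 1" by (simp_all add: \<epsilon>_def divide_simps)
      then have "(real (card B) * \<epsilon>) * \<epsilon> < 1" using \<epsilon>
        by (metis less_eq_real_def mult.right_neutral mult_le_cancel_left_pos mult_strict_right_mono mult_1 order_less_le_trans)
      then have "\<not> v \<bullet> v > 0" using le by (metis mult_less_cancel_right2 not_le order_less_imp_le)
      then show "v = 0" by simp
    qed
    then have "inj_on proj W"
      using linear_inj_on_iff_eq_0[OF linear_proj subW] by blast
    then have "dim (proj ` W) = dim W"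
      by (intro dim_image_eq[OF linear_proj]) (simp only: span_eq_iff[THEN iffD2, OF subW])
    then have "dim W = dim (proj ` W)" by simp
    also have "\<dots> \<le> dim {v. \<forall>b\<in>B. b \<bullet> v = 0}" by (rule dim_subset) (auto simp: proj_orthogonal)
    finally show ?case using lower dim_kernel_at W by simp
  qed
qed

end

section \<open>Nonsingular points\<close>

definition monomial_sum :: "nat \<Rightarrow> ((nat \<Rightarrow> real) \<Rightarrow> real) \<Rightarrow> bool" where
  "monomial_sum d h \<longleftrightarrow> (\<exists>A c. finite A \<and> A \<subseteq> ({..<d} \<rightarrow>\<^sub>E (UNIV :: nat set)) \<and>
     (\<forall>z. h z = (\<Sum>\<alpha>\<in>A. c \<alpha> * (\<Prod>i<d. z i ^ \<alpha> i))))"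

lemma monomial_sum_add_monomial:
  assumes "monomial_sum d h" "\<beta> \<in> {..<d} \<rightarrow>\<^sub>E UNIV"
  shows "monomial_sum d (\<lambda>z. k * (\<Prod>i<d. z i ^ \<beta> i) + h z)"
proof -
  obtain A c where A: "finite A" "A \<subseteq> ({..<d} \<rightarrow>\<^sub>E (UNIV :: nat set))"
    "\<And>z. h z = (\<Sum>\<alpha>\<in>A. c \<alpha> * (\<Prod>i<d. z i ^ \<alpha> i))" using assms(1) unfolding monomial_sum_def by blast
  define c' where "c' \<alpha> = (if \<alpha> \<in> A then c \<alpha> else 0) + (if \<alpha> = \<beta> then k else 0)" for \<alpha>
  have "k * (\<Prod>i<d. z i ^ \<beta> i) + h z = (\<Sum>\<alpha>\<in>insert \<beta> A. c' \<alpha> * (\<Prod>i<d. z i ^ \<alpha> i))" for z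
  proof -
    have "(\<Sum>\<alpha>\<in>insert \<beta> A. c' \<alpha> * (\<Prod>i<d. z i ^ \<alpha> i)) =
      (\<Sum>\<alpha>\<in>insert \<beta> A. (if \<alpha> \<in> A then c \<alpha> else 0) * (\<Prod>i<d. z i ^ \<alpha> i)) +
      (\<Sum>\<alpha>\<in>insert \<beta> A. if \<alpha> = \<beta> then k * (\<Prod>i<d. z i ^ \<alpha> i) else 0)"
      unfolding c'_def distrib_right sum.distrib by (intro arg_cong2[where f = "(+)"] sum.cong) auto
    also have "(\<Sum>\<alpha>\<in>insert \<beta> A. (if \<alpha> \<in> A then c \<alpha> else 0) * (\<Prod>i<d. z i ^ \<alpha> i)) = h z"
      unfolding A(3) using A(1) by (intro sum.mono_neutral_cong_right) auto
    also have "(\<Sum>\<alpha>\<in>insert \<beta> A. if \<alpha> = \<beta> then k * (\<Prod>i<d. z i ^ \<alpha> i) else 0) = k * (\<Prod>i<d. z i ^ \<beta> i)"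
      using A(1) by (subst sum.delta) auto
    finally show ?thesis by simp
  qed
  then show ?thesis unfolding monomial_sum_def using A(1,2) assms(2)
    by (intro exI[of _ "insert \<beta> A"] exI[of _ c']) auto
qed

lemma restrict_lessThan_PiE: "restrict f {..<d} \<in> {..<d} \<rightarrow>\<^sub>E UNIV"
  by (simp add: restrict_PiE_iff)

lemma monomial_sum_zero: "monomial_sum d (\<lambda>_. 0)"
  unfolding monomial_sum_def by (intro exI[of _ "{}"]) auto

lemma monomial_sum_many:
  assumes "finite K" "\<And>k. k \<in> K \<Longrightarrow> \<beta> k \<in> {..<d} \<rightarrow>\<^sub>E UNIV" "monomial_sum d h"
  shows "monomial_sum d (\<lambda>z. (\<Sum>k\<in>K. e k * (\<Prod>i<d. z i ^ \<beta> k i)) + h z)"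
  using assms(1,2)
proof (induction K)
  case empty then show ?case using assms(3) by simp
next
  case (insert k K)
  then have "monomial_sum d (\<lambda>z. e k * (\<Prod>i<d. z i ^ \<beta> k i) + ((\<Sum>k\<in>K. e k * (\<Prod>i<d. z i ^ \<beta> k i)) + h z))"
    by (intro monomial_sum_add_monomial) auto
  then show ?case using insert by (simp add: add.assoc)
qed

text \<open>This links the recursive description of polynomials to the sums over exponent vectors by which
algebraic independence is defined.\<close>

lemma coord_polys_monomial_sum:
  assumes "h \<in> coord_polys d"
  shows "monomial_sum d h"
  using assms
proof (induction rule: polys_in_induct)
  case (const c)
  have "monomial_sum d (\<lambda>z. c * (\<Prod>i<d. z i ^ restrict (\<lambda>_. 0) {..<d} i) + 0)"
    by (intro monomial_sum_add_monomial monomial_sum_zero restrict_lessThan_PiE)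
  then show ?case by simp
next
  case (var j)
  have "monomial_sum d (\<lambda>z. 1 * (\<Prod>i<d. z i ^ restrict (\<lambda>i. if i = j then 1 else 0) {..<d} i) + 0)"
    by (intro monomial_sum_add_monomial monomial_sum_zero restrict_lessThan_PiE)
  also have "(\<lambda>z. 1 * (\<Prod>i<d. z i ^ restrict (\<lambda>i. if i = j then 1 else 0) {..<d} i) + 0) = (\<lambda>z::nat \<Rightarrow> real. z j)"
  proof
    fix z :: "nat \<Rightarrow> real"
    have "(\<Prod>i<d. z i ^ restrict (\<lambda>i. if i = j then 1 else 0) {..<d} i) = (\<Prod>i<d. if i = j then z i else 1)"
      by (intro prod.cong) auto
    then show "1 * (\<Prod>i<d. z i ^ restrict (\<lambda>i. if i = j then 1 else 0) {..<d} i) + 0 = z j"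
      using var by simp
  qed
  finally show ?case .
next
  case (add p q)
  obtain A c where A: "finite A" "A \<subseteq> ({..<d} \<rightarrow>\<^sub>E (UNIV :: nat set))"
    "\<And>z. p z = (\<Sum>\<alpha>\<in>A. c \<alpha> * (\<Prod>i<d. z i ^ \<alpha> i))" using add(1) unfolding monomial_sum_def by blast
  have "monomial_sum d (\<lambda>z. (\<Sum>\<alpha>\<in>A. c \<alpha> * (\<Prod>i<d. z i ^ \<alpha> i)) + q z)"
    using A by (intro monomial_sum_many add(2)) auto
  then show ?case by (simp add: A(3))
next
  case (mult p q)
  obtain A c where A: "finite A" "A \<subseteq> ({..<d} \<rightarrow>\<^sub>E (UNIV :: nat set))"
    "\<And>z. p z = (\<Sum>\<alpha>\<in>A. c \<alpha> * (\<Prod>i<d. z i ^ \<alpha> i))" using mult(1) unfolding monomial_sum_def by blast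
  obtain A' c' where A': "finite A'" "A' \<subseteq> ({..<d} \<rightarrow>\<^sub>E (UNIV :: nat set))"
    "\<And>z. q z = (\<Sum>\<alpha>\<in>A'. c' \<alpha> * (\<Prod>i<d. z i ^ \<alpha> i))" using mult(2) unfolding monomial_sum_def by blast
  let ?\<beta> = "\<lambda>(\<alpha>, \<alpha>'). restrict (\<lambda>i. \<alpha> i + \<alpha>' i) {..<d}"
  have "monomial_sum d (\<lambda>z. (\<Sum>k\<in>A \<times> A'. (c (fst k) * c' (snd k)) * (\<Prod>i<d. z i ^ ?\<beta> k i)) + 0)"
  proof (rule monomial_sum_many[OF _ _ monomial_sum_zero])
    show "?\<beta> k \<in> {..<d} \<rightarrow>\<^sub>E UNIV" for k :: "(nat \<Rightarrow> nat) \<times> (nat \<Rightarrow> nat)"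
      unfolding split_def by (rule restrict_lessThan_PiE)
  qed (use A A' in simp)
  also have "(\<lambda>z. (\<Sum>k\<in>A \<times> A'. (c (fst k) * c' (snd k)) * (\<Prod>i<d. z i ^ ?\<beta> k i)) + 0) = (\<lambda>z. p z * q z)"
  proof
    fix z :: "nat \<Rightarrow> real"
    have "(\<Prod>i<d. z i ^ ?\<beta> (\<alpha>, \<alpha>') i) = (\<Prod>i<d. z i ^ \<alpha> i) * (\<Prod>i<d. z i ^ \<alpha>' i)" for \<alpha> \<alpha>'
      by (simp add: prod.distrib[symmetric] power_add)
    then show "(\<Sum>k\<in>A \<times> A'. (c (fst k) * c' (snd k)) * (\<Prod>i<d. z i ^ ?\<beta> k i)) + 0 = p z * q z"
      unfolding A(3) A'(3) sum_product sum.cartesian_product by (auto intro!: sum.cong)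
  qed
  finally show ?case .
qed

lemma independent_no_relation:
  assumes "algebraically_independent_on U d f" "h \<in> coord_polys d" "\<And>x. x \<in> U \<Longrightarrow> h (\<lambda>i. f i x) = 0"
  shows "h = 0"
proof -
  obtain A c where A: "finite A" "A \<subseteq> ({..<d} \<rightarrow>\<^sub>E (UNIV :: nat set))"
    "\<And>z. h z = (\<Sum>\<alpha>\<in>A. c \<alpha> * (\<Prod>i<d. z i ^ \<alpha> i))"
    using coord_polys_monomial_sum[OF assms(2)] unfolding monomial_sum_def by blast
  have "\<forall>x\<in>U. (\<Sum>\<alpha>\<in>A. c \<alpha> * (\<Prod>i<d. f i x ^ \<alpha> i)) = 0" using assms(3) A(3) by simp
  then have "\<forall>\<alpha>\<in>A. c \<alpha> = 0" using assms(1) A(1,2) unfolding algebraically_independent_on_def by blast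
  then show ?thesis by (auto simp: fun_eq_iff A(3))
qed

lemma common_denominator:
  fixes d :: nat
  assumes "\<forall>i<d. regular_on U (f i)"
  shows "\<exists>b a. real_polynomial_function b \<and> (\<forall>i<d. real_polynomial_function (a i)) \<and>
    (\<forall>x\<in>U. b x \<noteq> 0 \<and> (\<forall>i<d. f i x = a i x / b x))"
proof -
  have "\<forall>i. \<exists>p q. i < d \<longrightarrow> real_polynomial_function p \<and> real_polynomial_function q \<and>
        (\<forall>x\<in>U. q x \<noteq> 0 \<and> f i x = p x / q x)" using assms unfolding regular_on_def by blast
  then obtain p q where pq: "\<And>i. i < d \<Longrightarrow> real_polynomial_function (p i) \<and> real_polynomial_function (q i) \<and>
        (\<forall>x\<in>U. q i x \<noteq> 0 \<and> f i x = p i x / q i x)" by metis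
  define b where "b x = (\<Prod>i<d. q i x)" for x
  define a where "a i x = p i x * (\<Prod>j\<in>{..<d} - {i}. q j x)" for i x
  have bq: "b x = q i x * (\<Prod>j\<in>{..<d} - {i}. q j x)" if "i < d" for i x
    unfolding b_def using that by (subst prod.remove[of "{..<d}" i]) auto
  show ?thesis
  proof (intro exI[of _ b] exI[of _ a] conjI allI impI ballI)
    show "real_polynomial_function b" unfolding b_def[abs_def] using pq by (intro real_polynomial_function_prod) auto
    show "real_polynomial_function (a i)" if "i < d" for i
      unfolding a_def[abs_def] using pq that
      by (intro real_polynomial_function.intros(4) real_polynomial_function_prod) auto
    fix x assume x: "x \<in> U"
    show bx: "b x \<noteq> 0" unfolding b_def using pq x by simp
    fix i assume i: "i < d"
    have "f i x = p i x / q i x" using pq i x by blast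
    also have "\<dots> = a i x / b x" using bx unfolding bq[OF i] a_def by auto
    finally show "f i x = a i x / b x" .
  qed
qed

lemma prime_filter_principal:
  "irreducible_algebraic V \<Longrightarrow> prime_filter (principal V)"
  unfolding prime_filter_def eventually_principal using irreducible_prime by blast

text \<open>The number of independent rational functions on \<open>V\<close> is at most the number of ambient coordinates,
by \<open>independent_functions_le_tangent_dim\<close> with no equations, so the maximum that defines the dimension is
attained.\<close>

lemma algebraic_dim_witness:
  fixes V :: "(real^'n) set"
  assumes V: "irreducible_algebraic V"
  shows "\<exists>U b a. U \<subseteq> V \<and> U \<noteq> {} \<and> real_polynomial_function b \<and> (\<forall>i<algebraic_dim V. real_polynomial_function (a i)) \<and>
    (\<forall>x\<in>U. b x \<noteq> 0) \<and>
    (\<forall>h\<in>coord_polys (algebraic_dim V). (\<forall>x\<in>U. h (\<lambda>i. a i x / b x) = 0) \<longrightarrow> h = 0)"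
proof -
  define wit where "wit d \<longleftrightarrow> (\<exists>U f. zariski_dense_open U V \<and>
     (\<forall>i<d. regular_on U (f i)) \<and> algebraically_independent_on U d f)" for d
  have Une: "U \<subseteq> V \<and> U \<noteq> {}" if "zariski_dense_open U V" for U
  proof -
    have "V \<noteq> {}" using V by (simp add: irreducible_algebraic_def)
    moreover have "U \<subseteq> V" using zariski_dense_openD(1)[OF that] by blast
    ultimately show ?thesis using zariski_dense_openD(2)[OF that _ real_algebraic_empty] by blast
  qed
  have unpack: "\<exists>U b a. U \<subseteq> V \<and> U \<noteq> {} \<and> real_polynomial_function b \<and> (\<forall>i<d. real_polynomial_function (a i)) \<and>
    (\<forall>x\<in>U. b x \<noteq> 0) \<and> (\<forall>h\<in>coord_polys d. (\<forall>x\<in>U. h (\<lambda>i. a i x / b x) = 0) \<longrightarrow> h = 0)" if wit: "wit d" for d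
  proof -
    obtain U f where Uf: "zariski_dense_open U V" "\<forall>i<d. regular_on U (f i)" "algebraically_independent_on U d f"
      using wit unfolding wit_def by blast
    obtain b a where ba: "real_polynomial_function b" "\<forall>i<d. real_polynomial_function (a i)"
      "\<forall>x\<in>U. b x \<noteq> 0 \<and> (\<forall>i<d. f i x = a i x / b x)" using common_denominator[OF Uf(2)] by blast
    have "h = 0" if h: "h \<in> coord_polys d" "\<forall>x\<in>U. h (\<lambda>i. a i x / b x) = 0" for h
    proof (rule independent_no_relation[OF Uf(3) h(1)])
      fix x assume "x \<in> U"
      then have "h (\<lambda>i. f i x) = h (\<lambda>i. a i x / b x)" using ba(3) by (intro coord_polys_local[OF h(1)]) auto
      then show "h (\<lambda>i. f i x) = 0" using h(2) \<open>x \<in> U\<close> by simp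
    qed
    then show ?thesis using Une[OF Uf(1)] ba by blast
  qed
  have "wit 0"
  proof -
    have "algebraically_independent_on V 0 (\<lambda>_ _. 0)"
      unfolding algebraically_independent_on_def
    proof (intro allI impI ballI)
      fix A and c :: "(nat \<Rightarrow> nat) \<Rightarrow> real" and \<alpha>
      assume A: "finite A \<and> A \<subseteq> ({..<0} \<rightarrow>\<^sub>E (UNIV :: nat set)) \<and>
        (\<forall>x\<in>V. (\<Sum>\<alpha>\<in>A. c \<alpha> * (\<Prod>i<0. (0::real) ^ \<alpha> i)) = 0)" and \<alpha>: "\<alpha> \<in> A"
      have "A = {\<alpha>}" using A \<alpha> by (auto simp: PiE_empty_domain)
      moreover obtain x where "x \<in> V" using V by (auto simp: irreducible_algebraic_def)
      ultimately show "c \<alpha> = 0" using A by auto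
    qed
    then show ?thesis unfolding wit_def using zariski_dense_open_self by blast
  qed
  moreover have "d \<le> CARD('n)" if wd: "wit d" for d
  proof -
    obtain U b a where *: "U \<subseteq> V" "U \<noteq> {}" "real_polynomial_function b" "\<forall>i<d. real_polynomial_function (a i)"
    "\<forall>x\<in>U. b x \<noteq> 0" "\<forall>h\<in>coord_polys d. (\<forall>x\<in>U. h (\<lambda>i. a i x / b x) = 0) \<longrightarrow> h = 0" using unpack[OF wd] by blast
    show ?thesis
    proof (rule independent_functions_le_tangent_dim[OF prime_filter_principal[OF V] *(3), where P = "{}" and a = a])
      show "\<not> (\<forall>\<^sub>F x in principal V. b x = 0)" using * by (auto simp: eventually_principal)
      fix h assume "h \<in> coord_polys d" "\<forall>\<^sub>F x in principal V. b x \<noteq> 0 \<longrightarrow> h (\<lambda>i. a i x / b x) = 0"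
      then have "\<forall>x\<in>U. h (\<lambda>i. a i x / b x) = 0" using *(1,5) unfolding eventually_principal by blast
      then show "h = 0" using *(6) \<open>h \<in> coord_polys d\<close> by blast
    qed (use *(4) in \<open>auto simp: dim_UNIV\<close>)
  qed
  ultimately have "wit (algebraic_dim V)"
    unfolding algebraic_dim_def wit_def[symmetric] by (intro GreatestI_nat[of wit 0]) auto
  then show ?thesis by (rule unpack)
qed

lemma deriv_generated_ideal:
  assumes "h \<in> generated_ideal polys A" "A \<subseteq> polys"
    "\<And>a. a \<in> A \<Longrightarrow> a y = 0 \<and> frechet_derivative a (at y) v = 0"
  shows "h y = 0 \<and> frechet_derivative h (at y) v = 0"
  using assms(1)
proof induction
  case zero
  show ?case by (simp add: zero_fun_def frechet_derivative_const)
next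
  case (step a s u)
  have rp: "real_polynomial_function a" "real_polynomial_function s" "real_polynomial_function u"
    using step assms(2) generated_ideal_subset_ring[OF subring_polys assms(2)] by auto
  have "frechet_derivative (\<lambda>x. s x * a x + u x) (at y) =
    (\<lambda>v. (s y * frechet_derivative a (at y) v + frechet_derivative s (at y) v * a y) + frechet_derivative u (at y) v)"
    using frechet_derivative_at[OF has_derivative_add[OF has_derivative_mult[OF real_polynomial_has_derivative[OF rp(2)] real_polynomial_has_derivative[OF rp(1)]]
       real_polynomial_has_derivative[OF rp(3)]]] by metis
  then show ?case using step.IH assms(3)[OF step(1)] by (simp add: plus_fun_def times_fun_def)
qed

lemma deriv_cancel:
  assumes "real_polynomial_function u" "real_polynomial_function g" "u y \<noteq> 0" "(u * g) y = 0"
    "frechet_derivative (u * g) (at y) v = 0"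
  shows "g y = 0 \<and> frechet_derivative g (at y) v = 0"
proof -
  have "frechet_derivative (\<lambda>x. u x * g x) (at y) =
    (\<lambda>v. u y * frechet_derivative g (at y) v + frechet_derivative u (at y) v * g y)"
    using frechet_derivative_at[OF has_derivative_mult[OF real_polynomial_has_derivative[OF assms(1)] real_polynomial_has_derivative[OF assms(2)]]] by metis
  then show ?thesis using assms(3-5) by (simp add: times_fun_def)
qed

text \<open>The gradients at \<open>c\<close> of the vanishing ideal form a linear subspace, so an orthonormal basis of
their span consists of gradients.\<close>

lemma vanishing_ideal_equations:
  fixes V :: "(real^'n) set"
  assumes "c \<in> V"
  shows "\<exists>B p. regular_equations c B p \<and> p ` B \<subseteq> vanishing_ideal V \<and>
     zariski_tangent_space V c = {v. \<forall>b\<in>B. b \<bullet> v = 0}"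
proof -
  let ?I = "vanishing_ideal V"
  define g where "g q = (\<chi> j. frechet_derivative q (at c) (axis j 1))" for q :: "real^'n \<Rightarrow> real"
  have g: "g q \<bullet> v = frechet_derivative q (at c) v" if "real_polynomial_function q" for q v
    using linear_functional_coords[OF real_polynomial_linear_derivative[OF that], of c v]
    by (simp add: g_def inner_vec_def mult.commute)
  have "subspace (g ` ?I)"
  proof (rule subspaceI)
    have "g (\<lambda>_. 0) = 0" by (simp add: g_def vec_eq_iff frechet_derivative_const)
    moreover have "(\<lambda>_. 0) \<in> ?I" by (simp add: vanishing_ideal_iff real_polynomial_function.intros(2))
    ultimately show "0 \<in> g ` ?I" by (metis image_eqI)
  next
    fix x y assume "x \<in> g ` ?I" "y \<in> g ` ?I"
    then obtain q r where q: "q \<in> ?I" "x = g q" and r: "r \<in> ?I" "y = g r" by blast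
    then have rp: "real_polynomial_function q" "real_polynomial_function r" by (auto simp: vanishing_ideal_iff)
    have "frechet_derivative (\<lambda>x. q x + r x) (at c) = (\<lambda>v. frechet_derivative q (at c) v + frechet_derivative r (at c) v)"
      using frechet_derivative_at[OF has_derivative_add[OF real_polynomial_has_derivative[OF rp(1)] real_polynomial_has_derivative[OF rp(2)]]] by metis
    then have "x + y = g (\<lambda>x. q x + r x)" by (simp add: q r g_def vec_eq_iff)
    moreover have "(\<lambda>x. q x + r x) \<in> ?I" using q r by (auto simp: vanishing_ideal_iff real_polynomial_function.intros(3))
    ultimately show "x + y \<in> g ` ?I" by blast
  next
    fix k x assume "x \<in> g ` ?I"
    then obtain q where q: "q \<in> ?I" "x = g q" by blast
    then have rp: "real_polynomial_function q" by (auto simp: vanishing_ideal_iff)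
    have "frechet_derivative (\<lambda>x. k * q x) (at c) = (\<lambda>v. k * frechet_derivative q (at c) v)"
      using frechet_derivative_at[OF has_derivative_mult_right[OF real_polynomial_has_derivative[OF rp]]] by metis
    then have "k *\<^sub>R x = g (\<lambda>x. k * q x)" by (simp add: q g_def vec_eq_iff)
    moreover have "(\<lambda>x. k * q x) \<in> ?I" using q by (auto simp: vanishing_ideal_iff real_polynomial_function.intros(2,4))
    ultimately show "k *\<^sub>R x \<in> g ` ?I" by blast
  qed
  then obtain B where B: "B \<subseteq> g ` ?I" "pairwise orthogonal B" "\<And>x. x \<in> B \<Longrightarrow> norm x = 1"
    "independent B" "span B = g ` ?I" using orthonormal_basis_subspace by metis
  have "\<forall>b\<in>B. \<exists>q\<in>?I. g q = b" using B(1) by blast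
  then obtain p where p: "\<And>b. b \<in> B \<Longrightarrow> p b \<in> ?I" "\<And>b. b \<in> B \<Longrightarrow> g (p b) = b" by metis
  have poly: "real_polynomial_function (p b)" if "b \<in> B" for b using p(1)[OF that] by (simp add: vanishing_ideal_iff)
  have "regular_equations c B p"
  proof
    show "finite B" using B(4) by (rule independent_imp_finite)
    show "a \<bullet> b = (if a = b then 1 else 0)" if "a \<in> B" "b \<in> B" for a b
      using B(2,3) that by (auto simp: pairwise_def orthogonal_def norm_eq_1)
    show "p b c = 0" if "b \<in> B" for b using p(1)[OF that] assms by (simp add: vanishing_ideal_iff)
    show "frechet_derivative (p b) (at c) v = b \<bullet> v" if "b \<in> B" for b v
      using g[OF poly[OF that], of v] p(2)[OF that] by simp
  qed (rule poly)
  moreover have "zariski_tangent_space V c = {v. \<forall>b\<in>B. b \<bullet> v = 0}"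
  proof (intro equalityI subsetI)
    fix v assume v: "v \<in> zariski_tangent_space V c"
    have "b \<bullet> v = 0" if "b \<in> B" for b
      using v p(1)[OF that] g[OF poly[OF that], of v] p(2)[OF that] by (simp add: zariski_tangent_space_def)
    then show "v \<in> {v. \<forall>b\<in>B. b \<bullet> v = 0}" by blast
  next
    fix v assume v: "v \<in> {v. \<forall>b\<in>B. b \<bullet> v = 0}"
    have "frechet_derivative q (at c) v = 0" if q: "q \<in> ?I" for q
    proof -
      have "g q \<in> span B" using q B(5) by blast
      moreover have "orthogonal v b" if "b \<in> B" for b
        using v that by (simp add: orthogonal_def inner_commute[of v])
      ultimately have "orthogonal v (g q)" by (rule orthogonal_to_span)
      then have "g q \<bullet> v = 0" by (simp add: orthogonal_def inner_commute[of v])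
      then show ?thesis using g[of q v] q by (simp add: vanishing_ideal_iff)
    qed
    then show "v \<in> zariski_tangent_space V c" by (simp add: zariski_tangent_space_def)
  qed
  ultimately show ?thesis using p(1) by blast
qed

text \<open>A relation is divided by the highest power of the last variable, so that setting this variable to zero
leaves a nonzero polynomial.\<close>

lemma relation_divided_by_last:
  assumes "h \<in> coord_polys (Suc d)" "h \<noteq> 0"
  shows "\<exists>k g g0. g \<in> coord_polys (Suc d) \<and> g0 \<in> coord_polys d \<and> g0 \<noteq> 0 \<and>
    (\<forall>z. h z = z d ^ k * g z) \<and> (\<forall>z. z d = 0 \<longrightarrow> g z = g0 z)"
proof -
  obtain n c where c: "\<forall>i. c i \<in> coord_polys d" "h = (\<Sum>i<n. c i * (\<lambda>z. z d) ^ i)"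
    using assms(1) by (auto simp: adjoin_def polys_below_def)
  have "\<exists>i. i < n \<and> c i \<noteq> 0"
  proof (rule ccontr)
    assume "\<not> ?thesis"
    then have "h = 0" unfolding c(2) by (intro sum.neutral) auto
    then show False using assms(2) by simp
  qed
  define k where "k = (LEAST i. i < n \<and> c i \<noteq> 0)"
  have k: "k < n" "c k \<noteq> 0" using LeastI_ex[OF \<open>\<exists>i. i < n \<and> c i \<noteq> 0\<close>] unfolding k_def by auto
  have low: "c i = 0" if "i < k" for i
    using not_less_Least[of i "\<lambda>i. i < n \<and> c i \<noteq> 0"] that k(1) unfolding k_def by auto
  define g where "g = (\<Sum>i<n - k. c (i + k) * (\<lambda>z. z d) ^ i)"
  have "g \<in> polys_below (coord_polys d) (\<lambda>z. z d) (n - k)"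
    unfolding g_def by (rule polys_belowI[OF _ subring_polys_in]) (use c(1) in simp)
  then have g: "g \<in> coord_polys (Suc d)" unfolding polys_in.simps adjoin_def by (rule UN_I[OF UNIV_I])
  have hg: "h z = z d ^ k * g z" for z
  proof -
    have "h z = (\<Sum>i<n. c i z * z d ^ i)" by (simp add: c(2) sum_fun_apply power_fun_apply)
    also have "\<dots> = (\<Sum>i\<in>{k..<n}. c i z * z d ^ i)"
      using low by (intro sum.mono_neutral_right) auto
    also have "\<dots> = (\<Sum>i<n - k. c (i + k) z * z d ^ (i + k))"
      by (rule sum.reindex_bij_witness[of _ "\<lambda>i. i + k" "\<lambda>i. i - k"]) auto
    also have "\<dots> = z d ^ k * g z"
      by (simp add: g_def sum_fun_apply power_fun_apply sum_distrib_left power_add mult_ac)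
    finally show ?thesis .
  qed
  have g0: "g z = c k z" if "z d = 0" for z
  proof -
    have "g z = (\<Sum>i<n - k. c (i + k) z * 0 ^ i)" by (simp add: g_def sum_fun_apply power_fun_apply that)
    also have "\<dots> = (\<Sum>i<n - k. if i = 0 then c k z else 0)" by (intro sum.cong) auto
    finally show ?thesis using k(1) by simp
  qed
  show ?thesis
    by (rule exI[of _ k], rule exI[of _ g], rule exI[of _ "c k"]) (use g hg g0 c(1) k(2) in simp)
qed

text \<open>The steps \<open>JI\<close> and \<open>IJ\<close> of the proof are the two inclusions between the ideal of the germ of the
zero set of the chosen equations and the vanishing ideal of \<open>V\<close>. Both conclusions follow from their equality,
because finitely many multipliers \<open>u g\<close>, one for each generator \<open>g\<close> of the vanishing ideal, are
simultaneously nonzero near \<open>c\<close>.\<close>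

theorem nonsingular_local:
  fixes V :: "(real^'n) set"
  assumes V: "irreducible_algebraic V" and c: "c \<in> nonsingular_points V"
  shows "\<exists>\<delta>>0. \<forall>x\<in>V \<inter> ball c \<delta>. x \<in> nonsingular_points V"
    and "\<And>\<epsilon> q. \<epsilon> > 0 \<Longrightarrow> real_polynomial_function q \<Longrightarrow> \<forall>x\<in>V \<inter> ball c \<epsilon>. q x = 0 \<Longrightarrow> \<forall>x\<in>V. q x = 0"
proof -
  let ?I = "vanishing_ideal V"
  define d where "d = algebraic_dim V"
  have cV: "c \<in> V" and dimT: "dim (zariski_tangent_space V c) = d"
    using c by (auto simp: nonsingular_points_def d_def)
  obtain B p where R: "regular_equations c B p" and pI: "p ` B \<subseteq> ?I"
    and T: "zariski_tangent_space V c = {v. \<forall>b\<in>B. b \<bullet> v = 0}"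
    using vanishing_ideal_equations[OF cV] by blast
  interpret regular_equations c B p by (rule R)
  have cardB: "CARD('n) - card B = d" using dim_kernel_at T dimT by simp
  have Vz: "V \<subseteq> zeros" using pI by (auto simp: zeros_def vanishing_ideal_iff)
  have JI: "\<forall>x\<in>V. h x = 0" if h: "h \<in> polys" "\<forall>\<^sub>F y in germ. h y = 0" for h
  proof -
    obtain u where u: "u \<in> polys" "u c \<noteq> 0" "u * h \<in> equations" using germ_vanishing_iff[OF h(1)] h(2) by blast
    have "u x * h x = 0" if "x \<in> V" for x using equations_vanish[OF u(3)] Vz that by auto
    then have "(\<forall>x\<in>V. u x = 0) \<or> (\<forall>x\<in>V. h x = 0)"
      using u(1) h(1) by (intro irreducible_prime[OF V]) auto
    then show ?thesis using u(2) cV by blast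
  qed
  obtain U b a where U: "U \<subseteq> V" "U \<noteq> {}" and b: "real_polynomial_function b" and a: "\<forall>i<d. real_polynomial_function (a i)"
    and bU: "\<forall>x\<in>U. b x \<noteq> 0" and ind: "\<And>h. h \<in> coord_polys d \<Longrightarrow> \<forall>x\<in>U. h (\<lambda>i. a i x / b x) = 0 \<Longrightarrow> h = 0"
    using algebraic_dim_witness[OF V] unfolding d_def[symmetric] by blast
  have bJ: "\<not> (\<forall>\<^sub>F y in germ. b y = 0)" using JI[of b] b U bU by auto
  have evD: "\<forall>\<^sub>F y in germ. dim {v. \<forall>q\<in>p ` B. frechet_derivative q (at y) v = 0} \<le> d"
    using dim_kernel_near unfolding germ_def eventually_inf_principal
    by eventually_elim (simp add: cardB)
  have evp: "\<forall>\<^sub>F y in germ. q y = 0" if "q \<in> p ` B" for q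
    using that unfolding germ_def eventually_inf_principal by (auto simp: zeros_def)
  have IJ: "\<forall>\<^sub>F y in germ. g y = 0" if gI: "g \<in> ?I" for g
  proof (rule ccontr)
    assume nJ: "\<not> (\<forall>\<^sub>F y in germ. g y = 0)"
    have g: "real_polynomial_function g" using gI by (simp add: vanishing_ideal_iff)
    \<comment> \<open>The independent fractions on \<open>V\<close>, followed by \<open>g\<close> written with the same denominator.\<close>
    define a' where "a' i = (if i < d then a i else (\<lambda>x. g x * b x))" for i
    have a': "real_polynomial_function (a' i)" if "i < Suc d" for i
      using that a g b by (auto simp: a'_def intro: real_polynomial_function.intros(4))
    let ?z = "\<lambda>x i. a' i x / b x"
    have "Suc d \<le> d"
    proof (rule independent_functions_le_tangent_dim[OF prime_filter_germ b bJ, where P = "p ` B" and a = a'])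
      fix h assume h: "h \<in> coord_polys (Suc d)" and ev: "\<forall>\<^sub>F x in germ. b x \<noteq> 0 \<longrightarrow> h (?z x) = 0"
      show "h = 0"
      proof (rule ccontr)
        assume "h \<noteq> 0"
        from relation_divided_by_last[OF h this] obtain k h' h0 where h': "h' \<in> coord_polys (Suc d)"
          "h0 \<in> coord_polys d" "h0 \<noteq> 0" "\<forall>z. h z = z d ^ k * h' z" "\<forall>z. z d = 0 \<longrightarrow> h' z = h0 z" by blast
        have "\<exists>N q. real_polynomial_function q \<and> (\<forall>x. b x \<noteq> 0 \<longrightarrow> q x = b x ^ N * h' (?z x))"
        proof (rule clear_denominators[OF h'(1) b])
          fix i assume "i < Suc d"
          then show "\<exists>N q. real_polynomial_function q \<and> (\<forall>x. b x \<noteq> 0 \<longrightarrow> q x = b x ^ N * (a' i x / b x))"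
            using a' by (intro exI[of _ 1] exI[of _ "a' i"]) auto
        qed
        then obtain N q where q: "real_polynomial_function q" "\<forall>x. b x \<noteq> 0 \<longrightarrow> q x = b x ^ N * h' (?z x)" by blast
        have zd: "?z x d = g x" if "b x \<noteq> 0" for x using that by (simp add: a'_def)
        have "\<forall>\<^sub>F x in germ. (b x * g x ^ k) * q x = 0"
          using ev
        proof eventually_elim
          case (elim x)
          show ?case
          proof (cases "b x = 0")
            case False
            then have "g x ^ k * h' (?z x) = 0" using elim h'(4) zd by simp
            then show ?thesis using q(2) False by auto
          qed simp
        qed
        then have "(\<forall>\<^sub>F x in germ. b x * g x ^ k = 0) \<or> (\<forall>\<^sub>F x in germ. q x = 0)"
          using prime_filter_germ q(1) real_polynomial_function.intros(4)[OF b real_polynomial_function_power[OF g, of k]]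
          unfolding prime_filter_def by blast
        moreover have "\<not> (\<forall>\<^sub>F x in germ. b x * g x ^ k = 0)"
        proof
          assume "\<forall>\<^sub>F x in germ. b x * g x ^ k = 0"
          then have "\<forall>\<^sub>F x in germ. b x * g x = 0" by eventually_elim auto
          then show False using prime_filter_germ b g bJ nJ unfolding prime_filter_def by blast
        qed
        ultimately have "\<forall>\<^sub>F x in germ. q x = 0" by blast
        then have q0: "\<forall>x\<in>V. q x = 0" using JI q(1) by simp
        have "h0 (\<lambda>i. a i x / b x) = 0" if x: "x \<in> U" for x
        proof -
          have bx: "b x \<noteq> 0" and "x \<in> V" using x U bU by auto
          have "b x ^ N * h' (?z x) = 0" using q(2)[rule_format, OF bx] q0[rule_format, OF \<open>x \<in> V\<close>] by simp
          then have "h' (?z x) = 0" using bx by simp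
          moreover have "?z x d = 0" using zd[OF bx] gI \<open>x \<in> V\<close> by (simp add: vanishing_ideal_iff)
          ultimately have "h0 (?z x) = 0" using h'(5) by simp
          moreover have "h0 (?z x) = h0 (\<lambda>i. a i x / b x)"
            by (rule coord_polys_local[OF h'(2)]) (simp add: a'_def)
          ultimately show ?thesis by simp
        qed
        then have "h0 = 0" using ind[OF h'(2)] by blast
        with h'(3) show False by simp
      qed
    qed (use fin poly a' evp evD in auto)
    then show False by simp
  qed
  obtain A where A: "A \<subseteq> ?I" "finite A" "?I \<subseteq> generated_ideal polys A"
    using finite_generators_polys[of ?I] by (auto simp: vanishing_ideal_iff subset_iff)
  have Ap: "A \<subseteq> polys" using A(1) by (auto simp: vanishing_ideal_iff)
  have "\<forall>g\<in>A. \<exists>u\<in>polys. u c \<noteq> 0 \<and> u * g \<in> equations"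
    using IJ A(1) germ_vanishing_iff Ap by blast
  then obtain u where u: "\<And>g. g \<in> A \<Longrightarrow> u g \<in> polys" "\<And>g. g \<in> A \<Longrightarrow> u g c \<noteq> 0" "\<And>g. g \<in> A \<Longrightarrow> u g * g \<in> equations" by metis
  have "\<forall>\<^sub>F y in nhds c. \<forall>g\<in>A. u g y \<noteq> 0"
  proof (rule eventually_ball_finite[OF A(2)], rule ballI)
    fix g assume "g \<in> A"
    then have "isCont (u g) c" using continuous_on_real_polynomial[of "u g" UNIV] u(1) by (simp add: continuous_on_eq_continuous_at)
    then show "\<forall>\<^sub>F y in nhds c. u g y \<noteq> 0"
      using u(2)[OF \<open>g \<in> A\<close>] by (simp add: isCont_def tendsto_imp_eventually_ne eventually_nhds_conv_at)
  qed
  with dim_kernel_near have "\<forall>\<^sub>F y in nhds c. dim {v. \<forall>b\<in>B. frechet_derivative (p b) (at y) v = 0} = d \<and> (\<forall>g\<in>A. u g y \<noteq> 0)"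
    unfolding cardB by (rule eventually_conj)
  then obtain \<delta> where \<delta>: "\<delta> > 0" "\<And>y. dist y c < \<delta> \<Longrightarrow> dim {v. \<forall>b\<in>B. frechet_derivative (p b) (at y) v = 0} = d"
    "\<And>y g. dist y c < \<delta> \<Longrightarrow> g \<in> A \<Longrightarrow> u g y \<noteq> 0" unfolding eventually_nhds_metric by blast
  have pB: "p ` B \<subseteq> polys" using poly by auto
  have "x \<in> nonsingular_points V" if x: "x \<in> V" "x \<in> ball c \<delta>" for x
  proof -
    have near: "dist x c < \<delta>" using x(2) by (simp add: dist_commute)
    have "zariski_tangent_space V x = {v. \<forall>b\<in>B. frechet_derivative (p b) (at x) v = 0}"
    proof (intro equalityI subsetI)
      fix v assume "v \<in> zariski_tangent_space V x"
      then show "v \<in> {v. \<forall>b\<in>B. frechet_derivative (p b) (at x) v = 0}"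
        using pI by (auto simp: zariski_tangent_space_def)
    next
      fix v assume v: "v \<in> {v. \<forall>b\<in>B. frechet_derivative (p b) (at x) v = 0}"
      have Av: "g x = 0 \<and> frechet_derivative g (at x) v = 0" if g: "g \<in> A" for g
      proof -
        have "(u g * g) x = 0 \<and> frechet_derivative (u g * g) (at x) v = 0"
          using u(3)[OF g] unfolding equations_def
          by (rule deriv_generated_ideal[OF _ pB]) (use v Vz x(1) in \<open>auto simp: zeros_def\<close>)
        then show ?thesis using u(1)[OF g] g Ap \<delta>(3)[OF near g] by (intro deriv_cancel[of "u g"]) auto
      qed
      have "frechet_derivative q (at x) v = 0" if "q \<in> ?I" for q
        using deriv_generated_ideal[OF _ Ap Av, of q] A(3) that by blast
      then show "v \<in> zariski_tangent_space V x" by (simp add: zariski_tangent_space_def)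
    qed
    then show ?thesis using \<delta>(2)[OF near] x(1) by (simp add: nonsingular_points_def d_def)
  qed
  then show "\<exists>\<delta>>0. \<forall>x\<in>V \<inter> ball c \<delta>. x \<in> nonsingular_points V" using \<delta>(1) by blast
  fix \<epsilon> q assume \<epsilon>: "\<epsilon> > (0::real)" and q: "real_polynomial_function q" "\<forall>x\<in>V \<inter> ball c \<epsilon>. q x = 0"
  have algV: "real_algebraic V" using V by (simp add: irreducible_algebraic_def)
  have inV: "y \<in> V" if y: "y \<in> zeros" "dist y c < \<delta>" for y
  proof -
    have "g y = 0" if g: "g \<in> A" for g
      using equations_vanish[OF u(3)[OF g] y(1)] \<delta>(3)[OF y(2) g] by simp
    then have "g y = 0" if "g \<in> ?I" for g using generated_ideal_vanishes[of g polys A y] A(3) that by blast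
    then show ?thesis using real_algebraic_mem[OF algV] by blast
  qed
  have "\<forall>\<^sub>F y in nhds c. y \<in> zeros \<longrightarrow> q y = 0"
    unfolding eventually_nhds_metric
  proof (intro exI[of _ "min \<delta> \<epsilon>"] conjI allI impI)
    show "0 < min \<delta> \<epsilon>" using \<delta>(1) \<epsilon> by simp
    fix y assume "dist y c < min \<delta> \<epsilon>" "y \<in> zeros"
    then show "q y = 0" using inV[of y] q(2) by (simp add: dist_commute)
  qed
  then have "\<forall>\<^sub>F y in germ. q y = 0" unfolding germ_def eventually_inf_principal .
  then show "\<forall>x\<in>V. q x = 0" using JI q(1) by simp
qed

section \<open>Density in the central locus\<close>

text \<open>Near a central point there is a nonsingular point \<open>c\<close> of a component \<open>V\<close>. A polynomial that
vanishes on the complement of \<open>U\<close> but not on \<open>V\<close> cannot vanish on \<open>V\<close> near \<open>c\<close>; where it is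
nonzero, near \<open>c\<close>, lie points of \<open>U\<close> that are again nonsingular and hence central.\<close>

lemma dense_open_dense_in_Cent:
  fixes X :: "(real^'n) set"
  assumes X: "real_algebraic X" and U: "zariski_dense_open U X" and x: "x \<in> Cent X" and \<epsilon>: "\<epsilon> > 0"
  shows "\<exists>u\<in>U \<inter> Cent X. dist u x < \<epsilon>"
proof -
  obtain V where V: "V \<in> irreducible_components X" "x \<in> V" "x \<in> closure (nonsingular_points V)"
    using x unfolding Cent_def by blast
  have irr: "irreducible_algebraic V" and VX: "V \<subseteq> X" using V(1) by (auto simp: irreducible_components_def)
  obtain c where c: "c \<in> nonsingular_points V" "dist c x < \<epsilon> / 2"
    using V(3) \<epsilon> unfolding closure_approachable by (meson half_gt_zero)
  obtain \<delta> where \<delta>: "\<delta> > 0" "\<forall>y\<in>V \<inter> ball c \<delta>. y \<in> nonsingular_points V" using nonsingular_local(1)[OF irr c(1)] by blast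
  obtain q where q: "real_polynomial_function q" "\<forall>x\<in>X - U. q x = 0" "\<exists>v\<in>V. q v \<noteq> 0"
    using component_meets_dense_open[OF X V(1) U] by blast
  have "\<exists>v\<in>V \<inter> ball c (min \<delta> (\<epsilon> / 2)). q v \<noteq> 0"
  proof (rule ccontr)
    assume "\<not> ?thesis"
    then have "\<forall>x\<in>V. q x = 0" using \<delta>(1) \<epsilon> q(1) by (intro nonsingular_local(2)[OF irr c(1), of "min \<delta> (\<epsilon> / 2)"]) auto
    then show False using q(3) by blast
  qed
  then obtain v where v: "v \<in> V" "dist c v < \<delta>" "dist c v < \<epsilon> / 2" "q v \<noteq> 0" by auto
  have "v \<in> U" using v q(2) VX by blast
  moreover have "v \<in> nonsingular_points V" using v \<delta>(2) by simp
  then have "v \<in> Cent X" unfolding Cent_def using V(1) v(1) closure_subset by blast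
  moreover have "dist v x < \<epsilon>" using v(3) c(2) dist_triangle[of v x c] by (simp add: dist_commute)
  ultimately show ?thesis by blast
qed

lemma continuous_eq_on_Cent:
  fixes f g :: "real^'n \<Rightarrow> real"
  assumes X: "real_algebraic X" and U: "zariski_dense_open U X"
    and cont: "continuous_on (Cent X) f" "continuous_on (Cent X) g"
    and eq: "\<And>x. x \<in> U \<inter> Cent X \<Longrightarrow> f x = g x" and x: "x \<in> Cent X"
  shows "f x = g x"
proof (rule ccontr)
  assume ne: "f x \<noteq> g x"
  have "continuous_on (Cent X) (\<lambda>x. f x - g x)" using cont by (intro continuous_intros)
  then obtain d where d: "d > 0" "\<And>y. y \<in> Cent X \<Longrightarrow> dist y x < d \<Longrightarrow> dist (f y - g y) (f x - g x) < \<bar>f x - g x\<bar>"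
    using x ne unfolding continuous_on_iff by (meson right_minus_eq zero_less_abs_iff)
  obtain u where u: "u \<in> U \<inter> Cent X" "dist u x < d" using dense_open_dense_in_Cent[OF X U x d(1)] by blast
  then show False using d(2)[of u] eq[OF u(1)] by (auto simp: dist_real_def)
qed

section \<open>Polynomial functions on the seminormalization\<close>

lemma polynomial_function_vec:
  fixes f :: "real^'m \<Rightarrow> real^'n"
  shows "polynomial_function f \<longleftrightarrow> (\<forall>j. real_polynomial_function (\<lambda>x. f x $ j))"
proof
  assume "polynomial_function f"
  then show "\<forall>j. real_polynomial_function (\<lambda>x. f x $ j)"
    using bounded_linear_vec_nth unfolding polynomial_function_def o_def by blast
next
  assume f: "\<forall>j. real_polynomial_function (\<lambda>x. f x $ j)"
  show "polynomial_function f"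
    unfolding polynomial_function_def
  proof (intro allI impI)
    fix g :: "real^'n \<Rightarrow> real" assume g: "bounded_linear g"
    have "g \<circ> f = (\<lambda>x. \<Sum>j\<in>UNIV. f x $ j * g (axis j 1))"
    proof
      fix x
      show "(g \<circ> f) x = (\<Sum>j\<in>UNIV. f x $ j * g (axis j 1))"
        unfolding o_apply by (rule linear_functional_coords[OF bounded_linear.linear[OF g]])
    qed
    moreover have "real_polynomial_function (\<lambda>x. \<Sum>j\<in>UNIV. f x $ j * g (axis j 1))"
      using f by (intro real_polynomial_function_sum real_polynomial_function.intros(2,4)) auto
    ultimately show "real_polynomial_function (g \<circ> f)" by simp
  qed
qed

lemma real_polynomial_compose_vec:
  fixes s :: "real^'m \<Rightarrow> real^'n"
  assumes "real_polynomial_function h" "polynomial_function s"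
  shows "real_polynomial_function (\<lambda>z. h (s z))"
  using real_polynomial_function_compose[OF assms(2,1)] by (simp add: o_def)

lemma polynomial_substitution:
  fixes \<Psi> :: "(real^'k \<Rightarrow> real) \<Rightarrow> 'a \<Rightarrow> real" and h :: "real^'m \<Rightarrow> real"
  assumes const: "\<And>c. \<Psi> (\<lambda>_. c) x = c"
    and add: "\<And>p q. real_polynomial_function p \<Longrightarrow> real_polynomial_function q \<Longrightarrow> \<Psi> (\<lambda>z. p z + q z) x = \<Psi> p x + \<Psi> q x"
    and mult: "\<And>p q. real_polynomial_function p \<Longrightarrow> real_polynomial_function q \<Longrightarrow> \<Psi> (\<lambda>z. p z * q z) x = \<Psi> p x * \<Psi> q x"
    and s: "polynomial_function s" and h: "real_polynomial_function h"
  shows "\<Psi> (\<lambda>z. h (s z)) x = h (\<chi> j. \<Psi> (\<lambda>z. s z $ j) x)"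
proof -
  obtain e where e: "bij_betw e {..<CARD('m)} (UNIV :: 'm set)" using ex_enum by blast
  have "h \<in> polys_in (\<lambda>i x. x $ e i) CARD('m)" using h polys_in_coords[OF e] by simp
  then have "real_polynomial_function h \<and> \<Psi> (\<lambda>z. h (s z)) x = h (\<chi> j. \<Psi> (\<lambda>z. s z $ j) x)"
    by (induction rule: polys_in_induct)
       (auto simp: const add mult real_polynomial_compose_vec[OF _ s] real_polynomial_coord intro: real_polynomial_function.intros)
  then show ?thesis by blast
qed

text \<open>The isomorphism is turned into a map \<open>\<Psi>\<close> on polynomials of the ambient space, which avoids
restrictions in the sequel. Real constants are preserved because they are pulled back from \<open>X\<close>.\<close>

lemma seminormalization_hom:
  fixes X :: "(real^'n) set" and Z :: "(real^'k) set"
  assumes "is_seminormalization_cent X Z \<rho>"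
  shows "\<exists>\<Psi>. (\<forall>p. real_polynomial_function p \<longrightarrow> \<Psi> p \<in> integral_closure_R0 X) \<and>
    (\<forall>f\<in>integral_closure_R0 X. \<exists>p. real_polynomial_function p \<and> \<Psi> p = f) \<and>
    (\<forall>p q. real_polynomial_function p \<longrightarrow> real_polynomial_function q \<longrightarrow>
       (\<forall>x\<in>Cent X. \<Psi> p x = \<Psi> q x) \<longrightarrow> (\<forall>z\<in>Z. p z = q z)) \<and>
    (\<forall>p q. (\<forall>z\<in>Z. p z = q z) \<longrightarrow> \<Psi> p = \<Psi> q) \<and>
    (\<forall>p. real_polynomial_function p \<longrightarrow> (\<forall>x\<in>Cent X. \<Psi> (\<lambda>z. p (\<rho> z)) x = p x)) \<and>
    (\<forall>h s. \<forall>x\<in>Cent X. polynomial_function s \<longrightarrow> real_polynomial_function (h :: real^'m \<Rightarrow> real) \<longrightarrow>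
       \<Psi> (\<lambda>z. h (s z)) x = h (\<chi> j. \<Psi> (\<lambda>z. s z $ j) x))"
proof -
  let ?C = "Cent X" and ?R = "integral_closure_R0 X"
  obtain \<Phi> where \<Phi>: "\<Phi> \<in> ring_iso (polynomial_ring Z) (function_ring ?C ?R)"
    and \<Phi>\<rho>': "\<forall>p. real_polynomial_function p \<longrightarrow> \<Phi> (restrict (p \<circ> \<rho>) Z) = restrict p ?C"
    using assms unfolding is_seminormalization_cent_def by (elim conjE bexE)
  note \<Phi>\<rho> = \<Phi>\<rho>'[rule_format]
  have hom: "\<Phi> \<in> ring_hom (polynomial_ring Z) (function_ring ?C ?R)"
    and bij: "bij_betw \<Phi> {restrict p Z | p. real_polynomial_function p} ?R"
    using \<Phi> by (auto simp: ring_iso_def polynomial_ring_def function_ring_def)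
  define \<Psi> where "\<Psi> p = \<Phi> (restrict p Z)" for p
  have mem: "restrict p Z \<in> carrier (polynomial_ring Z)" if "real_polynomial_function p" for p
    using that by (auto simp: polynomial_ring_def function_ring_def)
  have dom: "restrict p Z \<in> {restrict p Z | p. real_polynomial_function p}" if "real_polynomial_function p" for p
    using that by blast
  have car: "\<Psi> p \<in> ?R" if "real_polynomial_function p" for p
    unfolding \<Psi>_def by (rule bij_betw_apply[OF bij dom[OF that]])
  have surj: "\<exists>p. real_polynomial_function p \<and> \<Psi> p = f" if "f \<in> ?R" for f
  proof -
    have "f \<in> \<Phi> ` {restrict p Z | p. real_polynomial_function p}"
      using that by (simp only: bij_betw_imp_surj_on[OF bij])
    then obtain g where "f = \<Phi> g" "g \<in> {restrict p Z | p. real_polynomial_function p}" by (rule imageE)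
    moreover from this(2) obtain p where "g = restrict p Z" "real_polynomial_function p" by blast
    ultimately show ?thesis unfolding \<Psi>_def by auto
  qed
  have ext: "f \<in> extensional ?C" if "f \<in> ?R" for f
    using that by (auto simp: integral_closure_R0_def R0_def K0_def)
  have inj: "\<forall>z\<in>Z. p z = q z"
    if "real_polynomial_function p" "real_polynomial_function q" "\<forall>x\<in>?C. \<Psi> p x = \<Psi> q x" for p q
  proof -
    have "\<Psi> p = \<Psi> q" using that ext[OF car] by (intro extensionalityI[of _ ?C]) auto
    then have eq: "restrict p Z = restrict q Z"
      unfolding \<Psi>_def by (rule inj_onD[OF bij_betw_imp_inj_on[OF bij] _ dom[OF that(1)] dom[OF that(2)]])
    show ?thesis
    proof
      fix z assume "z \<in> Z"
      then show "p z = q z" using fun_cong[OF eq, of z] by simp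
    qed
  qed
  have cong: "\<Psi> p = \<Psi> q" if "\<forall>z\<in>Z. p z = q z" for p q
    unfolding \<Psi>_def using that by (intro arg_cong[of _ _ \<Phi>]) (auto simp: fun_eq_iff)
  have add: "\<Psi> (\<lambda>z. p z + q z) x = \<Psi> p x + \<Psi> q x"
    if "real_polynomial_function p" "real_polynomial_function q" "x \<in> ?C" for p q x
  proof -
    have "restrict p Z \<oplus>\<^bsub>polynomial_ring Z\<^esub> restrict q Z = restrict (\<lambda>z. p z + q z) Z"
      by (auto simp: polynomial_ring_def function_ring_def fun_eq_iff)
    then have "\<Psi> (\<lambda>z. p z + q z) = \<Psi> p \<oplus>\<^bsub>function_ring ?C ?R\<^esub> \<Psi> q"
      using ring_hom_add[OF hom mem[OF that(1)] mem[OF that(2)]] by (simp add: \<Psi>_def)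
    then show ?thesis using that(3) by (simp add: function_ring_def)
  qed
  have mult: "\<Psi> (\<lambda>z. p z * q z) x = \<Psi> p x * \<Psi> q x"
    if "real_polynomial_function p" "real_polynomial_function q" "x \<in> ?C" for p q x
  proof -
    have "restrict p Z \<otimes>\<^bsub>polynomial_ring Z\<^esub> restrict q Z = restrict (\<lambda>z. p z * q z) Z"
      by (auto simp: polynomial_ring_def function_ring_def fun_eq_iff)
    then have "\<Psi> (\<lambda>z. p z * q z) = \<Psi> p \<otimes>\<^bsub>function_ring ?C ?R\<^esub> \<Psi> q"
      using ring_hom_mult[OF hom mem[OF that(1)] mem[OF that(2)]] by (simp add: \<Psi>_def)
    then show ?thesis using that(3) by (simp add: function_ring_def)
  qed
  have \<rho>: "\<Psi> (\<lambda>z. p (\<rho> z)) x = p x" if "real_polynomial_function p" "x \<in> ?C" for p x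
    using \<Phi>\<rho>[OF that(1)] that(2) by (simp add: \<Psi>_def o_def)
  have const: "\<Psi> (\<lambda>_. c) x = c" if "x \<in> ?C" for c x
    using \<rho>[of "\<lambda>_. c", OF real_polynomial_function.intros(2) that] .
  have subst: "\<Psi> (\<lambda>z. h (s z)) x = h (\<chi> j. \<Psi> (\<lambda>z. s z $ j) x)"
    if "x \<in> ?C" "polynomial_function s" "real_polynomial_function h" for h :: "real^'m \<Rightarrow> real" and s x
    by (rule polynomial_substitution[of \<Psi> x s h, OF const[OF that(1)] add[OF _ _ that(1)] mult[OF _ _ that(1)] that(2,3)])
  show ?thesis
  proof (rule exI[of _ \<Psi>], intro conjI)
    show "\<forall>p. real_polynomial_function p \<longrightarrow> \<Psi> p \<in> ?R" by (intro allI impI) (rule car)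
    show "\<forall>f\<in>?R. \<exists>p. real_polynomial_function p \<and> \<Psi> p = f" by (intro ballI) (rule surj)
    show "\<forall>p q. real_polynomial_function p \<longrightarrow> real_polynomial_function q \<longrightarrow>
       (\<forall>x\<in>?C. \<Psi> p x = \<Psi> q x) \<longrightarrow> (\<forall>z\<in>Z. p z = q z)" by (intro allI impI) (rule inj)
    show "\<forall>p q. (\<forall>z\<in>Z. p z = q z) \<longrightarrow> \<Psi> p = \<Psi> q" by (intro allI impI) (rule cong)
    show "\<forall>p. real_polynomial_function p \<longrightarrow> (\<forall>x\<in>?C. \<Psi> (\<lambda>z. p (\<rho> z)) x = p x)"
      by (intro allI impI ballI) (rule \<rho>)
    show "\<forall>h s. \<forall>x\<in>?C. polynomial_function s \<longrightarrow> real_polynomial_function (h :: real^'m \<Rightarrow> real) \<longrightarrow>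
       \<Psi> (\<lambda>z. h (s z)) x = h (\<chi> j. \<Psi> (\<lambda>z. s z $ j) x)"
      by (intro allI impI ballI) (rule subst)
  qed
qed

text \<open>On \<open>V\<close> the coordinates satisfy \<open>q (\<pi> y) * y $ j = p (\<pi> y)\<close>, where \<open>p / q\<close> is the \<open>j\<close>-th
component of the inverse. This polynomial identity extends to \<open>Y\<close>, so it determines every point of
\<open>Y\<close> over \<open>U\<close>, and no such point lies outside \<open>V\<close>.\<close>

lemma inverse_on_dense_open:
  fixes \<pi> :: "real^'m \<Rightarrow> real^'n"
  assumes t: "polynomial_function t" "\<And>y. y \<in> Y \<Longrightarrow> \<pi> y = t y"
    and V: "zariski_dense_open V Y" and iso: "iso_onto \<pi> V U"
    and y: "y \<in> Y" "\<pi> y \<in> U"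
  shows "inv_into V \<pi> (\<pi> y) = y"
proof -
  have bij: "bij_betw \<pi> V U" using iso by (simp add: iso_onto_def)
  have VY: "V \<subseteq> Y" using zariski_dense_openD(1)[OF V] by blast
  have "inv_into V \<pi> (\<pi> y) $ j = y $ j" for j
  proof -
    have "regular_on U (\<lambda>x. inv_into V \<pi> x $ j)" using iso by (simp add: iso_onto_def)
    then obtain p q where pq: "real_polynomial_function p" "real_polynomial_function q"
      "\<forall>x\<in>U. q x \<noteq> 0 \<and> inv_into V \<pi> x $ j = p x / q x"
      unfolding regular_on_def by (elim exE conjE)
    have "real_polynomial_function (\<lambda>y. q (t y) * y $ j - p (t y))"
      by (rule real_polynomial_function_diff[OF real_polynomial_function.intros(4)[OF
        real_polynomial_compose_vec[OF pq(2) t(1)] real_polynomial_coord] real_polynomial_compose_vec[OF pq(1) t(1)]])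
    then have "real_algebraic {y. q (t y) * y $ j - p (t y) = 0}" by (rule real_algebraic_zero_set)
    moreover have "V \<subseteq> {y. q (t y) * y $ j - p (t y) = 0}"
    proof
      fix v assume v: "v \<in> V"
      then have "\<pi> v \<in> U" "inv_into V \<pi> (\<pi> v) = v" "\<pi> v = t v"
        using bij VY t(2) by (auto simp: bij_betw_def inv_into_f_f)
      then show "v \<in> {y. q (t y) * y $ j - p (t y) = 0}" using pq(3)[rule_format, of "t v"] by (auto simp: field_simps)
    qed
    ultimately have "q (t y) * y $ j - p (t y) = 0" using zariski_dense_openD(2)[OF V] y(1) by blast
    then show ?thesis using pq(3)[rule_format, OF y(2)] t(2)[OF y(1)] by (simp add: field_simps)
  qed
  then show ?thesis by (simp add: vec_eq_iff)
qed

lemma polynomial_mapD: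
  assumes "polynomial_map Y X f"
  shows "\<exists>q. polynomial_function q \<and> (\<forall>y\<in>Y. f y = q y)"
  using assms unfolding polynomial_map_def by (rule conjunct1)

theorem theorem4p15:
  fixes X :: "(real^'n) set" and Y :: "(real^'m) set" and Xsc :: "(real^'k) set"
    and \<pi> :: "real^'m \<Rightarrow> real^'n" and \<pi>sc :: "real^'k \<Rightarrow> real^'n"
  assumes "real_algebraic X"
    and "is_seminormalization_cent X Xsc \<pi>sc"
    and "real_algebraic Y"
    and "finite_map Y X \<pi>" and "birational_map Y X \<pi>"
  shows "inverse_hereditarily_rational Y X \<pi> \<longleftrightarrow>
    (\<exists>\<psi>. polynomial_map Xsc Y \<psi> \<and> (\<forall>z\<in>Xsc. \<pi>sc z = \<pi> (\<psi> z)))"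
proof -
  let ?C = "Cent X"
  obtain \<Psi> where \<Psi>: "\<forall>p. real_polynomial_function p \<longrightarrow> \<Psi> p \<in> integral_closure_R0 X"
    "\<forall>f\<in>integral_closure_R0 X. \<exists>p. real_polynomial_function p \<and> \<Psi> p = f"
    "\<forall>p q. real_polynomial_function p \<longrightarrow> real_polynomial_function q \<longrightarrow>
       (\<forall>x\<in>?C. \<Psi> p x = \<Psi> q x) \<longrightarrow> (\<forall>z\<in>Xsc. p z = q z)"
    "\<forall>p q. (\<forall>z\<in>Xsc. p z = q z) \<longrightarrow> \<Psi> p = \<Psi> q"
    "\<forall>p. real_polynomial_function p \<longrightarrow> (\<forall>x\<in>?C. \<Psi> (\<lambda>z. p (\<pi>sc z)) x = p x)"
    "\<forall>h s. \<forall>x\<in>?C. polynomial_function s \<longrightarrow> real_polynomial_function (h :: real^'m \<Rightarrow> real) \<longrightarrow>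
       \<Psi> (\<lambda>z. h (s z)) x = h (\<chi> j. \<Psi> (\<lambda>z. s z $ j) x)"
    using seminormalization_hom[OF assms(2), where 'm = 'm] by (elim exE conjE)
  note car = \<Psi>(1)[rule_format] and surj = \<Psi>(2)[rule_format]
    and inj = \<Psi>(3)[THEN spec, THEN spec, THEN mp, THEN mp, THEN mp]
    and cong = \<Psi>(4)[THEN spec, THEN spec, THEN mp]
    and base = \<Psi>(5)[rule_format] and subst = \<Psi>(6)[rule_format]
  have "polynomial_map Y X \<pi>" using assms(4) by (simp add: finite_map_def)
  from polynomial_mapD[OF this] obtain t where t: "polynomial_function t" "\<And>y. y \<in> Y \<Longrightarrow> \<pi> y = t y" by metis
  have "polynomial_map Xsc X \<pi>sc" using assms(2) by (simp add: is_seminormalization_cent_def)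
  from polynomial_mapD[OF this] obtain r where r: "polynomial_function r" "\<And>z. z \<in> Xsc \<Longrightarrow> \<pi>sc z = r z" by metis
  have zero: "\<Psi> (\<lambda>_. 0) x = 0" if "x \<in> ?C" for x
    using base[of "\<lambda>_. 0", OF real_polynomial_function.intros(2) that] .
  have coord: "\<Psi> (\<lambda>z. r z $ i) x = x $ i" if "x \<in> ?C" for i x
  proof -
    have "\<Psi> (\<lambda>z. r z $ i) = \<Psi> (\<lambda>z. \<pi>sc z $ i)" using r(2) by (intro cong) simp
    then show ?thesis using base[OF real_polynomial_coord that, of i] by simp
  qed
  have tc: "real_polynomial_function (\<lambda>y. t y $ i)" for i using t(1) by (simp add: polynomial_function_vec)
  have rc: "real_polynomial_function (\<lambda>z. r z $ i)" for i using r(1) by (simp add: polynomial_function_vec)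
  show ?thesis
  proof
    assume "inverse_hereditarily_rational Y X \<pi>"
    then obtain f V U where f': "\<forall>j. restrict (\<lambda>x. f x $ j) ?C \<in> R0 X"
      and V: "zariski_dense_open V Y" and U: "zariski_dense_open U X" and iso: "iso_onto \<pi> V U"
      and fU': "\<forall>x\<in>U \<inter> ?C. f x = inv_into V \<pi> x"
      unfolding inverse_hereditarily_rational_def by (elim exE conjE)
    note f = f'[rule_format] and fU = fU'[rule_format]
    have bij: "bij_betw \<pi> V U" using iso by (simp add: iso_onto_def)
    have VY: "V \<subseteq> Y" using zariski_dense_openD(1)[OF V] by blast
    have fY: "f x \<in> Y" "t (f x) = x" if "x \<in> U \<inter> ?C" for x
    proof -
      have "inv_into V \<pi> x \<in> V" "\<pi> (inv_into V \<pi> x) = x"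
        using bij that by (auto simp: bij_betw_def inv_into_into f_inv_into_f)
      then show "f x \<in> Y" "t (f x) = x" using fU[OF that] VY t(2) by auto
    qed
    have "continuous_on ?C (\<lambda>x. f x $ j)" for j
    proof -
      have "continuous_on ?C (restrict (\<lambda>x. f x $ j) ?C)" using f by (auto simp: R0_def K0_def)
      then show ?thesis by (simp cong: continuous_on_cong)
    qed
    then have "continuous_on ?C (\<lambda>x. \<chi> j. f x $ j)" by (rule continuous_on_vec_lambda)
    then have cont: "continuous_on ?C f" by (simp only: vec_nth_inverse)
    have cont_poly: "continuous_on ?C (\<lambda>x. h (f x))" if "real_polynomial_function h" for h :: "real^'m \<Rightarrow> real"
      using continuous_on_compose2[OF continuous_on_real_polynomial[OF that, of UNIV] cont] by simp
    have fint: "restrict (\<lambda>x. f x $ j) ?C \<in> integral_closure_R0 X" for j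
    proof -
      obtain d :: nat and a where a': "\<forall>i<d. real_polynomial_function (a i)"
        and eq': "\<forall>y\<in>Y. (y $ j) ^ d + (\<Sum>i<d. a i (\<pi> y) * (y $ j) ^ i) = 0"
        using finite_map_integral[OF assms(4) real_polynomial_coord[of j]] by (elim exE conjE)
      note a = a'[rule_format] and eq = eq'[rule_format]
      have "(f x $ j) ^ d + (\<Sum>i<d. a i x * (f x $ j) ^ i) = 0" if x: "x \<in> ?C" for x
      proof (rule continuous_eq_on_Cent[OF assms(1) U _ continuous_on_const _ x])
        show "continuous_on ?C (\<lambda>x. (f x $ j) ^ d + (\<Sum>i<d. a i x * (f x $ j) ^ i))"
          using cont a by (intro continuous_intros continuous_on_real_polynomial) auto
        fix x assume x: "x \<in> U \<inter> ?C"
        show "(f x $ j) ^ d + (\<Sum>i<d. a i x * (f x $ j) ^ i) = 0"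
          using eq[OF fY(1)[OF x]] t(2)[OF fY(1)[OF x]] fY(2)[OF x] by simp
      qed
      then show ?thesis using f a unfolding integral_closure_R0_def by (auto intro!: exI[of _ d] exI[of _ a])
    qed
    have "\<forall>j. \<exists>p. real_polynomial_function p \<and> \<Psi> p = restrict (\<lambda>x. f x $ j) ?C" using surj[OF fint] by blast
    then obtain s where s: "\<And>j. real_polynomial_function (s j)" "\<And>j. \<Psi> (s j) = restrict (\<lambda>x. f x $ j) ?C" by metis
    define \<psi> where "\<psi> z = (\<chi> j. s j z)" for z
    have \<psi>: "polynomial_function \<psi>" by (simp add: polynomial_function_vec \<psi>_def s(1))
    have sub: "\<Psi> (\<lambda>z. h (\<psi> z)) x = h (f x)" if "x \<in> ?C" "real_polynomial_function h" for h x
    proof -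
      have "\<Psi> (\<lambda>z. h (\<psi> z)) x = h (\<chi> j. \<Psi> (\<lambda>z. \<psi> z $ j) x)" by (rule subst[OF that(1) \<psi> that(2)])
      also have "(\<chi> j. \<Psi> (\<lambda>z. \<psi> z $ j) x) = f x" using that(1) by (simp add: \<psi>_def s(2) vec_eq_iff)
      finally show ?thesis .
    qed
    have \<psi>Y: "\<psi> z \<in> Y" if z: "z \<in> Xsc" for z
      unfolding real_algebraic_mem[OF assms(3)]
    proof
      fix h assume h: "h \<in> vanishing_ideal Y"
      then have hp: "real_polynomial_function h" by (simp add: vanishing_ideal_iff)
      have "h (f x) = 0" if "x \<in> ?C" for x
        by (rule continuous_eq_on_Cent[OF assms(1) U cont_poly[OF hp] continuous_on_const _ that])
           (use fY h in \<open>auto simp: vanishing_ideal_iff\<close>)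
      then have "\<forall>x\<in>?C. \<Psi> (\<lambda>z. h (\<psi> z)) x = \<Psi> (\<lambda>_. 0) x" using sub hp zero by simp
      then have "\<forall>z\<in>Xsc. h (\<psi> z) = 0"
        by (rule inj[OF real_polynomial_compose_vec[OF hp \<psi>] real_polynomial_function.intros(2)])
      then show "h (\<psi> z) = 0" using z by blast
    qed
    have "\<pi>sc z = \<pi> (\<psi> z)" if z: "z \<in> Xsc" for z
    proof -
      have "t (\<psi> z) $ i = r z $ i" for i
      proof -
        have "t (f x) $ i = x $ i" if "x \<in> ?C" for x
          by (rule continuous_eq_on_Cent[OF assms(1) U cont_poly[OF tc] _ _ that])
             (use fY in \<open>auto intro: continuous_intros\<close>)
        then have "\<forall>x\<in>?C. \<Psi> (\<lambda>z. t (\<psi> z) $ i) x = \<Psi> (\<lambda>z. r z $ i) x"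
          using sub[OF _ tc[of i]] coord by simp
        then have "\<forall>z\<in>Xsc. t (\<psi> z) $ i = r z $ i"
          by (rule inj[OF real_polynomial_compose_vec[OF tc \<psi>] rc])
        then show ?thesis using z by blast
      qed
      then show ?thesis using r(2)[OF z] t(2)[OF \<psi>Y[OF z]] by (simp add: vec_eq_iff)
    qed
    moreover have "polynomial_map Xsc Y \<psi>" using \<psi> \<psi>Y unfolding polynomial_map_def by blast
    ultimately show "\<exists>\<psi>. polynomial_map Xsc Y \<psi> \<and> (\<forall>z\<in>Xsc. \<pi>sc z = \<pi> (\<psi> z))" by blast
  next
    assume "\<exists>\<psi>. polynomial_map Xsc Y \<psi> \<and> (\<forall>z\<in>Xsc. \<pi>sc z = \<pi> (\<psi> z))"
    then obtain \<psi> where \<psi>: "polynomial_map Xsc Y \<psi>" and fac': "\<forall>z\<in>Xsc. \<pi>sc z = \<pi> (\<psi> z)" by (elim exE conjE)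
    note fac = fac'[rule_format]
    from polynomial_mapD[OF \<psi>] obtain s where s: "polynomial_function s" "\<And>z. z \<in> Xsc \<Longrightarrow> \<psi> z = s z" by metis
    have \<psi>Y: "\<psi> z \<in> Y" if "z \<in> Xsc" for z using \<psi> that by (auto simp: polynomial_map_def)
    have sc: "real_polynomial_function (\<lambda>z. s z $ j)" for j using s(1) by (simp add: polynomial_function_vec)
    define f where "f x = (\<chi> j. \<Psi> (\<lambda>z. s z $ j) x)" for x
    have fR: "restrict (\<lambda>x. f x $ j) ?C \<in> R0 X" for j
    proof -
      have "\<Psi> (\<lambda>z. s z $ j) \<in> R0 X" using car[OF sc, of j] by (simp add: integral_closure_R0_def)
      moreover from this have "\<Psi> (\<lambda>z. s z $ j) \<in> extensional ?C" by (simp add: R0_def K0_def)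
      then have "restrict (\<lambda>x. f x $ j) ?C = \<Psi> (\<lambda>z. s z $ j)"
        by (simp add: f_def extensional_restrict)
      ultimately show ?thesis by simp
    qed
    have fY: "f x \<in> Y" if x: "x \<in> ?C" for x
      unfolding real_algebraic_mem[OF assms(3)]
    proof
      fix h assume h: "h \<in> vanishing_ideal Y"
      then have hp: "real_polynomial_function h" by (simp add: vanishing_ideal_iff)
      have "\<Psi> (\<lambda>z. h (s z)) = \<Psi> (\<lambda>_. 0)"
        using h \<psi>Y s(2) by (intro cong) (auto simp: vanishing_ideal_iff)
      then show "h (f x) = 0" using subst[OF x s(1) hp] zero[OF x] by (simp add: f_def)
    qed
    have \<pi>f: "\<pi> (f x) = x" if x: "x \<in> ?C" for x
    proof -
      have "t (f x) $ i = x $ i" for i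
      proof -
        have "\<forall>z\<in>Xsc. t (s z) $ i = r z $ i" using fac r(2) s(2) t(2) \<psi>Y by metis
        then have "\<Psi> (\<lambda>z. t (s z) $ i) = \<Psi> (\<lambda>z. r z $ i)" by (rule cong)
        then show ?thesis using subst[OF x s(1) tc[of i]] coord[OF x] by (simp add: f_def)
      qed
      then show ?thesis using t(2)[OF fY[OF x]] by (simp add: vec_eq_iff)
    qed
    obtain V U where VU: "zariski_dense_open V Y" "zariski_dense_open U X" "iso_onto \<pi> V U"
      using assms(5) unfolding birational_map_def by (elim exE conjE)
    have "f x = inv_into V \<pi> x" if x: "x \<in> U \<inter> ?C" for x
      using inverse_on_dense_open[OF t VU(1,3) fY, of x] \<pi>f[of x] x by simp
    then show "inverse_hereditarily_rational Y X \<pi>"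
      unfolding inverse_hereditarily_rational_def using fR VU by blast
  qed
qed

end
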